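(* The centralizer of the subalgebra $H(m,1,n-1)$ in the algebra $H(m,1,n)$ is commutative and is generated by the center of $H(m,1,n-1)$ and the Jucys--Murphy element $J_n$. Moreover, the subalgebra generated by the Jucys--Murphy elements $J_1,\dots,J_n$ of the algebra $H(m,1,n)$ is maximal commutative.
   Context: Parameters. Let $m,n\ge 1$. Either $K=\mathbb{C}(q,v_1,\dots,v_m)$ with $q,v_1,\dots,v_m$ indeterminates, or $K=\mathbb{C}$ and $q,v_1,\dots,v_m\in\mathbb{C}$, $q\neq0$, satisfy: $1+q^2+\dots+q^{2N}\neq0$ for all non-negative integers $N<n$; $q^{2i}v_j-v_k\neq0$ for all $i,j,k$ with $j\neq k$ and $-n<i<n$; $v_j\neq0$ for all $j=1,\dots,m$. Cyclotomic Hecke algebra. $H(m,1,n)$ is the associative unital $K$-algebra generated by $\tau,\sigma_1,\dots,\sigma_{n-1}$ with defining relations $\sigma_i\sigma_{i+1}\sigma_i=\sigma_{i+1}\sigma_i\sigma_{i+1}$; $\sigma_i\sigma_j=\sigma_j\sigma_i$ if $|i-j|>1$; $\tau\sigma_1\tau\sigma_1=\sigma_1\tau\sigma_1\tau$; $\tau\sigma_i=\sigma_i\tau$ for $i>1$; $\sigma_i^2=(q-q^{-1})\sigma_i+1$; $(\tau-v_1)\cdots(\tau-v_m)=0$. $H(m,1,0)=K$; $H(m,1,n-1)$ is identified with the subalgebra of $H(m,1,n)$ generated by $\tau,\sigma_1,\dots,\sigma_{n-2}$. The Jucys--Murphy elements are $J_1=\tau$, $J_{i+1}=\sigma_iJ_i\sigma_i$,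 $i=1,\dots,n-1$.
   Formalization: In the case K = C with n ≥ 2 the condition q² ≠ 1 is added; the listed conditions allow q = ±1, where the claim fails (e.g. m = 1, n = 2, q = 1: J_1 = J_2 = v_1 generate only C inside a 2-dimensional commutative algebra). *)

theory Defs
  imports
    Complex_Main
    "HOL-Algebra.Generated_Rings"
    "HOL-Algebra.QuotRing"
    "HOL-Library.Poly_Mapping"
    "HOL-Library.Option_ord"
    "HOL-Computational_Algebra.Fraction_Field"
begin

section \<open>Free associative algebras\<close>

text \<open>The elements are the finitely supported functions from words over the alphabet \<open>G\<close>
  to the coefficient field; words that use a letter outside \<open>G\<close> have coefficient zero.\<close>

definition free_algebra :: "'g set \<Rightarrow> ('g list \<Rightarrow> 'k::field) ring" where
  "free_algebra G =
    \<lparr>carrier = {f. finite {w. f w \<noteq> 0} \<and> (\<forall>w. f w \<noteq> 0 \<longrightarrow> set w \<subseteq> G)},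
     mult = (\<lambda>f g w. \<Sum>i\<le>length w. f (take i w) * g (drop i w)),
     one = (\<lambda>w. if w = [] then 1 else 0),
     zero = (\<lambda>w. 0),
     add = (\<lambda>f g w. f w + g w)\<rparr>"

definition free_scalar :: "'k \<Rightarrow> 'g list \<Rightarrow> 'k::field" where
  "free_scalar c = (\<lambda>w. if w = [] then c else 0)"

definition free_gen :: "'g \<Rightarrow> 'g list \<Rightarrow> 'k::field" where
  "free_gen x = (\<lambda>w. if w = [x] then 1 else 0)"

lemma free_algebra_mult_closed:
  assumes "f \<in> carrier (free_algebra G)" "g \<in> carrier (free_algebra G)"
  shows "f \<otimes>\<^bsub>free_algebra G\<^esub> g \<in> carrier (free_algebra G)"
proof -
  let ?h = "\<lambda>w. \<Sum>i\<le>length w. f (take i w) * g (drop i w)"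
  have ex: "\<exists>u v. w = u @ v \<and> f u \<noteq> 0 \<and> g v \<noteq> 0" if nz: "?h w \<noteq> 0" for w
  proof -
    obtain i where "f (take i w) * g (drop i w) \<noteq> 0"
      using sum.not_neutral_contains_not_neutral[OF nz] by blast
    then show ?thesis
      by (intro exI[of _ "take i w"] exI[of _ "drop i w"]) auto
  qed
  have "{w. ?h w \<noteq> 0} \<subseteq> (\<lambda>(u, v). u @ v) ` ({u. f u \<noteq> 0} \<times> {v. g v \<noteq> 0})"
    using ex by fast
  moreover have "finite ({u. f u \<noteq> 0} \<times> {v. g v \<noteq> 0})"
    using assms by (simp add: free_algebra_def)
  ultimately have "finite {w. ?h w \<noteq> 0}"
    by (meson finite_imageI finite_subset)
  moreover have "set w \<subseteq> G" if h: "?h w \<noteq> 0" for w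
  proof -
    obtain u v where "w = u @ v" "f u \<noteq> 0" "g v \<noteq> 0"
      using ex[OF h] by blast
    then show ?thesis
      using assms by (auto simp: free_algebra_def)
  qed
  ultimately show ?thesis
    unfolding free_algebra_def by simp
qed

lemma free_algebra_mult_assoc:
  fixes f g h :: "'g list \<Rightarrow> 'k::field"
  shows "(f \<otimes>\<^bsub>free_algebra G\<^esub> g) \<otimes>\<^bsub>free_algebra G\<^esub> h =
   f \<otimes>\<^bsub>free_algebra G\<^esub> (g \<otimes>\<^bsub>free_algebra G\<^esub> h)"
proof
  fix w :: "'g list"
  let ?n = "length w"
  have "((f \<otimes>\<^bsub>free_algebra G\<^esub> g) \<otimes>\<^bsub>free_algebra G\<^esub> h) w
      = (\<Sum>i\<le>?n. \<Sum>j\<le>i. f (take j w) * g (take (i - j) (drop j w)) * h (drop i w))"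
  proof -
    have "(\<Sum>j\<le>length (take i w). f (take j (take i w)) * g (drop j (take i w))) * h (drop i w)
        = (\<Sum>j\<le>i. f (take j w) * g (take (i - j) (drop j w)) * h (drop i w))"
      if "i \<le> ?n" for i
      unfolding sum_distrib_right
      by (rule sum.cong) (use that in \<open>auto simp: drop_take min_def\<close>)
    then show ?thesis
      by (simp add: free_algebra_def)
  qed
  also have "\<dots> = (\<Sum>(i, j)\<in>(SIGMA i:{..?n}. {..i}).
      f (take j w) * g (take (i - j) (drop j w)) * h (drop i w))"
    by (simp add: sum.Sigma)
  also have "\<dots> = (\<Sum>(j, k)\<in>(SIGMA j:{..?n}. {..?n - j}).
      f (take j w) * g (take k (drop j w)) * h (drop (j + k) w))"
    by (rule sum.reindex_bij_witness[of _ "\<lambda>(j, k). (j + k, j)" "\<lambda>(i, j). (j, i - j)"]) auto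
  also have "\<dots> = (\<Sum>j\<le>?n. \<Sum>k\<le>?n - j.
      f (take j w) * g (take k (drop j w)) * h (drop (j + k) w))"
    by (simp add: sum.Sigma)
  also have "\<dots> = (f \<otimes>\<^bsub>free_algebra G\<^esub> (g \<otimes>\<^bsub>free_algebra G\<^esub> h)) w"
    by (simp add: free_algebra_def sum_distrib_left add.commute mult.assoc)
  finally show "((f \<otimes>\<^bsub>free_algebra G\<^esub> g) \<otimes>\<^bsub>free_algebra G\<^esub> h) w
      = (f \<otimes>\<^bsub>free_algebra G\<^esub> (g \<otimes>\<^bsub>free_algebra G\<^esub> h)) w" .
qed

lemma free_algebra_one:
  "\<one>\<^bsub>free_algebra G\<^esub> \<otimes>\<^bsub>free_algebra G\<^esub> f = f"
  "f \<otimes>\<^bsub>free_algebra G\<^esub> \<one>\<^bsub>free_algebra G\<^esub> = f"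
proof -
  have "(\<Sum>i\<le>length w. (if take i w = [] then 1 else 0) * f (drop i w)) = f w" for w
  proof -
    have "(\<Sum>i\<le>length w. (if take i w = [] then 1 else 0) * f (drop i w))
        = (\<Sum>i\<le>length w. if i = 0 then f w else 0)"
      by (rule sum.cong) auto
    then show ?thesis by simp
  qed
  then show "\<one>\<^bsub>free_algebra G\<^esub> \<otimes>\<^bsub>free_algebra G\<^esub> f = f"
    by (simp add: free_algebra_def)
  have "(\<Sum>i\<le>length w. f (take i w) * (if drop i w = [] then 1 else 0)) = f w" for w
  proof -
    have "(\<Sum>i\<le>length w. f (take i w) * (if drop i w = [] then 1 else 0))
        = (\<Sum>i\<le>length w. if i = length w then f w else 0)"
      by (rule sum.cong) auto
    then show ?thesis by simp
  qed
  then show "f \<otimes>\<^bsub>free_algebra G\<^esub> \<one>\<^bsub>free_algebra G\<^esub> = f"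
    by (simp add: free_algebra_def)
qed

lemma free_algebra_add_closed:
  assumes "f \<in> carrier (free_algebra G)" "g \<in> carrier (free_algebra G)"
  shows "f \<oplus>\<^bsub>free_algebra G\<^esub> g \<in> carrier (free_algebra G)"
proof -
  have "{w. f w + g w \<noteq> 0} \<subseteq> {w. f w \<noteq> 0} \<union> {w. g w \<noteq> 0}"
    by auto
  then have "finite {w. f w + g w \<noteq> 0}"
    using assms by (auto simp: free_algebra_def intro: finite_subset)
  moreover have "set w \<subseteq> G" if "f w + g w \<noteq> 0" for w
  proof -
    have "f w \<noteq> 0 \<or> g w \<noteq> 0" using that by auto
    then show ?thesis using assms by (auto simp: free_algebra_def)
  qed
  ultimately show ?thesis
    by (simp add: free_algebra_def)
qed

lemma free_algebra_ring: "ring (free_algebra G :: ('g list \<Rightarrow> 'k::field) ring)"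
proof (rule ringI)
  show "abelian_group (free_algebra G :: ('g list \<Rightarrow> 'k) ring)"
  proof (rule abelian_groupI)
    fix f :: "'g list \<Rightarrow> 'k"
    assume f: "f \<in> carrier (free_algebra G)"
    then have "(\<lambda>w. - f w) \<in> carrier (free_algebra G)"
      by (simp add: free_algebra_def)
    moreover have "(\<lambda>w. - f w) \<oplus>\<^bsub>free_algebra G\<^esub> f = \<zero>\<^bsub>free_algebra G\<^esub>"
      by (simp add: free_algebra_def)
    ultimately show "\<exists>g\<in>carrier (free_algebra G). g \<oplus>\<^bsub>free_algebra G\<^esub> f = \<zero>\<^bsub>free_algebra G\<^esub>"
      by blast
  qed (simp_all add: free_algebra_add_closed, simp_all add: free_algebra_def add_ac)
  show "Group.monoid (free_algebra G :: ('g list \<Rightarrow> 'k) ring)"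
  proof (rule monoidI)
    show "\<one>\<^bsub>free_algebra G\<^esub> \<in> carrier (free_algebra G :: ('g list \<Rightarrow> 'k) ring)"
      by (simp add: free_algebra_def)
  qed (simp_all add: free_algebra_mult_closed free_algebra_mult_assoc free_algebra_one)
qed (simp_all add: free_algebra_def distrib_left distrib_right sum.distrib)


section \<open>Subalgebras and centralizers\<close>

text \<open>An algebra is a ring \<open>R\<close> together with the set \<open>K\<close> of its scalars, the image
  of the coefficient field; a subalgebra is then a subring containing \<open>K\<close>.\<close>

definition generated_subalgebra :: "'a set \<Rightarrow> ('a, 'b) ring_scheme \<Rightarrow> 'a set \<Rightarrow> 'a set" where
  "generated_subalgebra K R S = generate_ring R (K \<union> S)"

definition centralizer :: "('a, 'b) ring_scheme \<Rightarrow> 'a set \<Rightarrow> 'a set" where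
  "centralizer R A = {x \<in> carrier R. \<forall>a\<in>A. x \<otimes>\<^bsub>R\<^esub> a = a \<otimes>\<^bsub>R\<^esub> x}"

definition center_of :: "('a, 'b) ring_scheme \<Rightarrow> 'a set \<Rightarrow> 'a set" where
  "center_of R A = {x \<in> A. \<forall>a\<in>A. x \<otimes>\<^bsub>R\<^esub> a = a \<otimes>\<^bsub>R\<^esub> x}"

definition maximal_commutative :: "'a set \<Rightarrow> ('a, 'b) ring_scheme \<Rightarrow> 'a set \<Rightarrow> bool" where
  "maximal_commutative K R A \<longleftrightarrow>
     subcring A R \<and> K \<subseteq> A \<and> (\<forall>B. subcring B R \<and> K \<subseteq> B \<and> A \<subseteq> B \<longrightarrow> B = A)"


section \<open>The cyclotomic Hecke algebra\<close>

text \<open>The number \<open>m\<close> is the cardinality of the index type \<open>'m\<close>; the linear order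
  on \<open>'m\<close> serves to order the factors of the cyclotomic relation.\<close>

datatype hecke_gen = Tau | Sigma nat

definition hecke_gens :: "nat \<Rightarrow> hecke_gen set" where
  "hecke_gens n = (if n = 0 then {} else insert Tau (Sigma ` {1..<n}))"

definition hecke_relations ::
  "'k::field \<Rightarrow> ('m::{finite,linorder} \<Rightarrow> 'k) \<Rightarrow> nat \<Rightarrow>
   ((hecke_gen list \<Rightarrow> 'k) \<times> (hecke_gen list \<Rightarrow> 'k)) set" where
  "hecke_relations q v n =
    (let F = free_algebra (hecke_gens n);
         t = free_gen Tau;
         s = (\<lambda>i. free_gen (Sigma i))
     in {(s i \<otimes>\<^bsub>F\<^esub> s (i + 1) \<otimes>\<^bsub>F\<^esub> s i, s (i + 1) \<otimes>\<^bsub>F\<^esub> s i \<otimes>\<^bsub>F\<^esub> s (i + 1)) | i.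
            1 \<le> i \<and> i + 1 < n}
      \<union> {(s i \<otimes>\<^bsub>F\<^esub> s j, s j \<otimes>\<^bsub>F\<^esub> s i) | i j.
            1 \<le> i \<and> i < n \<and> 1 \<le> j \<and> j < n \<and> \<bar>int i - int j\<bar> > 1}
      \<union> (if 1 < n
          then {(t \<otimes>\<^bsub>F\<^esub> s 1 \<otimes>\<^bsub>F\<^esub> t \<otimes>\<^bsub>F\<^esub> s 1, s 1 \<otimes>\<^bsub>F\<^esub> t \<otimes>\<^bsub>F\<^esub> s 1 \<otimes>\<^bsub>F\<^esub> t)} else {})
      \<union> {(t \<otimes>\<^bsub>F\<^esub> s i, s i \<otimes>\<^bsub>F\<^esub> t) | i. 1 < i \<and> i < n}
      \<union> {(s i \<otimes>\<^bsub>F\<^esub> s i, free_scalar (q - inverse q) \<otimes>\<^bsub>F\<^esub> s i \<oplus>\<^bsub>F\<^esub> \<one>\<^bsub>F\<^esub>) | i.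
            1 \<le> i \<and> i < n}
      \<union> (if 1 \<le> n
          then {(foldr (\<lambda>j p. (t \<ominus>\<^bsub>F\<^esub> free_scalar (v j)) \<otimes>\<^bsub>F\<^esub> p) (sorted_list_of_set UNIV) \<one>\<^bsub>F\<^esub>,
                 \<zero>\<^bsub>F\<^esub>)} else {}))"

definition hecke_ideal ::
  "'k::field \<Rightarrow> ('m::{finite,linorder} \<Rightarrow> 'k) \<Rightarrow> nat \<Rightarrow> (hecke_gen list \<Rightarrow> 'k) set" where
  "hecke_ideal q v n =
    Idl\<^bsub>free_algebra (hecke_gens n)\<^esub>
      {l \<ominus>\<^bsub>free_algebra (hecke_gens n)\<^esub> r | l r. (l, r) \<in> hecke_relations q v n}"

definition hecke ::
  "'k::field \<Rightarrow> ('m::{finite,linorder} \<Rightarrow> 'k) \<Rightarrow> nat \<Rightarrow> (hecke_gen list \<Rightarrow> 'k) set ring" where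
  "hecke q v n = free_algebra (hecke_gens n) Quot hecke_ideal q v n"

lemma hecke_relations_carrier:
  assumes "(l, r) \<in> hecke_relations q v n"
  shows "l \<in> carrier (free_algebra (hecke_gens n))"
    and "r \<in> carrier (free_algebra (hecke_gens n))"
proof -
  define F :: "(hecke_gen list \<Rightarrow> 'a) ring" where "F = free_algebra (hecke_gens n)"
  interpret F: ring F
    unfolding F_def by (rule free_algebra_ring)
  have gen: "free_gen x \<in> carrier F" if "x \<in> hecke_gens n" for x
    using that by (auto simp: F_def free_algebra_def free_gen_def)
  have scalar: "free_scalar c \<in> carrier F" for c
    by (auto simp: F_def free_algebra_def free_scalar_def)
  have s: "free_gen (Sigma i) \<in> carrier F" if "1 \<le> i" "i < n" for i
    using that by (intro gen) (auto simp: hecke_gens_def)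
  have t: "free_gen Tau \<in> carrier F" if "1 \<le> n"
    using that by (intro gen) (auto simp: hecke_gens_def)
  have cyc: "foldr (\<lambda>j p. (free_gen Tau \<ominus>\<^bsub>F\<^esub> free_scalar (v j)) \<otimes>\<^bsub>F\<^esub> p) js \<one>\<^bsub>F\<^esub> \<in> carrier F"
    if "1 \<le> n" for js
    by (induction js) (use t[OF that] scalar in auto)
  have "l \<in> carrier F \<and> r \<in> carrier F"
    using assms unfolding hecke_relations_def Let_def F_def[symmetric]
    by (auto split: if_splits intro!: F.m_closed F.a_closed s t scalar cyc)
  then show "l \<in> carrier (free_algebra (hecke_gens n))"
    and "r \<in> carrier (free_algebra (hecke_gens n))"
    by (simp_all add: F_def)
qed

lemma hecke_ideal_ideal: "ideal (hecke_ideal q v n) (free_algebra (hecke_gens n))"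
proof -
  interpret F: ring "free_algebra (hecke_gens n) :: (hecke_gen list \<Rightarrow> 'a) ring"
    by (rule free_algebra_ring)
  show ?thesis
    unfolding hecke_ideal_def
    by (rule F.genideal_ideal) (auto dest: hecke_relations_carrier)
qed

lemma hecke_ring: "ring (hecke q v n)"
  unfolding hecke_def by (rule ideal.quotient_is_ring[OF hecke_ideal_ideal])

definition hecke_class ::
  "'k::field \<Rightarrow> ('m::{finite,linorder} \<Rightarrow> 'k) \<Rightarrow> nat \<Rightarrow> (hecke_gen list \<Rightarrow> 'k) \<Rightarrow>
   (hecke_gen list \<Rightarrow> 'k) set" where
  "hecke_class q v n f = hecke_ideal q v n +>\<^bsub>free_algebra (hecke_gens n)\<^esub> f"

definition hecke_scalars ::
  "'k::field \<Rightarrow> ('m::{finite,linorder} \<Rightarrow> 'k) \<Rightarrow> nat \<Rightarrow> (hecke_gen list \<Rightarrow> 'k) set set" where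
  "hecke_scalars q v n = range (\<lambda>c. hecke_class q v n (free_scalar c))"

abbreviation tau ::
  "'k::field \<Rightarrow> ('m::{finite,linorder} \<Rightarrow> 'k) \<Rightarrow> nat \<Rightarrow> (hecke_gen list \<Rightarrow> 'k) set" where
  "tau q v n \<equiv> hecke_class q v n (free_gen Tau)"

abbreviation sigma ::
  "'k::field \<Rightarrow> ('m::{finite,linorder} \<Rightarrow> 'k) \<Rightarrow> nat \<Rightarrow> nat \<Rightarrow> (hecke_gen list \<Rightarrow> 'k) set" where
  "sigma q v n i \<equiv> hecke_class q v n (free_gen (Sigma i))"

text \<open>The copy of \<open>H(m,1,k)\<close> inside \<open>H(m,1,n)\<close>, for \<open>k \<le> n\<close>; for \<open>k = 0\<close> it consists of
  the scalars.\<close>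

definition hecke_sub ::
  "'k::field \<Rightarrow> ('m::{finite,linorder} \<Rightarrow> 'k) \<Rightarrow> nat \<Rightarrow> nat \<Rightarrow> (hecke_gen list \<Rightarrow> 'k) set set" where
  "hecke_sub q v n k =
    generated_subalgebra (hecke_scalars q v n) (hecke q v n)
      ((\<lambda>x. hecke_class q v n (free_gen x)) ` hecke_gens k)"

text \<open>The index of the Jucys--Murphy elements starts at 1; the value at 0 is not used.\<close>

fun jucys_murphy ::
  "'k::field \<Rightarrow> ('m::{finite,linorder} \<Rightarrow> 'k) \<Rightarrow> nat \<Rightarrow> nat \<Rightarrow> (hecke_gen list \<Rightarrow> 'k) set" where
  "jucys_murphy q v n 0 = undefined"
| "jucys_murphy q v n (Suc 0) = tau q v n"
| "jucys_murphy q v n (Suc (Suc i)) =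
     sigma q v n (Suc i) \<otimes>\<^bsub>hecke q v n\<^esub> jucys_murphy q v n (Suc i)
       \<otimes>\<^bsub>hecke q v n\<^esub> sigma q v n (Suc i)"


section \<open>The two kinds of parameters\<close>

text \<open>The field of rational functions over the complex numbers in the indeterminates
  \<open>q\<close> (index \<open>None\<close>) and \<open>v\<^sub>j\<close> (index \<open>Some j\<close>).\<close>

type_synonym 'm rat_fun = "(('m option \<Rightarrow>\<^sub>0 nat) \<Rightarrow>\<^sub>0 complex) fract"

definition indet :: "'m::{finite,linorder} option \<Rightarrow> 'm rat_fun" where
  "indet x = Fract (Poly_Mapping.single (Poly_Mapping.single x 1) 1) 1"

text \<open>The last conjunct is not implied by the others: \<open>q = 1\<close> and \<open>q = -1\<close> satisfy the
  remaining conditions for suitable \<open>v\<close>.  For \<open>n \<ge> 2\<close> these two values must be excluded,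
  since then \<open>\<sigma>\<^sub>i\<^sup>2 = 1\<close> and all \<open>J\<^sub>i\<close> are conjugate to \<open>\<tau>\<close>, so that the \<open>J\<^sub>i\<close> generate too
  small an algebra; e.g. for \<open>m = 1\<close> they are all equal to the scalar \<open>v\<^sub>1\<close>.\<close>

definition admissible :: "nat \<Rightarrow> complex \<Rightarrow> ('m::{finite,linorder} \<Rightarrow> complex) \<Rightarrow> bool" where
  "admissible n q v \<longleftrightarrow>
     q \<noteq> 0 \<and>
     (\<forall>N<n. (\<Sum>k\<le>N. q ^ (2 * k)) \<noteq> 0) \<and>
     (\<forall>(i::int) j k. j \<noteq> k \<and> - int n < i \<and> i < int n \<longrightarrow> q powi (2 * i) * v j - v k \<noteq> 0) \<and>
     (\<forall>j. v j \<noteq> 0) \<and>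
     (n = 1 \<or> q ^ 2 \<noteq> 1)"

end

theory Submission
  imports
    Defs
    "HOL-Computational_Algebra.Polynomial"
    "HOL-Library.Function_Algebras"
begin

text \<open>
  Only the defining relations are used; neither the dimension nor the irreducible representations
  of the Hecke algebra are needed.  Induction on \<open>k\<close> shows that, on each joint eigenvector of
  \<open>J\<^sub>1, \<dots>, J\<^sub>k\<close>, the element \<open>J\<^sub>k\<^sub>+\<^sub>1\<close> is annihilated by a polynomial whose roots are the
  contents of the addable boxes of a multipartition.  The parameters make these roots distinct, so
  that Lagrange interpolation yields orthogonal idempotents \<open>e p\<close> with sum \<open>1\<close>, indexed by standard
  multitableaux \<open>p\<close> (some of them might vanish).  The sum over all \<open>p\<close> of a fixed shape is central,
  and a Mackey decomposition \<open>H\<^sub>k\<^sub>+\<^sub>1 = H\<^sub>k[J\<^sub>k\<^sub>+\<^sub>1] + H\<^sub>k \<sigma>\<^sub>k H\<^sub>k[J\<^sub>k\<^sub>+\<^sub>1]\<close> shows that every corner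
  \<open>e p H e p\<close> consists of multiples of \<open>e p\<close>.  Hence an element commuting with all \<open>J\<^sub>i\<close> is a
  combination of the \<open>e p\<close>; if it commutes with \<open>H\<^sub>n\<^sub>-\<^sub>1\<close>, its coefficient at \<open>p\<close> depends only on the
  shape of the first \<open>n - 1\<close> boxes and on the last box, because tableaux of the same shape are
  connected by swaps of consecutive boxes.
\<close>

section \<open>Algebras with central scalars\<close>

text \<open>The hard point is that the roots are no more than the addable contents. On a joint
  eigenvector where \<open>X k\<close> has the value \<open>a\<close>, the square of the intertwiner
  \<open>U\<close> is minus a quadratic polynomial in \<open>X (Suc k)\<close> with roots
  \<open>q^2 a\<close> and \<open>q^-2 a\<close>, so the values of \<open>X (Suc k)\<close> are
  confined to the old addable contents and these two. Equal successive values would give a Jordan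
  block of \<open>X k\<close>, although its roots are simple; a sequence of contents
  \<open>b, c, b\<close> with \<open>b\<close> and \<open>c\<close> adjacent would give a common
  eigenvector of two neighbouring \<open>s i\<close> with different eigenvalues, against the braid
  relation. The second argument sees only the last boxes, hence annihilation is proved
  simultaneously for all tableaux of a shape, whose idempotents the intertwiners connect within
  \<open>H k\<close>. Since idempotents may vanish, only explicit scalars are ever cancelled, and
  the parameters make these nonzero. All this happens in a type of class \<open>ring_1\<close>; the
  quotient of the free algebra, a carrier set depending on the parameters, is embedded into such a
  type by a faithful representation.\<close>

locale central_scalars =
  fixes emb :: "'k::field \<Rightarrow> 'a::ring_1"
  assumes emb_add: "emb (a + b) = emb a + emb b"
    and emb_mult: "emb (a * b) = emb a * emb b"
    and emb_1: "emb 1 = 1"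
    and emb_central: "x * emb a = emb a * x"
begin

definition scl :: "'k \<Rightarrow> 'a \<Rightarrow> 'a" (infixr "\<cdot>" 75)
  where "c \<cdot> x = emb c * x"

lemma emb_0: "emb 0 = 0"
  using emb_add[of 0 0] by simp

lemma emb_minus: "emb (- a) = - emb a"
  using emb_add[of a "- a"] by (simp add: emb_0 eq_neg_iff_add_eq_0 add.commute)

lemma emb_times [simp]: "emb c * x = c \<cdot> x" "x * emb c = c \<cdot> x"
  by (simp_all add: scl_def emb_central)

lemma scl_times [simp]: "(c \<cdot> x) * y = c \<cdot> (x * y)" "x * (c \<cdot> y) = c \<cdot> (x * y)"
  unfolding scl_def by (simp_all only: mult.assoc) (metis emb_central mult.assoc)

lemma scl_scl [simp]: "a \<cdot> b \<cdot> x = (a * b) \<cdot> x"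
  by (simp add: scl_def emb_mult mult.assoc del: emb_times)

lemma scl_emb [simp]: "a \<cdot> emb b = emb (a * b)"
  by (simp add: scl_def emb_mult del: emb_times)

lemma scl_1 [simp]: "1 \<cdot> x = x"
  by (simp add: scl_def emb_1 del: emb_times)

lemma scl_0 [simp]: "0 \<cdot> x = 0" "c \<cdot> 0 = 0"
  by (simp_all add: scl_def emb_0 del: emb_times)

lemma scl_minus [simp]: "(- c) \<cdot> x = - (c \<cdot> x)" "c \<cdot> (- x) = - (c \<cdot> x)"
  by (simp_all add: scl_def emb_minus del: emb_times)

lemma scl_distrib:
  "c \<cdot> (x + y) = c \<cdot> x + c \<cdot> y" "c \<cdot> (x - y) = c \<cdot> x - c \<cdot> y"
  "(a + b) \<cdot> x = a \<cdot> x + b \<cdot> x" "(a - b) \<cdot> x = a \<cdot> x - b \<cdot> x"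
proof -
  have "emb (a - b) = emb a - emb b"
    using emb_add[of a "- b"] by (simp add: emb_minus)
  then show "(a - b) \<cdot> x = a \<cdot> x - b \<cdot> x"
    by (simp add: scl_def left_diff_distrib del: emb_times)
qed (simp_all add: scl_def emb_add algebra_simps del: emb_times)

lemma scl_sum_left: "sum f I \<cdot> x = (\<Sum>i\<in>I. f i \<cdot> x)"
  by (induction I rule: infinite_finite_induct) (simp_all add: scl_distrib)

lemma scl_eq_0: "a \<cdot> x = 0 \<Longrightarrow> a \<noteq> 0 \<Longrightarrow> x = 0"
  using scl_scl[of "inverse a" a x] by simp

lemma scl_cancel: "a \<cdot> x = b \<cdot> x \<Longrightarrow> a \<noteq> b \<Longrightarrow> x = 0"
  using scl_eq_0[of "a - b" x] by (simp add: scl_distrib)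

section \<open>Generated subalgebras\<close>

inductive_set alg :: "'a set \<Rightarrow> 'a set" for S where
  scalar: "emb a \<in> alg S"
| gen: "x \<in> S \<Longrightarrow> x \<in> alg S"
| add: "x \<in> alg S \<Longrightarrow> y \<in> alg S \<Longrightarrow> x + y \<in> alg S"
| mult: "x \<in> alg S \<Longrightarrow> y \<in> alg S \<Longrightarrow> x * y \<in> alg S"

lemma alg_0: "0 \<in> alg S" and alg_1: "1 \<in> alg S"
  using alg.scalar[of 0 S] alg.scalar[of 1 S] by (simp_all add: emb_0 emb_1)

lemma alg_scl: "x \<in> alg S \<Longrightarrow> c \<cdot> x \<in> alg S"
  using alg.mult[OF alg.scalar[of c]] by fastforce

lemma alg_uminus: "x \<in> alg S \<Longrightarrow> - x \<in> alg S"
  using alg_scl[of x S "-1"] by simp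

lemma alg_diff: "x \<in> alg S \<Longrightarrow> y \<in> alg S \<Longrightarrow> x - y \<in> alg S"
  using alg.add[OF _ alg_uminus] by fastforce

lemma alg_sum: "(\<And>i. i \<in> I \<Longrightarrow> f i \<in> alg S) \<Longrightarrow> sum f I \<in> alg S"
  by (induction I rule: infinite_finite_induct) (auto intro: alg_0 alg.add)

lemma alg_subset:
  assumes "S \<subseteq> alg T"
  shows "alg S \<subseteq> alg T"
proof
  fix x assume "x \<in> alg S"
  then show "x \<in> alg T"
    by induction (use assms in \<open>auto intro: alg.intros\<close>)
qed

lemma alg_mono: "S \<subseteq> T \<Longrightarrow> alg S \<subseteq> alg T"
  by (rule alg_subset) (auto intro: alg.gen)

lemma alg_commute:
  assumes "x \<in> alg S" "\<And>y. y \<in> S \<Longrightarrow> z * y = y * z"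
  shows "z * x = x * z"
  using assms(1)
proof induction
  case (mult x y)
  then show ?case by (metis mult.assoc)
qed (simp_all add: assms(2) distrib_left distrib_right)

lemma alg_commutative:
  assumes "x \<in> alg S" "y \<in> alg S" "\<And>a b. a \<in> S \<Longrightarrow> b \<in> S \<Longrightarrow> a * b = b * a"
  shows "x * y = y * x"
  by (rule alg_commute[OF assms(2)], rule sym, rule alg_commute[OF assms(1)]) (use assms(3) in auto)

text \<open>The induction shows \<open>x * m \<in> M\<close> for every \<open>m \<in> M\<close>, so
  \<open>M\<close> need not be closed under multiplication. This suits a spanning set such as
  \<open>mackey\<close>.\<close>

lemma alg_left_induct:
  assumes "x \<in> alg S" "1 \<in> M"
    and add: "\<And>x y. x \<in> M \<Longrightarrow> y \<in> M \<Longrightarrow> x + y \<in> M"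
    and scalar: "\<And>a x. x \<in> M \<Longrightarrow> a \<cdot> x \<in> M"
    and gen: "\<And>g x. g \<in> S \<Longrightarrow> x \<in> M \<Longrightarrow> g * x \<in> M"
  shows "x \<in> M"
proof -
  have "x * m \<in> M" if "m \<in> M" for m
    using assms(1) that
    by (induction arbitrary: m) (auto simp: mult.assoc distrib_right intro: scalar add gen)
  from this[OF \<open>1 \<in> M\<close>] show ?thesis by simp
qed

lemma fix_pass:
  assumes "z * W = W * z" "z * g = (g :: 'a)"
  shows "z * (W * g) = W * g"
  by (metis assms mult.assoc)

lemma fix_zero:
  assumes "W * z = 0" "z * g = (g :: 'a)"
  shows "W * g = 0"
  by (metis assms mult.assoc mult_zero_left)

lemma eigen_pass:
  assumes "W * z = z * W" "W * g = a \<cdot> g"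
  shows "W * (z * g) = a \<cdot> (z * g)"
  by (metis assms mult.assoc scl_times(2))

subsection \<open>Polynomials evaluated at an element\<close>

text \<open>Coefficients lie in the field and the argument in a noncommutative algebra, so Horner's
  scheme is run through \<open>emb\<close>.\<close>

definition pev :: "'a \<Rightarrow> 'k poly \<Rightarrow> 'a" where
  "pev X = (\<lambda>P. fold_coeffs (\<lambda>a y. emb a + X * y) P 0)"

lemma pev_0 [simp]: "pev X 0 = 0"
  by (simp add: pev_def)

lemma pev_pCons [simp]: "pev X (pCons a P) = emb a + X * pev X P"
  by (cases "a = 0 \<and> P = 0") (auto simp: pev_def emb_0)

lemma pev_1 [simp]: "pev X 1 = 1"
  using pev_pCons[of X 1 0] by (simp add: one_pCons emb_1 del: pev_pCons)

lemma pev_add: "pev X (P + Q) = pev X P + pev X Q"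
proof (induction P arbitrary: Q)
  case (pCons a P)
  then show ?case by (cases Q) (simp add: emb_add distrib_left)
qed simp

lemma pev_smult: "pev X (smult a P) = a \<cdot> pev X P"
  by (induction P) (simp_all add: scl_distrib)

lemma pev_mult: "pev X (P * Q) = pev X P * pev X Q"
  by (induction P)
     (simp_all add: pev_add pev_smult emb_0 distrib_right mult.assoc)

lemma pev_sum: "pev X (sum P I) = (\<Sum>i\<in>I. pev X (P i))"
  by (induction I rule: infinite_finite_induct) (simp_all add: pev_add)

lemma pev_in_alg: "X \<in> alg S \<Longrightarrow> pev X P \<in> alg S"
  by (induction P) (auto intro: alg.intros alg_0)

lemma pev_commute:
  assumes "z * X = X * z"
  shows "z * pev X P = pev X P * z"
  by (rule alg_commute[of _ "{X}"]) (auto intro: pev_in_alg alg.gen assms)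

text \<open>With \<open>W = U\<close>, a polynomial in \<open>X\<close> that kills
  \<open>U * g\<close> becomes a polynomial in \<open>Y\<close> that kills
  \<open>U * (U * g)\<close>. The bound on the spectrum of the next Jucys--Murphy element starts
  here.\<close>

lemma pev_intertwine:
  assumes "W * X = Y * W"
  shows "W * pev X P = pev Y P * W"
proof (induction P)
  case (pCons a P)
  have "W * (X * pev X P) = Y * (W * pev X P)"
    by (metis assms mult.assoc)
  with pCons show ?case by (simp add: distrib_left distrib_right mult.assoc)
qed simp

lemma pev_eigen:
  assumes "X * g = c \<cdot> g"
  shows "pev X P * g = poly P c \<cdot> g"
  by (induction P) (simp_all add: assms distrib_right scl_distrib mult.assoc mult.commute)

end

section \<open>The rank two relations\<close>

text \<open>For the Jucys--Murphy elements \<open>X = J\<^sub>i\<close>, \<open>Y = J\<^sub>i\<^sub>+\<^sub>1\<close> and \<open>s = \<sigma>\<^sub>i\<close>, the element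
  \<open>U = s (X - Y) + (q - 1/q) Y\<close> exchanges \<open>X\<close> and \<open>Y\<close>.\<close>

locale rank_two = central_scalars emb for emb :: "'k::field \<Rightarrow> 'a::ring_1" +
  fixes \<delta> :: 'k and s X Y :: 'a
  assumes s_square: "s * s = \<delta> \<cdot> s + 1"
    and Y_eq: "Y = s * X * s"
    and XY: "X * Y = Y * X"
begin

definition U :: 'a where "U = s * (X - Y) + \<delta> \<cdot> Y"

lemma Ys: "Y * s = s * X + \<delta> \<cdot> Y"
proof -
  have "Y * s = s * X * (s * s)" by (simp only: Y_eq mult.assoc)
  then show ?thesis by (simp add: s_square distrib_left) (simp add: Y_eq mult.assoc)
qed

lemma sY: "s * Y = X * s + \<delta> \<cdot> Y"
proof -
  have "s * Y = (s * s) * (X * s)" by (simp only: Y_eq mult.assoc)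
  then show ?thesis by (simp add: s_square distrib_right) (simp add: Y_eq mult.assoc)
qed

lemma Xs: "X * s = s * Y - \<delta> \<cdot> Y"
  by (simp add: sY)

lemma UX: "U * X = Y * U"
proof -
  have "Y * U = (Y * s) * (X - Y) + \<delta> \<cdot> (Y * Y)"
    by (simp add: U_def distrib_left mult.assoc)
  then show ?thesis
    by (simp add: Ys U_def XY algebra_simps scl_distrib)
qed

lemma UY: "U * Y = X * U"
proof -
  have "X * U = (X * s) * (X - Y) + \<delta> \<cdot> (X * Y)"
    by (simp add: U_def distrib_left mult.assoc)
  then show ?thesis
    by (simp add: Xs U_def XY algebra_simps scl_distrib)
qed

text \<open>Where \<open>X\<close> and \<open>Y\<close> act by \<open>a\<close> and
  \<open>b\<close>, and \<open>\<delta> = q - 1/q\<close>, the right-hand side is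
  \<open>-(a - q^2 b)(a - q^-2 b)\<close>. Thus \<open>U\<close> is invertible between the two joint
  eigenspaces unless one value is \<open>q^2\<close> times the other.\<close>

lemma UU: "U * U = (\<delta> * \<delta>) \<cdot> (X * Y) - (X - Y) * (X - Y)"
proof -
  have "U * U = U * s * (X - Y) + \<delta> \<cdot> (U * Y)"
    by (subst (2) U_def) (simp add: distrib_left mult.assoc)
  also have "U * s = Y - X - \<delta> \<cdot> (X * s)"
  proof -
    have "U * s = s * (X * s) - s * (Y * s) + \<delta> \<cdot> (Y * s)"
      by (simp add: U_def algebra_simps)
    also have "s * (X * s) = Y" by (simp add: Y_eq mult.assoc)
    also have "s * (Y * s) = (s * s) * X + \<delta> \<cdot> (s * Y)"
      by (simp add: Ys distrib_left mult.assoc)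
    also have "\<dots> = X + \<delta> \<cdot> (s * X + s * Y)"
      by (simp add: s_square algebra_simps scl_distrib)
    finally show ?thesis by (simp add: Ys Xs algebra_simps scl_distrib)
  qed
  also have "U * Y = X * s * (X - Y) + \<delta> \<cdot> (X * Y)"
    by (simp add: UY) (simp add: U_def distrib_left mult.assoc)
  finally show ?thesis by (simp add: algebra_simps scl_distrib XY)
qed

lemma U_commute:
  assumes "z * s = s * z" "z * X = X * z"
  shows "z * Y = Y * z" "z * U = U * z"
proof -
  have zs: "z * (s * w) = s * (z * w)" for w by (metis assms(1) mult.assoc)
  have zX: "z * (X * w) = X * (z * w)" for w by (metis assms(2) mult.assoc)
  show zY: "z * Y = Y * z" by (simp add: Y_eq mult.assoc zs zX assms)
  show "z * U = U * z"
    by (simp add: U_def distrib_left distrib_right left_diff_distrib right_diff_distrib mult.assoc zs assms zY)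
qed

lemma s_eigen:
  assumes "X * g = a \<cdot> g" "Y * g = b \<cdot> g"
  shows "U * g = (a - b) \<cdot> (s * g) + (\<delta> * b) \<cdot> g"
proof -
  have "U * g = s * (X * g) - s * (Y * g) + \<delta> \<cdot> (Y * g)"
    by (simp add: U_def algebra_simps)
  then show ?thesis
    by (simp add: assms scl_distrib)
qed

lemma U_eigen:
  assumes "X * g = a \<cdot> g" "Y * g = b \<cdot> g"
  shows "X * (U * g) = b \<cdot> (U * g)" "Y * (U * g) = a \<cdot> (U * g)"
  by (metis UY assms(2) scl_times(2) mult.assoc, metis UX assms(1) scl_times(2) mult.assoc)

lemma UU_eigen:
  assumes "X * g = a \<cdot> g" "Y * g = b \<cdot> g"
  shows "U * (U * g) = (\<delta> * \<delta> * a * b - (a - b) * (a - b)) \<cdot> g"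
proof -
  have XYg: "X * (Y * g) = (a * b) \<cdot> g"
    by (simp add: assms mult.commute)
  have D: "(X - Y) * g = (a - b) \<cdot> g"
    by (simp add: assms scl_distrib left_diff_distrib)
  have "U * (U * g) = (\<delta> * \<delta>) \<cdot> (X * (Y * g)) - (X - Y) * ((X - Y) * g)"
    by (subst mult.assoc[symmetric]) (simp add: UU left_diff_distrib right_diff_distrib mult.assoc)
  also have "(X - Y) * ((X - Y) * g) = ((a - b) * (a - b)) \<cdot> g"
    by (simp only: D scl_times scl_scl)
  finally show ?thesis
    by (simp add: XYg scl_distrib mult.assoc)
qed

text \<open>Only the value of \<open>X\<close> is known here, so \<open>UU\<close> becomes quadratic
  in \<open>Y\<close>. For \<open>\<delta> = q - 1/q\<close> the middle coefficient is
  \<open>-(q^2 + q^-2) a\<close>, and the roots are \<open>q^2 a\<close> and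
  \<open>q^-2 a\<close>.\<close>

lemma UU_X_eigen:
  assumes Xg: "X * g = a \<cdot> g"
  shows "U * (U * g) = - (pev Y [:a * a, - (\<delta> * \<delta> + 2) * a, 1:] * g)"
proof -
  have XYg: "X * (Y * g) = a \<cdot> (Y * g)"
    by (metis XY Xg mult.assoc scl_times(2))
  have "U * (U * g) = (\<delta> * \<delta>) \<cdot> (X * (Y * g)) - (X - Y) * ((X - Y) * g)"
    by (subst mult.assoc[symmetric]) (simp add: UU left_diff_distrib right_diff_distrib mult.assoc)
  also have "\<dots> = (\<delta> * \<delta> * a) \<cdot> (Y * g) - ((a * a) \<cdot> g - a \<cdot> (Y * g) - a \<cdot> (Y * g) + Y * (Y * g))"
    by (simp add: Xg XYg left_diff_distrib right_diff_distrib scl_distrib)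
  finally have UUg: "U * (U * g) =
    (\<delta> * \<delta> * a) \<cdot> (Y * g) - ((a * a) \<cdot> g - a \<cdot> (Y * g) - a \<cdot> (Y * g) + Y * (Y * g))" .
  have two: "(2 * a) \<cdot> (Y * g) = a \<cdot> (Y * g) + a \<cdot> (Y * g)"
    by (simp only: scl_distrib(3)[symmetric] mult_2)
  show ?thesis unfolding UUg
    by (simp add: emb_1 distrib_right distrib_left scl_distrib two left_diff_distrib mult.assoc)
qed

text \<open>The identity \<open>(X - c) (s g) = - \<delta> c g\<close> says that \<open>g\<close>
  and \<open>s * g\<close> would span a Jordan block of \<open>X\<close>. Since \<open>c\<close> is
  a simple root of \<open>(x - c) P\<close>, such a block is impossible.\<close>

lemma double_eigen_zero:
  assumes Xg: "X * g = c \<cdot> g" and Yg: "Y * g = c \<cdot> g"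
    and P: "pev X P * ((X - emb c) * (s * g)) = 0" and nz: "poly P c \<noteq> 0" "\<delta> \<noteq> 0" "c \<noteq> 0"
  shows "g = 0"
proof -
  have "X * (s * g) = s * (Y * g) - \<delta> \<cdot> (Y * g)"
    by (simp add: Xs left_diff_distrib flip: mult.assoc)
  then have "(X - emb c) * (s * g) = - ((\<delta> * c) \<cdot> g)"
    by (simp add: Yg left_diff_distrib)
  with P have "(\<delta> * c * poly P c) \<cdot> g = 0"
    by (simp add: pev_eigen[OF Xg])
  then show ?thesis
    using scl_eq_0 nz by (metis mult_eq_0_iff)
qed

end

text \<open>On a common eigenvector the braid relation reads \<open>a b a = b a b\<close>. It will
  rule out a content that recurs after a single adjacent one.\<close>

lemma (in central_scalars) braid_eigen_zero:
  assumes braid: "s * r * s = r * s * r"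
    and s: "s * h = a \<cdot> h" and r: "r * h = b \<cdot> h"
    and "a * b * (a - b) \<noteq> 0"
  shows "h = 0"
proof -
  have "s * (r * (s * h)) = r * (s * (r * h))"
    using braid by (metis mult.assoc)
  then have "(a * b * a) \<cdot> h = (b * a * b) \<cdot> h"
    by (simp add: s r mult.assoc)
  moreover have "a * b * a \<noteq> b * a * b" using assms(4) by (auto simp: algebra_simps)
  ultimately show ?thesis using scl_cancel by blast
qed

section \<open>Standard multitableaux as moves of beads\<close>

text \<open>A multipartition is encoded by its Maya diagrams: \<open>(j, x) \<in> S\<close> if the edge between the
  diagonals \<open>x\<close> and \<open>x + 1\<close> of the boundary of the \<open>j\<close>-th component carries a bead.  Adding a box
  of content \<open>d\<close> moves a bead from \<open>d - 1\<close> to \<open>d\<close>.  A standard multitableau is the list of its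
  boxes (component, content), the last one added being the head of the list.\<close>

type_synonym 'm box = "'m \<times> int"

definition no_boxes :: "'m box set" where
  "no_boxes = {(j, x). x < 0}"

definition addable :: "'m box set \<Rightarrow> 'm box set" where
  "addable S = {(j, d). (j, d - 1) \<in> S \<and> (j, d) \<notin> S}"

definition add_box :: "'m box set \<Rightarrow> 'm box \<Rightarrow> 'm box set" where
  "add_box S c = insert c (S - {(fst c, snd c - 1)})"

fun shape :: "'m box list \<Rightarrow> 'm box set" where
  "shape [] = no_boxes"
| "shape (c # p) = add_box (shape p) c"

fun standard :: "'m box list \<Rightarrow> bool" where
  "standard [] \<longleftrightarrow> True"
| "standard (c # p) \<longleftrightarrow> standard p \<and> c \<in> addable (shape p)"

lemma addable_no_boxes: "addable no_boxes = {(j, 0) | j. True}"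
  by (auto simp: addable_def no_boxes_def)

text \<open>Moving a bead from \<open>d - 1\<close> to \<open>d\<close> affects the neighbouring
  places only: it can move on unless \<open>d + 1\<close> is occupied, and a bead at
  \<open>d - 2\<close> can now enter the vacated place \<open>d - 1\<close>.\<close>

lemma addable_add_box:
  assumes "(j, d) \<in> addable S"
  shows "addable (add_box S (j, d)) = (addable S - {(j, d)})
    \<union> (if (j, d + 1) \<in> S then {} else {(j, d + 1)}) \<union> (if (j, d - 2) \<in> S then {(j, d - 1)} else {})"
  using assms by (auto simp: addable_def add_box_def split: if_splits)

lemma finite_addable:
  assumes "standard (p :: 'm::finite box list)"
  shows "finite (addable (shape p))"
  using assms
proof (induction p)
  case Nil
  have "addable no_boxes = (\<lambda>j :: 'm. (j, 0)) ` UNIV" by (auto simp: addable_no_boxes)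
  then show ?case by simp
next
  case (Cons c p)
  then show ?case by (cases c) (simp add: addable_add_box)
qed

lemma addable_not_adjacent:
  assumes "(j, d) \<in> addable S" "\<bar>x - d\<bar> = 1"
  shows "(j, x) \<notin> addable S"
proof -
  consider "x = d + 1" | "x = d - 1" using assms(2) by linarith
  then show ?thesis using assms(1) by cases (auto simp: addable_def)
qed

text \<open>Each box replaces an addable content by neighbouring ones, so distances grow by at most
  one per box; the extra \<open>1\<close> within a component allows for both neighbours appearing at
  once. The parameters separate eigenvalues in exactly this range.\<close>

lemma addable_distance:
  assumes "standard p" "(j, d) \<in> addable (shape p)" "(k, x) \<in> addable (shape p)"
  shows "\<bar>d - x\<bar> \<le> int (length p) + (if j = k then 1 else 0)"
  using assms
proof (induction p arbitrary: j d k x)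
  case Nil
  then show ?case by (auto simp: addable_no_boxes)
next
  case (Cons c p)
  obtain i y where c: "c = (i, y)" by (cases c)
  have iy: "(i, y) \<in> addable (shape p)" using Cons.prems c by simp
  \<comment> \<open>Every addable box has an ancestor that was addable before: itself, or the box
    just added.\<close>
  have near: "\<exists>d'. (j, d') \<in> addable (shape p) \<and> ((j, d') \<noteq> (i, y) \<and> d = d' \<or> j = i \<and> d' = y \<and> \<bar>d - y\<bar> = 1)"
    if "(j, d) \<in> addable (shape (c # p))" for j d
    using that iy unfolding c by (auto simp: addable_add_box[OF iy] split: if_splits)
  obtain d' where d': "(j, d') \<in> addable (shape p)"
    "(j, d') \<noteq> (i, y) \<and> d = d' \<or> j = i \<and> d' = y \<and> \<bar>d - y\<bar> = 1"
    using near[OF Cons.prems(2)] by blast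
  obtain x' where x': "(k, x') \<in> addable (shape p)"
    "(k, x') \<noteq> (i, y) \<and> x = x' \<or> k = i \<and> x' = y \<and> \<bar>x - y\<bar> = 1"
    using near[OF Cons.prems(3)] by blast
  show ?case
    using Cons.IH[OF _ d'(1) x'(1)] Cons.prems(1) d'(2) x'(2)
    by (auto split: if_splits)
qed

section \<open>Exchanges of consecutive boxes\<close>

inductive swap :: "'m box list \<Rightarrow> 'm box list \<Rightarrow> bool" where
  head: "standard p \<Longrightarrow> c \<in> addable (shape p) \<Longrightarrow> b \<in> addable (shape p) \<Longrightarrow> b \<noteq> c
    \<Longrightarrow> swap (c # b # p) (b # c # p)"
| tail: "swap p r \<Longrightarrow> c \<in> addable (shape p) \<Longrightarrow> swap (c # p) (c # r)"

lemma addable_add_other: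
  assumes "b \<in> addable S" "c \<in> addable S" "b \<noteq> c"
  shows "b \<in> addable (add_box S c)" "add_box (add_box S b) c = add_box (add_box S c) b"
proof -
  obtain j d k x where [simp]: "b = (j, d)" "c = (k, x)" by (metis surj_pair)
  show "b \<in> addable (add_box S c)"
    using assms by (simp add: addable_add_box)
  show "add_box (add_box S b) c = add_box (add_box S c) b"
    using assms by (auto simp: addable_def add_box_def)
qed

lemma swap_properties:
  assumes "swap p r"
  shows "standard p \<and> standard r \<and> length r = length p \<and> shape r = shape p"
  using assms
proof induction
  case (head p c b)
  then show ?case
    using addable_add_other[of b "shape p" c] addable_add_other(1)[of c "shape p" b] by (simp del: split_paired_All)
qed simp

lemma swaps_properties:
  assumes "swap\<^sup>*\<^sup>* p r" "standard p"
  shows "standard r \<and> length r = length p \<and> shape r = shape p"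
  using assms by induction (auto dest: swap_properties)

lemma swaps_tail:
  assumes "swap\<^sup>*\<^sup>* p r" "standard p" "c \<in> addable (shape p)"
  shows "swap\<^sup>*\<^sup>* (c # p) (c # r)"
  using assms(1)
proof induction
  case (step y z)
  then have "swap (c # y) (c # z)"
    using assms(3) swaps_properties[OF step(1) assms(2)] by (intro swap.tail) auto
  with step show ?case by auto
qed simp

text \<open>A bead at \<open>d\<close> with \<open>d - 1\<close> free marks a removable box. If the
  last box \<open>b\<close> is another one, the removable box was removable before \<open>b\<close>
  was added and can be brought to the end there. It then exchanges with \<open>b\<close>, because
  the two boxes are not on equal or neighbouring diagonals of one component.\<close>

lemma removable_last:
  assumes "standard p" "(j, d) \<in> shape p" "(j, d - 1) \<notin> shape p"
  shows "\<exists>r. swap\<^sup>*\<^sup>* p ((j, d) # r)"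
  using assms
proof (induction p)
  case Nil
  then show ?case by (auto simp: no_boxes_def)
next
  case (Cons b p)
  obtain k x where b: "b = (k, x)" by (cases b)
  have kx: "(k, x) \<in> addable (shape p)" "standard p" using Cons.prems b by auto
  show ?case
  proof (cases "b = (j, d)")
    case False
    with Cons.prems have in_p: "(j, d) \<in> shape p" "(j, d) \<noteq> (k, x - 1)" "(j, d - 1) \<noteq> (k, x)" "(j, d - 1) \<notin> shape p"
      by (auto simp: b add_box_def)
    obtain r where r: "swap\<^sup>*\<^sup>* p ((j, d) # r)"
      using Cons.IH[OF _ in_p(1) in_p(4)] Cons.prems by auto
    have jd: "standard r" "(j, d) \<in> addable (shape r)" "shape p = add_box (shape r) (j, d)"
      using swaps_properties[OF r] Cons.prems by auto
    have "b \<in> addable (shape r)"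
      using kx jd in_p False unfolding b
      by (auto simp: addable_def add_box_def split: if_splits)
    then have "swap (b # (j, d) # r) ((j, d) # b # r)"
      using jd False by (intro swap.head) auto
    moreover have "swap\<^sup>*\<^sup>* (b # p) (b # (j, d) # r)"
      using swaps_tail[OF r] kx b by auto
    ultimately show ?thesis by (meson rtranclp.rtrancl_into_rtrancl)
  qed auto
qed

lemma add_box_undo:
  assumes "(j, d) \<in> addable S"
  shows "S = insert (j, d - 1) (add_box S (j, d) - {(j, d)})"
  using assms by (auto simp: addable_def add_box_def)

text \<open>The last box of \<open>p\<close> is removable from the common shape, so swaps bring it
  to the end of \<open>r\<close>; deleting it from both leaves shorter tableaux of equal
  shape.\<close>

lemma shape_eq_swaps:
  assumes "standard p" "standard r" "length p = length r" "shape p = shape r"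
  shows "swap\<^sup>*\<^sup>* r p"
  using assms
proof (induction p arbitrary: r)
  case (Cons c p)
  obtain j d where c: "c = (j, d)" by (cases c)
  have jd: "(j, d) \<in> addable (shape p)" using Cons.prems c by simp
  have "(j, d) \<in> shape r" "(j, d - 1) \<notin> shape r"
    unfolding Cons.prems(4)[symmetric] by (auto simp: c add_box_def)
  then obtain r' where r': "swap\<^sup>*\<^sup>* r (c # r')"
    using removable_last[of r j d] Cons.prems(2) c by auto
  have r'_props: "standard r'" "(j, d) \<in> addable (shape r')" "length r' = length p"
    "add_box (shape r') (j, d) = add_box (shape p) (j, d)"
    using swaps_properties[OF r'] Cons.prems by (auto simp: c)
  then have "shape p = shape r'"
    using add_box_undo jd by metis
  then have "swap\<^sup>*\<^sup>* r' p" using Cons r'_props by auto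
  then have "swap\<^sup>*\<^sup>* (c # r') (c # p)"
    using swaps_tail r'_props c by blast
  with r' show ?case by simp
qed simp

definition tableaux :: "nat \<Rightarrow> 'm box list set" where
  "tableaux k = {p. standard p \<and> length p = k}"

lemma tableaux_0: "tableaux 0 = {[]}"
  by (auto simp: tableaux_def)

lemma tableaux_Suc:
  "tableaux (Suc k) = (\<lambda>(p, c). c # p) ` (SIGMA p:tableaux k. addable (shape p))"
proof (intro Set.set_eqI iffI)
  fix r :: "'a box list" assume "r \<in> tableaux (Suc k)"
  then obtain c p where "r = c # p" "p \<in> tableaux k" "c \<in> addable (shape p)"
    by (cases r) (auto simp: tableaux_def)
  then show "r \<in> (\<lambda>(p, c). c # p) ` (SIGMA p:tableaux k. addable (shape p))" by force
qed (auto simp: tableaux_def)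

lemma finite_tableaux: "finite (tableaux k :: 'm::finite box list set)"
proof (induction k)
  case (Suc k)
  have "finite (SIGMA p:tableaux k. addable (shape (p :: 'm box list)))"
    by (intro finite_SigmaI finite_addable) (use Suc in \<open>simp_all add: tableaux_def\<close>)
  then show ?case by (simp add: tableaux_Suc)
qed (simp add: tableaux_0)

lemma sum_tableaux_Suc:
  fixes F :: "'m::finite box list \<Rightarrow> 'a::comm_monoid_add"
  shows "sum F (tableaux (Suc k)) = (\<Sum>p\<in>tableaux k. \<Sum>c\<in>addable (shape p). F (c # p))"
proof -
  have "sum F (tableaux (Suc k)) = (\<Sum>(p, c)\<in>(SIGMA p:tableaux k. addable (shape p)). F (c # p))"
    unfolding tableaux_Suc by (subst sum.reindex) (auto simp: inj_on_def case_prod_unfold)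
  also have "\<dots> = (\<Sum>p\<in>tableaux k. \<Sum>c\<in>addable (shape p). F (c # p))"
    by (intro sum.Sigma[symmetric] finite_tableaux ballI finite_addable) (simp add: tableaux_def)
  finally show ?thesis .
qed

section \<open>Contents\<close>

text \<open>The common consequences of both kinds of parameters. The sums
  \<open>1 + q^2 + ... + q^(2(d-1))\<close> are quotients of \<open>q^(2d) - 1\<close> by
  \<open>q^2 - 1\<close>, hence the form of \<open>q_power\<close>.\<close>

locale hecke_params =
  fixes q :: "'k::field" and v :: "'m::finite \<Rightarrow> 'k" and n :: nat
  assumes q_nonzero: "q \<noteq> 0"
    and q_power: "2 \<le> n \<Longrightarrow> 1 \<le> d \<Longrightarrow> d \<le> n \<Longrightarrow> q ^ (2 * d) \<noteq> 1"
    and v_nonzero: "v j \<noteq> 0"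
    and v_separated: "j \<noteq> k \<Longrightarrow> \<bar>i\<bar> < int n \<Longrightarrow> q powi (2 * i) * v j \<noteq> v k"
begin

text \<open>This will be the eigenvalue of \<open>X (length p)\<close> on
  \<open>e (c # p)\<close>.\<close>

definition val :: "'m box \<Rightarrow> 'k" where
  "val c = q powi (2 * snd c) * v (fst c)"

lemma val_nonzero: "val c \<noteq> 0"
  by (simp add: val_def q_nonzero v_nonzero)

lemma val_shift: "val (j, d + i) = q powi (2 * i) * val (j, d)"
  by (simp add: val_def distrib_left power_int_add q_nonzero)

lemma val_distinct:
  assumes "(j, d) \<noteq> (k, x)" "if j = k then \<bar>d - x\<bar> \<le> int n \<and> 2 \<le> n else \<bar>d - x\<bar> < int n"
  shows "val (j, d) \<noteq> val (k, x)"
proof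
  assume eq: "val (j, d) = val (k, x)"
  have shift: "val (j, d) = q powi (2 * (d - x)) * val (j, x)"
    using val_shift[of j x "d - x"] by simp
  show False
  proof (cases "j = k")
    case True
    with eq shift have one: "q powi (2 * (d - x)) = 1" using val_nonzero[of "(k, x)"] by auto
    have "q ^ (2 * nat \<bar>d - x\<bar>) = 1"
    proof (cases "d \<ge> x")
      case True
      then have "2 * (d - x) = int (2 * nat \<bar>d - x\<bar>)" by simp
      with one show ?thesis by (metis power_int_of_nat)
    next
      case False
      then have "2 * (d - x) = - int (2 * nat \<bar>d - x\<bar>)" by simp
      with one show ?thesis by (metis power_int_minus power_int_of_nat inverse_eq_1_iff)
    qed
    moreover have "1 \<le> nat \<bar>d - x\<bar>" "nat \<bar>d - x\<bar> \<le> n" "2 \<le> n" using assms True by auto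
    ultimately show False using q_power by blast
  next
    case False
    have "q powi (2 * x) * (q powi (2 * (d - x)) * v j) = q powi (2 * x) * v k"
      using eq[unfolded shift] by (simp only: val_def fst_conv snd_conv mult.left_commute)
    then have "q powi (2 * (d - x)) * v j = v k"
      using q_nonzero mult_left_cancel[of "q powi (2 * x)"] power_int_not_zero[of q "2 * x"] by blast
    then show False using v_separated[of j k "d - x"] False assms by simp
  qed
qed

text \<open>Addable contents of one component differ by at least 2, since a place cannot be both
  free and occupied. With the distance bound this gives
  \<open>2 \<le> \<bar>d - x\<bar> \<le> n\<close>, which also supplies the condition
  \<open>2 \<le> n\<close> of \<open>q_power\<close>.\<close>

lemma val_inj:
  assumes "standard p" "length p < n"
  shows "inj_on val (addable (shape p))"
proof (rule inj_onI, rule ccontr)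
  fix a b assume ab: "a \<in> addable (shape p)" "b \<in> addable (shape p)" "val a = val b" "a \<noteq> b"
  obtain j d k x where [simp]: "a = (j, d)" "b = (k, x)" by (metis surj_pair)
  have dist: "\<bar>d - x\<bar> \<le> int (length p) + (if j = k then 1 else 0)"
    using addable_distance[of p j d k x] assms(1) ab by simp
  moreover have "\<bar>d - x\<bar> \<ge> 2" if "j = k"
    using addable_not_adjacent[of j d "shape p" x] ab that by (cases "\<bar>x - d\<bar> = 1") auto
  ultimately show False using val_distinct[of j d k x] ab assms(2) by (auto split: if_splits)
qed

text \<open>A content next to an addable one of its component is never addable, yet remains in the
  range where eigenvalues separate. This excludes the eigenvalues that an intertwiner would produce
  at a forbidden exchange.\<close>

lemma val_adjacent:
  assumes "standard p" "length p + 2 \<le> n" "a \<in> addable (shape p)" "(j, d) \<in> addable (shape p)" "\<bar>x - d\<bar> = 1"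
  shows "val a \<noteq> val (j, x)"
proof -
  obtain k y where [simp]: "a = (k, y)" by (cases a)
  have "\<bar>y - d\<bar> \<le> int (length p) + (if k = j then 1 else 0)"
    using addable_distance[of p k y j d] assms by simp
  moreover have "(k, y) \<noteq> (j, x)" using addable_not_adjacent assms by fastforce
  ultimately show ?thesis using assms(2,5) unfolding \<open>a = (k, y)\<close>
    by (intro val_distinct) (auto split: if_splits)
qed

text \<open>Either both boxes were addable together, or \<open>c\<close> became addable through
  \<open>b\<close> and lies on a neighbouring diagonal. The inequality permits solving
  \<open>s_eigen\<close> for \<open>s * g\<close>.\<close>

lemma val_successive:
  assumes "standard (c # b # p)" "length p + 2 \<le> n"
  shows "val c \<noteq> val b"
proof -
  obtain j d where b: "b = (j, d)" by (cases b)
  have jd: "(j, d) \<in> addable (shape p)" using assms b by simp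
  have "c \<in> addable (add_box (shape p) (j, d))" using assms b by simp
  then consider "c \<in> addable (shape p)" "c \<noteq> b" | x where "c = (j, x)" "\<bar>x - d\<bar> = 1"
    unfolding addable_add_box[OF jd] b by (fastforce split: if_splits)
  then show ?thesis
  proof cases
    case 1
    then show ?thesis using val_inj[of p] assms by (auto dest: inj_onD)
  next
    case 2
    then show ?thesis using val_adjacent[of p b j d x] assms jd b by auto
  qed
qed

section \<open>Annihilating and interpolating polynomials\<close>

definition full :: "'m box set \<Rightarrow> 'k poly" where
  "full A = (\<Prod>a\<in>A. [:- val a, 1:])"

definition lagrange :: "'m box set \<Rightarrow> 'm box \<Rightarrow> 'k poly" where
  "lagrange A c = (\<Prod>a\<in>A - {c}. smult (inverse (val c - val a)) [:- val a, 1:])"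

lemma poly_full_nonzero: "x \<notin> val ` A \<Longrightarrow> poly (full A) x \<noteq> 0"
  unfolding full_def poly_prod by (cases "finite A") auto

lemma full_remove: "finite A \<Longrightarrow> c \<in> A \<Longrightarrow> full A = [:- val c, 1:] * full (A - {c})"
  unfolding full_def by (rule prod.remove)

lemma full_insert: "finite A \<Longrightarrow> c \<notin> A \<Longrightarrow> full (insert c A) = [:- val c, 1:] * full A"
  unfolding full_def by (rule prod.insert)

lemma full_lagrange: "\<exists>k. lagrange A c = smult k (full (A - {c}))"
  unfolding lagrange_def full_def prod_smult by blast

lemma poly_lagrange:
  assumes "inj_on val A" "finite A" "a \<in> A" "c \<in> A"
  shows "poly (lagrange A c) (val a) = (if a = c then 1 else 0)"
proof (cases "a = c")
  case True
  have "(\<Prod>b\<in>A - {c}. inverse (val c - val b) * (val c - val b)) = 1"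
  proof (rule prod.neutral, rule ballI)
    fix b assume "b \<in> A - {c}"
    then have "val c - val b \<noteq> 0" using assms by (auto dest: inj_onD)
    then show "inverse (val c - val b) * (val c - val b) = 1" by simp
  qed
  with True show ?thesis by (simp add: lagrange_def poly_prod del: smult_pCons)
next
  case False
  with assms show ?thesis by (auto simp: lagrange_def poly_prod)
qed

lemma sum_lagrange:
  assumes "inj_on val A" "finite A" "A \<noteq> {}"
  shows "(\<Sum>c\<in>A. lagrange A c) = 1"
proof (rule poly_eqI_degree[of "val ` A"])
  show "poly (\<Sum>c\<in>A. lagrange A c) x = poly 1 x" if "x \<in> val ` A" for x
    using that assms by (auto simp: poly_sum poly_lagrange)
  have card: "card (val ` A) = card A" "card A > 0"
    using assms by (simp_all add: card_image card_gt_0_iff)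
  have "degree (lagrange A c) \<le> card A - 1" if "c \<in> A" for c
  proof -
    have "degree (lagrange A c) \<le> (\<Sum>a\<in>A - {c}. degree (smult (inverse (val c - val a)) [:- val a, 1:]))"
      unfolding lagrange_def by (rule degree_prod_sum_le[of "A - {c}", unfolded o_def]) (use assms in auto)
    also have "\<dots> \<le> (\<Sum>a\<in>A - {c}. 1)" by (rule sum_mono) simp
    finally show ?thesis using that assms by simp
  qed
  then have "degree (\<Sum>c\<in>A. lagrange A c) \<le> card A - 1"
    by (rule degree_sum_le[OF assms(2)])
  with card show "degree (\<Sum>c\<in>A. lagrange A c) < card (val ` A)" by simp
  show "degree (1 :: 'k poly) < card (val ` A)" using card by simp
qed

end

section \<open>Joint idempotents of the Jucys--Murphy elements\<close>

locale hecke_algebra = central_scalars emb + hecke_params q v n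
  for emb :: "'k::field \<Rightarrow> 'a::ring_1" and q :: 'k and v :: "'m::finite \<Rightarrow> 'k" and n :: nat +
  fixes t :: 'a and s :: "nat \<Rightarrow> 'a"
  assumes s_square: "1 \<le> i \<Longrightarrow> i < n \<Longrightarrow> s i * s i = (q - inverse q) \<cdot> s i + 1"
    and braid: "1 \<le> i \<Longrightarrow> Suc i < n \<Longrightarrow> s i * s (Suc i) * s i = s (Suc i) * s i * s (Suc i)"
    and s_commute: "1 \<le> i \<Longrightarrow> Suc i < j \<Longrightarrow> j < n \<Longrightarrow> s i * s j = s j * s i"
    and t_braid: "1 < n \<Longrightarrow> t * s 1 * t * s 1 = s 1 * t * s 1 * t"
    and t_commute: "1 < i \<Longrightarrow> i < n \<Longrightarrow> t * s i = s i * t"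
    and t_poly: "pev t (\<Prod>j\<in>UNIV. [:- v j, 1:]) = 0"
begin

abbreviation \<delta> :: 'k where "\<delta> \<equiv> q - inverse q"

text \<open>\<open>X k\<close> is the Jucys--Murphy element \<open>J\<^sub>k\<^sub>+\<^sub>1\<close>.\<close>

primrec X :: "nat \<Rightarrow> 'a" where
  "X 0 = t"
| "X (Suc k) = s (Suc k) * X k * s (Suc k)"

declare X.simps(2) [simp del]

section \<open>The chain of subalgebras and its commutation relations\<close>

definition gens :: "nat \<Rightarrow> 'a set" where
  "gens k = (if k = 0 then {} else insert t (s ` {1..<k}))"

abbreviation H :: "nat \<Rightarrow> 'a set" where "H k \<equiv> alg (gens k)"

lemma gens_mono: "j \<le> k \<Longrightarrow> gens j \<subseteq> gens k"
  by (auto simp: gens_def)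

lemma H_mono: "j \<le> k \<Longrightarrow> H j \<subseteq> H k"
  by (rule alg_mono[OF gens_mono])

lemma s_in_H: "1 \<le> i \<Longrightarrow> i < k \<Longrightarrow> s i \<in> H k"
  by (rule alg.gen) (simp add: gens_def)

lemma X_in_H: "j < k \<Longrightarrow> X j \<in> H k"
proof (induction j)
  case 0
  then show ?case by (intro alg.gen) (simp add: gens_def)
next
  case (Suc j)
  then show ?case by (auto simp: X.simps(2) intro!: alg.mult s_in_H)
qed

lemma s_H_commute:
  assumes "x \<in> H k" "Suc k < n"
  shows "s (Suc k) * x = x * s (Suc k)"
  using assms(1)
proof (rule alg_commute)
  fix y assume "y \<in> gens k"
  then show "s (Suc k) * y = y * s (Suc k)"
    using s_commute[of _ "Suc k"] t_commute[of "Suc k"] assms(2)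
    by (auto simp: gens_def split: if_splits)
qed

lemma s_X_lower:
  assumes "1 \<le> i" "i < k" "k < n"
  shows "s i * X k = X k * s i"
  using assms
proof (induction k)
  case (Suc k)
  show ?case
  proof (cases "i = k")
    case True
    then obtain j where j: "i = Suc j" "k = Suc j" using Suc by (cases k) auto
    \<comment> \<open>With \<open>i = Suc j\<close> the Jucys--Murphy element is
      \<open>b a x a b\<close>. Sliding \<open>a\<close> through it takes the braid relation twice,
      with \<open>b x = x b\<close> in between.\<close>
    define a b x where "a = s (Suc j)" "b = s (Suc (Suc j))" "x = X j"
    have bx: "b * x = x * b" unfolding a_b_x_def
      by (rule s_H_commute) (use Suc j in \<open>auto intro: H_mono[THEN subsetD] X_in_H\<close>)
    have aba: "a * b * a = b * a * b" using braid[of "Suc j"] Suc j by (simp add: a_b_x_def)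
    have "a * (b * a * x * a * b) = (a * b * a) * x * a * b" by (simp only: mult.assoc)
    also have "\<dots> = b * a * (b * x) * a * b" unfolding aba by (simp only: mult.assoc)
    also have "\<dots> = b * a * x * (b * a * b)" unfolding bx by (simp only: mult.assoc)
    also have "\<dots> = b * a * x * a * b * a" unfolding aba[symmetric] by (simp only: mult.assoc)
    finally show ?thesis by (simp only: j a_b_x_def X.simps(2) mult.assoc)
  next
    case False
    then have sX: "s i * X k = X k * s i" and ss: "s i * s (Suc k) = s (Suc k) * s i"
      using Suc False s_commute[of i "Suc k"] by auto
    have "s i * X (Suc k) = s (Suc k) * (s i * X k) * s (Suc k)"
      by (simp only: X.simps(2) ss flip: mult.assoc)
    also have "\<dots> = s (Suc k) * X k * (s i * s (Suc k))" unfolding sX by (simp only: mult.assoc)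
    finally show ?thesis unfolding ss X.simps(2) by (simp only: mult.assoc)
  qed
qed simp

lemma t_X: "k < n \<Longrightarrow> t * X k = X k * t"
proof (induction k)
  case (Suc k)
  show ?case
  proof (cases k)
    case 0
    then show ?thesis using t_braid Suc by (simp add: X.simps(2) mult.assoc)
  next
    case (Suc j)
    then have "t * s (Suc k) = s (Suc k) * t" using t_commute Suc.prems by auto
    moreover have "t * X k = X k * t" using Suc.IH Suc.prems by simp
    ultimately show ?thesis unfolding X.simps(2) by (metis mult.assoc)
  qed
qed simp

lemma X_H_commute:
  assumes "x \<in> H k" "k < n"
  shows "X k * x = x * X k"
  using assms(1)
proof (rule alg_commute)
  fix y assume "y \<in> gens k"
  then show "X k * y = y * X k"
    using t_X[OF assms(2)] s_X_lower[of _ k] assms(2) by (auto simp: gens_def split: if_splits)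
qed

lemma X_commute:
  assumes "i < n" "j < n"
  shows "X i * X j = X j * X i"
proof (cases i j rule: linorder_cases)
  case less
  then show ?thesis using X_H_commute[OF X_in_H[of i j]] assms(2) by simp
next
  case greater
  then show ?thesis using X_H_commute[OF X_in_H[of j i]] assms(1) by simp
qed simp

lemma rank_two_X:
  assumes "Suc k < n"
  shows "rank_two emb \<delta> (s (Suc k)) (X k) (X (Suc k))"
  by unfold_locales (use assms s_square[of "Suc k"] X_commute[of k "Suc k"] in \<open>auto simp: X.simps(2)\<close>)

section \<open>Idempotents indexed by tableaux\<close>

text \<open>Intended as the projection to the joint eigenspace where \<open>X i\<close> has the
  value of the box added in step \<open>i + 1\<close>. The recursion reflects that the interpolation
  points for the next box depend on the shape reached so far.\<close>

fun e :: "'m box list \<Rightarrow> 'a" where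
  "e [] = 1"
| "e (c # p) = pev (X (length p)) (lagrange (addable (shape p)) c) * e p"

lemma e_in_alg_X: "length p \<le> k \<Longrightarrow> e p \<in> alg (X ` {..<k})"
  by (induction p) (auto intro!: alg_1 alg.mult pev_in_alg[OF alg.gen])

lemma e_in_H:
  assumes "length p \<le> k"
  shows "e p \<in> H k"
proof -
  have "alg (X ` {..<k}) \<subseteq> H k" by (rule alg_subset) (auto intro: X_in_H)
  with e_in_alg_X[OF assms] show ?thesis by blast
qed

lemma X_e_commute:
  assumes "i < n" "length p \<le> n"
  shows "X i * e p = e p * X i"
  by (rule alg_commute[OF e_in_alg_X[OF assms(2)]]) (use assms X_commute in auto)

lemma pev_full_eigen:
  assumes "finite D" "b \<in> D" "pev Y (full D) * f = 0"
  shows "Y * (pev Y (full (D - {b})) * f) = val b \<cdot> (pev Y (full (D - {b})) * f)"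
  using assms(3) unfolding full_remove[OF assms(1,2)] pev_mult
  by (simp add: emb_1 left_diff_distrib distrib_right mult.assoc)

text \<open>The induction hypothesis behind the idempotents: on the image of \<open>e p\<close> the
  next Jucys--Murphy element satisfies the polynomial of the addable boxes. It implies the
  properties of \<open>e p\<close> up to length \<open>K\<close>, and these in turn serve to pass to
  \<open>Suc K\<close>.\<close>

definition spectral :: "nat \<Rightarrow> bool" where
  "spectral K \<longleftrightarrow> (\<forall>p. standard p \<longrightarrow> length p < K \<longrightarrow>
     pev (X (length p)) (full (addable (shape p))) * e p = 0)"

text \<open>Up to a scalar, \<open>lagrange\<close> is \<open>full\<close> without its factor at
  \<open>c\<close>, so multiplying by the missing factor gives 0.\<close>

lemma X_e_head:
  assumes "spectral K" "standard (c # p)" "length p < K"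
  shows "X (length p) * e (c # p) = val c \<cdot> e (c # p)"
proof -
  obtain k where k: "lagrange (addable (shape p)) c = smult k (full (addable (shape p) - {c}))"
    using full_lagrange by blast
  have "X (length p) * (pev (X (length p)) (full (addable (shape p) - {c})) * e p)
      = val c \<cdot> (pev (X (length p)) (full (addable (shape p) - {c})) * e p)"
    by (rule pev_full_eigen) (use assms in \<open>auto simp: spectral_def finite_addable\<close>)
  then show ?thesis by (simp add: k pev_smult mult.commute)
qed

lemma e_idem:
  assumes "spectral K" "standard p" "length p \<le> K" "K \<le> n"
  shows "e p * e p = e p"
  using assms(2,3)
proof (induction p)
  case (Cons c p)
  have "e p * e (c # p) = e (c # p)"
    using Cons pev_commute[of "e p" "X (length p)" "lagrange (addable (shape p)) c"]
      X_e_commute[of "length p" p] assms(4) by (simp flip: mult.assoc) (simp add: mult.assoc)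
  then have "e (c # p) * e (c # p) = pev (X (length p)) (lagrange (addable (shape p)) c) * e (c # p)"
    by (simp add: mult.assoc)
  also have "\<dots> = poly (lagrange (addable (shape p)) c) (val c) \<cdot> e (c # p)"
    by (rule pev_eigen, rule X_e_head[OF assms(1)]) (use Cons in auto)
  also have "poly (lagrange (addable (shape p)) c) (val c) = 1"
    using Cons.prems assms(4) by (subst poly_lagrange) (auto intro: val_inj finite_addable)
  finally show ?case by simp
qed simp

lemma e_Cons_idem:
  assumes "spectral K" "standard (c # p)" "length p \<le> K" "length p < n" "K \<le> n"
  shows "e p * e (c # p) = e (c # p)"
  using e_idem[OF assms(1) _ assms(3,5)] pev_commute[of "e p" "X (length p)" "lagrange (addable (shape p)) c"]
      X_e_commute[of "length p" p] assms by (simp flip: mult.assoc) (simp add: mult.assoc)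

lemma poly_lagrange_1:
  assumes "standard (c # p)" "length p < n"
  shows "poly (lagrange (addable (shape p)) c) (val c) = 1"
  using assms by (subst poly_lagrange) (auto intro: val_inj finite_addable)

declare e.simps(2) [simp del]

lemma delta_nonzero: "2 \<le> n \<Longrightarrow> \<delta> \<noteq> 0"
  using q_power[of 1] q_nonzero by (auto simp: power2_eq_square field_simps)

lemma val_up: "val (j, d + 1) = q * q * val (j, d)" and val_down: "val (j, d - 1) = inverse (q * q) * val (j, d)"
  using val_shift[of j d 1] val_shift[of j d "-1"] by (simp_all add: power_int_minus power2_eq_square)

abbreviation U :: "nat \<Rightarrow> 'a" where
  "U k \<equiv> rank_two.U emb \<delta> (s (Suc k)) (X k) (X (Suc k))"

lemma U_in_H: "Suc k < n \<Longrightarrow> U k \<in> H (Suc (Suc k))"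
  unfolding rank_two.U_def[OF rank_two_X]
  by (intro alg.mult alg.add alg_diff alg_scl X_in_H s_in_H) auto

lemma U_e_commute:
  assumes "length p \<le> k" "Suc k < n"
  shows "e p * U k = U k * e p"
proof -
  interpret R: rank_two emb \<delta> "s (Suc k)" "X k" "X (Suc k)" by (rule rank_two_X[OF assms(2)])
  show ?thesis
  proof (rule R.U_commute)
    show "e p * s (Suc k) = s (Suc k) * e p"
      by (rule s_H_commute[OF e_in_H, symmetric]) (use assms in simp_all)
    show "e p * X k = X k * e p"
      by (rule X_e_commute[symmetric]) (use assms in simp_all)
  qed
qed

text \<open>Because \<open>U k\<close> commutes with \<open>e p\<close>, the vector
  \<open>U k * f\<close> stays in the image of \<open>e p\<close>, where \<open>X k\<close> can only
  have values of addable boxes.\<close>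

lemma pair_eigen:
  assumes "spectral K" "standard (c # b # p)" "Suc (length p) < K" "K \<le> n"
  defines "k \<equiv> length p" and "f \<equiv> e (c # b # p)"
  shows "X k * f = val b \<cdot> f" "X (Suc k) * f = val c \<cdot> f" "e p * f = f" "e p * (U k * f) = U k * f"
proof -
  have k: "Suc k < n" "k < K" "Suc k < K" using assms(3,4) by (auto simp: k_def)
  interpret R: rank_two emb \<delta> "s (Suc k)" "X k" "X (Suc k)" by (rule rank_two_X[OF k(1)])
  show "X (Suc k) * f = val c \<cdot> f"
    using X_e_head[OF assms(1,2)] k by (simp add: f_def k_def)
  have "X k * e (b # p) = val b \<cdot> e (b # p)"
    unfolding k_def by (rule X_e_head[OF assms(1)]) (use assms(2) k k_def in simp_all)
  then show "X k * f = val b \<cdot> f"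
    unfolding f_def e.simps(2)[of c]
    by (rule eigen_pass[rotated]) (use pev_commute[OF R.XY] in \<open>simp add: k_def\<close>)
  have "e p * e (b # p) = e (b # p)"
    using assms(2,4) k by (intro e_Cons_idem[OF assms(1)]) (auto simp: k_def)
  moreover have "e p * X (Suc k) = X (Suc k) * e p"
    using X_e_commute[of "Suc k" p] k by (simp add: k_def)
  ultimately show ep: "e p * f = f"
    unfolding f_def e.simps(2)[of c]
    by (intro fix_pass pev_commute) (simp_all add: k_def)
  show "e p * (U k * f) = U k * f"
    by (rule fix_pass[OF U_e_commute ep]) (use k k_def in simp_all)
qed

text \<open>\<open>U k\<close> exchanges the values of \<open>X k\<close> and
  \<open>X (Suc k)\<close>, so both interpolating factors of the exchanged tableau act on
  \<open>U k * f\<close> by 1.\<close>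

lemma pair_swap:
  assumes "spectral K" "standard (c # b # p)" "Suc (length p) < K" "K \<le> n"
    and c: "c \<in> addable (shape p)" "b \<noteq> c"
  defines "k \<equiv> length p" and "f \<equiv> e (c # b # p)"
  shows "e (b # c # p) * (U k * f) = U k * f"
proof -
  note pair = pair_eigen[OF assms(1-4), folded k_def f_def]
  have k: "Suc k < n" using assms(3,4) by (auto simp: k_def)
  interpret R: rank_two emb \<delta> "s (Suc k)" "X k" "X (Suc k)" by (rule rank_two_X[OF k])
  define y where "y = U k * f"
  have y: "X k * y = val c \<cdot> y" "X (Suc k) * y = val b \<cdot> y"
    using R.U_eigen[OF pair(1,2)] by (auto simp: y_def)
  have std: "standard (b # c # p)"
    using swap_properties[OF swap.head[of p c b]] assms(2) c by auto
  have "e (c # p) * y = y"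
    using pev_eigen[OF y(1)] pair(4) poly_lagrange_1[of c p] std k
    by (simp add: k_def y_def e.simps(2) mult.assoc)
  then show ?thesis
    using pev_eigen[OF y(2)] poly_lagrange_1[OF std] k
    by (simp add: k_def y_def e.simps(2)[of b] mult.assoc)
qed

text \<open>\<open>U k\<close> carries the image of \<open>e p\<close> into that of
  \<open>e r\<close>, and a second \<open>U k\<close> returns with the scalar
  \<open>\<kappa>\<close>; division by \<open>\<kappa>\<close> gives the factorization. Keeping both
  factors in \<open>H (length p)\<close> lets them commute with later Jucys--Murphy
  elements.\<close>

lemma swap_factor:
  assumes "swap p r" "spectral K" "length p \<le> K" "K \<le> n"
  shows "\<exists>x\<in>H (length p). \<exists>y\<in>H (length p). e p = x * e r * y"
  using assms(1,3)
proof induction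
  case (head p c b)
  define k where "k = length p"
  have k: "Suc k < n" "Suc (length p) < K" using head assms(4) by (auto simp: k_def)
  have std: "standard (c # b # p)" "standard (b # c # p)"
    using swap_properties[OF swap.head[OF head(1-4)]] by auto
  interpret R: rank_two emb \<delta> "s (Suc k)" "X k" "X (Suc k)" by (rule rank_two_X[OF k(1)])
  define f where "f = e (c # b # p)"
  note pair = pair_eigen[OF assms(2) std(1) k(2) assms(4), folded k_def f_def]
  define y where "y = U k * f"
  have e_y: "e (b # c # p) * y = y"
    using pair_swap[OF assms(2) std(1) k(2) assms(4) head(2,4)] by (simp add: y_def f_def k_def)
  define \<kappa> where "\<kappa> = \<delta> * \<delta> * val b * val c - (val b - val c) * (val b - val c)"
  have UU: "U k * y = \<kappa> \<cdot> f" using R.UU_eigen[OF pair(1,2)] by (simp add: y_def \<kappa>_def)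
  have "\<kappa> \<noteq> 0"
  proof -
    \<comment> \<open>\<open>- \<kappa>\<close> is the product of \<open>val b - q^2 val c\<close>
      and \<open>val b - q^-2 val c\<close>. A zero factor would put the value of \<open>b\<close>
      next to that of the addable box \<open>c\<close>.\<close>
    obtain j d where c: "c = (j, d)" by (cases c)
    have "val b \<noteq> val (j, d + 1)" "val b \<noteq> val (j, d - 1)"
      using val_adjacent[of p b j d] head k by (auto simp: c k_def)
    moreover have "\<kappa> = - ((val b - q * q * val c) * (val b - inverse (q * q) * val c))"
      using q_nonzero by (simp add: \<kappa>_def field_simps)
    ultimately show ?thesis by (simp add: val_up val_down c)
  qed
  then have "f = (inverse \<kappa> \<cdot> U k) * e (b # c # p) * y"
    using UU e_y by (simp add: mult.assoc)
  moreover have "U k \<in> H (length (c # b # p))"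
    using U_in_H[OF k(1)] by (simp add: k_def)
  moreover from this have "y \<in> H (length (c # b # p))"
    unfolding y_def f_def by (intro alg.mult e_in_H) auto
  ultimately show ?case unfolding f_def by (intro bexI[of _ y] bexI[of _ "inverse \<kappa> \<cdot> U k"] alg_scl)
next
  case (tail p r c)
  then obtain x y where xy: "x \<in> H (length p)" "y \<in> H (length p)" "e p = x * e r * y" by auto
  have same: "length r = length p" "shape r = shape p" using swap_properties tail by auto
  define L where "L = pev (X (length p)) (lagrange (addable (shape p)) c)"
  have Lx: "L * x = x * L"
    unfolding L_def using X_H_commute[OF xy(1)] tail assms(4) by (intro pev_commute[symmetric]) auto
  have "e (c # p) = (L * x) * e r * y" by (simp add: L_def e.simps(2) xy(3) mult.assoc)
  then have "e (c # p) = x * e (c # r) * y"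
    unfolding Lx by (simp add: L_def e.simps(2) same mult.assoc)
  moreover have "x \<in> H (length (c # p))" "y \<in> H (length (c # p))"
    using xy H_mono[of "length p" "length (c # p)"] by auto
  ultimately show ?case by blast
qed

lemma swaps_factor:
  assumes "swap\<^sup>*\<^sup>* p r" "standard p" "spectral K" "length p \<le> K" "K \<le> n"
  shows "\<exists>x\<in>H (length p). \<exists>y\<in>H (length p). e p = x * e r * y"
  using assms(1)
proof induction
  case base
  show ?case by (intro bexI[of _ 1]) (auto intro: alg_1)
next
  case (step r r')
  then obtain x y where xy: "x \<in> H (length p)" "y \<in> H (length p)" "e p = x * e r * y" by auto
  have "length r = length p" using swaps_properties[OF step(1)] assms by simp
  then obtain x' y' where "x' \<in> H (length p)" "y' \<in> H (length p)" "e r = x' * e r' * y'"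
    using swap_factor[OF step(2) assms(3)] assms by auto
  with xy have "e p = (x * x') * e r' * (y' * y)" "x * x' \<in> H (length p)" "y' * y \<in> H (length p)"
    by (simp_all add: mult.assoc alg.mult)
  then show ?case by blast
qed

text \<open>Excludes equal values in two successive steps. As \<open>s (Suc k)\<close> commutes with
  \<open>e p\<close>, the vector \<open>s (Suc k) * g\<close> stays in the image of
  \<open>e p\<close>, where \<open>full A\<close> kills with simple roots; so no Jordan block can
  arise.\<close>

lemma double_content_zero:
  assumes "spectral K" "standard (c # p)" "length p < K" "K \<le> n" "Suc (length p) < n"
    and g: "g = pev (X (Suc (length p))) Q * e (c # p)" "X (Suc (length p)) * g = val c \<cdot> g"
  shows "g = 0"
proof -
  define k where "k = length p"
  interpret R: rank_two emb \<delta> "s (Suc k)" "X k" "X (Suc k)"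
    by (rule rank_two_X) (use assms k_def in simp)
  define A where "A = addable (shape p)"
  have A: "finite A" "c \<in> A" using assms finite_addable by (auto simp: A_def)
  have Xg: "X k * g = val c \<cdot> g"
    unfolding g(1) k_def[symmetric]
    by (rule eigen_pass) (use X_e_head[OF assms(1-3)] pev_commute[OF R.XY] in \<open>simp_all add: k_def\<close>)
  have "e p * g = g"
  proof -
    have "e p * X (Suc k) = X (Suc k) * e p" using X_e_commute[of "Suc k" p] assms by (simp add: k_def)
    then show ?thesis
      using e_Cons_idem[OF assms(1,2)] pev_commute[of "e p" "X (Suc k)" Q] g(1) assms
      by (simp add: k_def flip: mult.assoc) (simp add: mult.assoc)
  qed
  moreover have "s (Suc k) * e p = e p * s (Suc k)"
    using s_H_commute[OF e_in_H] assms by (simp add: k_def)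
  ultimately have "s (Suc k) * g = e p * (s (Suc k) * g)" by (metis mult.assoc)
  moreover have "pev (X k) (full A) * e p = 0"
    using assms unfolding spectral_def k_def A_def by auto
  ultimately have "pev (X k) (full A) * (s (Suc k) * g) = 0" by (metis mult.assoc mult_zero_left)
  moreover have "pev (X k) (full A) = pev (X k) (full (A - {c})) * (X k - emb (val c))"
    unfolding full_remove[OF A] mult.commute[of "[:- val c, 1:]"] pev_mult by (simp add: emb_1 emb_minus)
  ultimately have *: "pev (X k) (full (A - {c})) * ((X k - emb (val c)) * (s (Suc k) * g)) = 0"
    by (simp add: mult.assoc)
  show ?thesis
  proof (rule R.double_eigen_zero[OF Xg _ *])
    show "X (Suc k) * g = val c \<cdot> g" using g k_def by simp
    show "poly (full (A - {c})) (val c) \<noteq> 0"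
      using val_inj[of p] assms A by (intro poly_full_nonzero) (auto simp: A_def dest: inj_onD)
    show "\<delta> \<noteq> 0" using assms by (intro delta_nonzero) auto
  qed (rule val_nonzero)
qed

text \<open>Excludes the values \<open>b, c, b\<close> on neighbouring diagonals. Both intertwiners
  kill \<open>h\<close>, because either exchange would create a forbidden eigenvalue. By
  \<open>s_eigen\<close>, \<open>h\<close> is then a common eigenvector of two neighbouring
  generators, with distinct nonzero eigenvalues.\<close>

lemma blocked_content_zero:
  assumes "spectral K" "standard (c # b # r)" "Suc (length r) < K" "K \<le> n" "Suc (Suc (length r)) < n"
    and cb: "c = (j, x)" "b = (j, y)" "\<bar>x - y\<bar> = 1"
    and h: "h = pev (X (Suc (Suc (length r)))) Q * e (c # b # r)" "X (Suc (Suc (length r))) * h = val b \<cdot> h"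
  shows "h = 0"
proof -
  define k where "k = length r"
  interpret R1: rank_two emb \<delta> "s (Suc k)" "X k" "X (Suc k)"
    by (rule rank_two_X) (use assms k_def in simp)
  interpret R2: rank_two emb \<delta> "s (Suc (Suc k))" "X (Suc k)" "X (Suc (Suc k))"
    by (rule rank_two_X) (use assms k_def in simp)
  have std: "standard (b # r)" "standard r" using assms by auto
  have pass: "z * h = pev (X (Suc (Suc k))) Q * (z * e (c # b # r))"
    if "z * X (Suc (Suc k)) = X (Suc (Suc k)) * z" for z
    using pev_commute[OF that, of Q] h(1) by (metis k_def mult.assoc)
  have Yh: "X (Suc (Suc k)) * h = val b \<cdot> h" using h k_def by simp
  have Xh: "X (Suc k) * h = val c \<cdot> h"
    using pass[OF R2.XY] X_e_head[OF assms(1,2)] assms h(1) by (simp add: k_def)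
  have br: "e (b # r) * h = h"
    using pass[of "e (b # r)"] X_e_commute[of "Suc (Suc k)" "b # r"] e_Cons_idem[OF assms(1,2)] assms
    by (simp add: k_def)
  have Wh: "X k * h = val b \<cdot> h"
    using X_e_head[OF assms(1) std(1)] br assms(3)
    by (metis Suc_lessD k_def mult.assoc scl_times(1))
  have er: "e r * h = h"
  proof -
    have "e r * (e (b # r) * h) = e (b # r) * h"
      using e_Cons_idem[OF assms(1) std(1)] assms by (simp flip: mult.assoc)
    then show ?thesis by (simp only: br)
  qed
  \<comment> \<open>\<open>R1.U * h\<close> lies in the image of \<open>e r\<close> and has the
    value \<open>val c\<close> for \<open>X k\<close>; but \<open>c\<close> is on a diagonal next to
    \<open>b\<close>, which is addable to the shape of \<open>r\<close>.\<close>
  have zero1: "R1.U * h = 0"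
  proof -
    have "e r * R1.U = R1.U * e r"
      by (rule U_e_commute) (use assms in \<open>simp_all add: k_def\<close>)
    then have "e r * (R1.U * h) = R1.U * h" using er by (rule fix_pass)
    moreover have "pev (X k) (full (addable (shape r))) * e r = 0"
      using assms unfolding spectral_def k_def by auto
    ultimately have "pev (X k) (full (addable (shape r))) * (R1.U * h) = 0"
      using fix_zero by blast
    then have "poly (full (addable (shape r))) (val c) \<cdot> (R1.U * h) = 0"
      by (simp add: pev_eigen[OF R1.U_eigen(1)[OF Wh Xh]])
    moreover have "val c \<notin> val ` addable (shape r)"
      using val_adjacent[of r _ j y x] std assms by fastforce
    ultimately show ?thesis using scl_eq_0 poly_full_nonzero by blast
  qed
  have zero2: "R2.U * h = 0"
  proof -
    have "e (b # r) * R2.U = R2.U * e (b # r)"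
      by (rule U_e_commute) (use assms in \<open>simp_all add: k_def\<close>)
    then have "e (b # r) * (R2.U * h) = R2.U * h" using br by (rule fix_pass)
    moreover have "pev (X (Suc k)) (full (addable (shape (b # r)))) * e (b # r) = 0"
      using assms unfolding spectral_def k_def by (metis length_Cons std(1))
    ultimately have "pev (X (Suc k)) (full (addable (shape (b # r)))) * (R2.U * h) = 0"
      using fix_zero by blast
    then have "poly (full (addable (shape (b # r)))) (val b) \<cdot> (R2.U * h) = 0"
      by (simp only: pev_eigen[OF R2.U_eigen(1)[OF Xh Yh]])
    moreover have "val b \<notin> val ` addable (shape (b # r))"
      using val_adjacent[of "b # r" _ j x y] assms by fastforce
    ultimately show ?thesis using scl_eq_0 poly_full_nonzero by blast
  qed
  have adjacent: "val c = q * q * val b \<or> val b = q * q * val c"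
    using cb val_up[of j x] val_up[of j y] by (cases "x < y") (auto simp: algebra_simps abs_if)
  \<comment> \<open>Here \<open>n\<close> is at least 3, so \<open>q^4 \<noteq> 1\<close>. That
    \<open>q^2\<close> is not 1 separates \<open>val b\<close> from \<open>val c\<close>; that it is
    not -1 gives \<open>val b + val c \<noteq> 0\<close>, which makes the two eigenvalues
    differ.\<close>
  have "(q * q) * (q * q) \<noteq> 1"
    using q_power[of 2] assms(5) by (simp add: power4_eq_xxxx mult.assoc)
  then have qq: "q * q \<noteq> 1" "q * q \<noteq> - 1"
    by auto
  have key: "q * q * val w \<noteq> val w" "q * q * val w \<noteq> - val w" for w
    using qq val_nonzero[of w] mult_right_cancel[of "val w" "q * q" 1]
      mult_right_cancel[of "val w" "q * q" "- 1"] by auto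
  have ne: "val b \<noteq> val c" "val b \<noteq> - val c"
    using adjacent key by (metis, metis minus_minus)
  have solve: "w = (- (b' / a')) \<cdot> h" if "a' \<cdot> w + b' \<cdot> h = 0" "a' \<noteq> 0" for a' b' w
  proof -
    have "inverse a' \<cdot> (a' \<cdot> w + b' \<cdot> h) = w + (b' / a') \<cdot> h"
      using that(2) by (simp add: scl_distrib divide_inverse mult.commute)
    then show ?thesis using that(1) by (simp add: eq_neg_iff_add_eq_0)
  qed
  have s1: "s (Suc k) * h = (- (\<delta> * val c / (val b - val c))) \<cdot> h"
    by (rule solve) (use R1.s_eigen[OF Wh Xh] zero1 ne in auto)
  have s2: "s (Suc (Suc k)) * h = (- (\<delta> * val b / (val c - val b))) \<cdot> h"
    by (rule solve) (use R2.s_eigen[OF Xh Yh] zero2 ne in auto)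
  show ?thesis
  proof (rule braid_eigen_zero[OF _ s1 s2])
    show "s (Suc k) * s (Suc (Suc k)) * s (Suc k) = s (Suc (Suc k)) * s (Suc k) * s (Suc (Suc k))"
      using braid assms by (simp add: k_def)
    have "d * val b / (val c - val b) = - (d * val b / (val b - val c))" for d
      by (metis minus_diff_eq minus_divide_right)
    then have "- (d * val c / (val b - val c)) - - (d * val b / (val c - val b))
        = - d * (val c + val b) / (val b - val c)" for d
      by (simp add: diff_divide_distrib add_divide_distrib distrib_left)
    moreover have "val c + val b \<noteq> 0" using ne by (metis add.commute eq_neg_iff_add_eq_0)
    ultimately show "- (\<delta> * val c / (val b - val c)) * - (\<delta> * val b / (val c - val b)) *
        (- (\<delta> * val c / (val b - val c)) - - (\<delta> * val b / (val c - val b))) \<noteq> 0"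
      using ne val_nonzero delta_nonzero assms by auto
  qed
qed

end

section \<open>Induction on the spectrum of the Jucys--Murphy elements\<close>

context hecke_algebra begin

text \<open>\<open>blocked_content_zero\<close> applies only if \<open>b\<close> is the last box.
  Swaps bring the removable box \<open>b\<close> to the end, and \<open>swaps_factor\<close>
  expresses \<open>e p\<close> through \<open>e (b # r)\<close> with factors in \<open>H k\<close>,
  past which polynomials in \<open>X k\<close> and \<open>X (Suc k)\<close> can be moved. Since
  \<open>zero\<close> is then applied to \<open>b # r\<close>, it has to hold for every tableau of
  shape \<open>S\<close>.\<close>

lemma blocked_remove:
  assumes "spectral (Suc k)" "Suc k < n" "finite D"
    and b: "b = (j, x)" "(j, x) \<in> S" "(j, x - 1) \<notin> S" "b \<in> D"
    and c: "c = (j, d)" "c \<in> addable S" "\<bar>d - x\<bar> = 1"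
    and zero: "\<And>p. standard p \<Longrightarrow> length p = k \<Longrightarrow> shape p = S \<Longrightarrow> pev (X (Suc k)) (full D) * e (c # p) = 0"
    and p: "standard p" "length p = k" "shape p = S"
  shows "pev (X (Suc k)) (full (D - {b})) * e (c # p) = 0"
proof -
  obtain r where r: "swap\<^sup>*\<^sup>* p (b # r)"
    using removable_last[of p j x] p b by blast
  then obtain y z where yz: "y \<in> H k" "z \<in> H k" "e p = y * e (b # r) * z"
    using swaps_factor[OF r p(1) assms(1)] assms(2) p by auto
  have br: "standard (b # r)" "length (b # r) = k" "shape (b # r) = S"
    using swaps_properties[OF r p(1)] p by auto
  then have len: "length r = k - 1" "k \<noteq> 0" by auto
  define P where "P = pev (X (Suc k)) (full (D - {b}))"
  define L where "L = pev (X k) (lagrange (addable S) c)"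
  have Ly: "L * y = y * L"
    unfolding L_def using assms(2) X_H_commute[OF yz(1)] by (intro pev_commute[symmetric]) auto
  have Py: "P * y = y * P"
    unfolding P_def using assms(2) X_H_commute[of y "Suc k"] H_mono[of k "Suc k"] yz(1)
    by (intro pev_commute[symmetric]) auto
  have "P * e (c # b # r) = 0"
  proof (rule blocked_content_zero)
    show "P * e (c # b # r) = pev (X (Suc (Suc (length r)))) (full (D - {b})) * e (c # b # r)"
      using len by (simp add: P_def)
    have "X (Suc k) * (P * e (c # b # r)) = val b \<cdot> (P * e (c # b # r))"
      unfolding P_def by (rule pev_full_eigen[OF assms(3) b(4) zero]) (use br in auto)
    then show "X (Suc (Suc (length r))) * (P * e (c # b # r)) = val b \<cdot> (P * e (c # b # r))"
      using len by simp
    show "standard (c # b # r)" using br c by simp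
  qed (use assms len in auto)
  moreover have "P * e (c # p) = P * (L * y) * e (b # r) * z"
    using p by (simp add: e.simps(2)[of c p] L_def yz(3) mult.assoc)
  moreover have "\<dots> = (P * y) * (L * e (b # r)) * z" unfolding Ly by (simp add: mult.assoc)
  moreover have "\<dots> = y * (P * e (c # b # r)) * z"
    using br(2,3) unfolding Py e.simps(2)[of c "b # r"] by (simp add: L_def mult.assoc)
  ultimately show ?thesis by (simp add: P_def)
qed

lemma spectral_1:
  assumes "1 \<le> n"
  shows "spectral 1"
proof -
  have "full (addable no_boxes) = (\<Prod>j\<in>UNIV. [:- v j, 1:])"
    unfolding full_def addable_no_boxes
    by (rule prod.reindex_bij_witness[of _ "\<lambda>j. (j, 0)" fst]) (auto simp: val_def)
  then show ?thesis
    using t_poly by (simp add: spectral_def)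
qed

text \<open>From the old addable boxes together with both neighbours of \<open>c\<close>, three
  reductions lead to the set in \<open>addable_add_box\<close>: \<open>c\<close> goes always, the
  upper neighbour if \<open>d + 1\<close> is occupied, the lower one if \<open>d - 2\<close> is
  free.\<close>

lemma spectral_Suc:
  assumes "spectral (Suc k)" "Suc k < n"
  shows "spectral (Suc (Suc k))"
proof -
  have step: "pev (X (Suc k)) (full (addable (shape (c # p)))) * e (c # p) = 0"
    if std: "standard (c # p)" and len: "length p = k" for c p
  proof -
    interpret R: rank_two emb \<delta> "s (Suc k)" "X k" "X (Suc k)" by (rule rank_two_X[OF assms(2)])
    obtain j d where c: "c = (j, d)" by (cases c)
    define S where "S = shape p"
    define A where "A = addable S"
    have A: "finite A" "c \<in> A" using std finite_addable by (auto simp: A_def S_def)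
    have S: "(j, d - 1) \<in> S" "(j, d) \<notin> S" using A(2) by (auto simp: A_def c addable_def)
    define Z where "Z D \<longleftrightarrow> (\<forall>r. standard r \<longrightarrow> length r = k \<longrightarrow> shape r = S \<longrightarrow>
      pev (X (Suc k)) (full D) * e (c # r) = 0)" for D
    define up down where "up = (j, d + 1)" and "down = (j, d - 1)"
    have notA: "up \<notin> A" "down \<notin> A" "up \<noteq> down" "up \<noteq> c" "down \<noteq> c"
      using S by (auto simp: up_def down_def A_def addable_def c)
    have Z_full: "Z (insert up (insert down A))"
      unfolding Z_def
    proof (intro allI impI)
      fix r assume r: "standard r" "length r = k" "shape r = S"
      define f where "f = e (c # r)"
      have std_r: "standard (c # r)" using r A by (simp add: A_def)
      have Xf: "X k * f = val c \<cdot> f"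
        using X_e_head[OF assms(1) std_r] r by (simp add: f_def)
      have "e r * f = f"
        unfolding f_def by (rule e_Cons_idem[OF assms(1) std_r]) (use r assms in auto)
      moreover have "e r * R.U = R.U * e r"
        by (rule U_e_commute) (use r assms in simp_all)
      ultimately have "e r * (R.U * f) = R.U * f" by (rule fix_pass[rotated])
      moreover have "pev (X k) (full A) * e r = 0"
        using assms(1) r unfolding spectral_def A_def by auto
      ultimately have "pev (X k) (full A) * (R.U * f) = 0" by (rule fix_zero[rotated])
      \<comment> \<open>A further \<open>U\<close> on the left turns \<open>X k\<close> into
        \<open>X (Suc k)\<close>, and \<open>U * U\<close> supplies the quadratic factor with roots
        \<open>val up\<close> and \<open>val down\<close>.\<close>
      then have "pev (X (Suc k)) (full A) * (R.U * (R.U * f)) = 0"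
        using pev_intertwine[OF R.UX, of "full A"] by (metis mult.assoc mult_zero_right)
      moreover have "R.U * (R.U * f) = - (pev (X (Suc k)) ([:- val up, 1:] * [:- val down, 1:]) * f)"
      proof -
        have "(val c * val c) = val up * val down" "(\<delta> * \<delta> + 2) * val c = val up + val down"
          using q_nonzero unfolding up_def down_def c val_up val_down by (simp_all add: field_simps)
        then show ?thesis using R.UU_X_eigen[OF Xf] by (simp add: algebra_simps)
      qed
      ultimately have "pev (X (Suc k)) (full A * ([:- val up, 1:] * [:- val down, 1:])) * f = 0"
        by (simp only: pev_mult[of _ "full A"] mult.assoc mult_minus_right neg_equal_0_iff_equal)
      moreover have "full (insert up (insert down A)) = full A * ([:- val up, 1:] * [:- val down, 1:])"
        using A notA by (simp add: full_insert del: mult_pCons_left mult_pCons_right)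
      ultimately show "pev (X (Suc k)) (full (insert up (insert down A))) * e (c # r) = 0"
        by (simp only: f_def)
    qed
    define D where "D = insert up (insert down (A - {c}))"
    have D: "insert up (insert down A) - {c} = D"
      using notA by (auto simp: D_def)
    have "Z (E - {c})" if "Z E" "finite E" "c \<in> E" for E
      unfolding Z_def
    proof (intro allI impI)
      fix r assume r: "standard r" "length r = k" "shape r = S"
      have "X (Suc k) * (pev (X (Suc k)) (full (E - {c})) * e (c # r))
        = val c \<cdot> (pev (X (Suc k)) (full (E - {c})) * e (c # r))"
        by (rule pev_full_eigen) (use that r in \<open>auto simp: Z_def\<close>)
      then show "pev (X (Suc k)) (full (E - {c})) * e (c # r) = 0"
        using r A assms by (intro double_content_zero[OF assms(1), of c r]) (auto simp: A_def)
    qed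
    from this[OF Z_full] have ZD: "Z D" using A by (simp add: D)
    have remove: "Z (E - {(j, x)})"
      if "Z E" "finite E" "(j, x) \<in> E" "(j, x) \<in> S" "(j, x - 1) \<notin> S" "\<bar>d - x\<bar> = 1" for E x
      unfolding Z_def
      by (intro allI impI, rule blocked_remove[OF assms, where b = "(j, x)" and S = S])
        (use that c A in \<open>auto simp: A_def Z_def\<close>)
    \<comment> \<open>As \<open>(j, d)\<close> is free and \<open>(j, d - 1)\<close> occupied,
      \<open>up\<close> is a removable box of \<open>S\<close> if its bead is present, and
      \<open>down\<close> is one if \<open>d - 2\<close> is free.\<close>
    define D1 where "D1 = (if up \<in> S then D - {up} else D)"
    have "Z D1" using ZD remove[of D "d + 1"] A S by (auto simp: D1_def up_def D_def)
    define D2 where "D2 = (if (j, d - 2) \<in> S then D1 else D1 - {down})"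
    have "Z D2" using \<open>Z D1\<close> remove[of D1 "d - 1"] A S
      by (auto simp: D2_def D1_def up_def down_def D_def)
    moreover have "D2 = addable (shape (c # p))"
      using notA A(2) addable_add_box[of j d S]
      by (auto simp: D2_def D1_def D_def up_def down_def A_def c simp flip: S_def split: if_splits)
    ultimately show ?thesis using std len by (auto simp: Z_def S_def)
  qed
  show ?thesis
    unfolding spectral_def
  proof (intro allI impI)
    fix p :: "'m box list" assume p: "standard p" "length p < Suc (Suc k)"
    show "pev (X (length p)) (full (addable (shape p))) * e p = 0"
    proof (cases "length p = Suc k")
      case True
      then show ?thesis using step p by (cases p) auto
    next
      case False
      then show ?thesis using assms(1) p by (auto simp: spectral_def)
    qed
  qed
qed

lemma spectral_le: "1 \<le> k \<Longrightarrow> k \<le> n \<Longrightarrow> spectral k"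
proof (induction k rule: nat_induct_at_least)
  case base
  then show ?case by (rule spectral_1)
next
  case (Suc k)
  then show ?case using spectral_Suc[of "k - 1"] by simp
qed

lemma spectral_n: "spectral n"
  using spectral_le[of n] by (cases "n = 0") (auto simp: spectral_def)

end

context hecke_algebra begin

section \<open>Matrix structure\<close>

lemma X_e:
  assumes "standard (c # p)" "length p < n"
  shows "X (length p) * e (c # p) = val c \<cdot> e (c # p)"
  by (rule X_e_head[OF spectral_n]) (use assms in auto)

lemma e_square: "standard p \<Longrightarrow> length p \<le> n \<Longrightarrow> e p * e p = e p"
  by (rule e_idem[OF spectral_n]) auto

text \<open>If only the last boxes differ, the interpolating polynomial for \<open>c\<close>
  vanishes at \<open>val d\<close>. Otherwise \<open>e p\<close> can be moved past the last factor
  of \<open>e r\<close>, to meet the orthogonal \<open>e r'\<close>.\<close>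

lemma e_orthogonal:
  assumes "standard p" "standard r" "length p = length r" "length r \<le> n" "p \<noteq> r"
  shows "e p * e r = 0"
  using assms
proof (induction p arbitrary: r)
  case (Cons c p)
  then obtain d r' where r: "r = d # r'" by (cases r) auto
  have len: "length p = length r'" "length r' < n" using Cons.prems r by auto
  have comm: "X (length p) * e p = e p * X (length p)"
    by (rule X_e_commute) (use len in auto)
  define P where "P = pev (X (length p)) (lagrange (addable (shape p)) c)"
  have Pp: "e p * P = P * e p" unfolding P_def by (rule pev_commute) (rule comm[symmetric])
  show ?case
  proof (cases "p = r'")
    case True
    then have "c \<noteq> d" using Cons.prems r by auto
    have "e (c # p) * e r = P * (e p * e (d # r'))"
      by (simp add: r P_def e.simps(2)[of c] mult.assoc)
    also have "e p * e (d # r') = e (d # r')"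
      unfolding True by (rule e_Cons_idem[OF spectral_n]) (use Cons.prems r in auto)
    also have "P * e (d # r') = poly (lagrange (addable (shape p)) c) (val d) \<cdot> e (d # r')"
      unfolding P_def len(1) by (rule pev_eigen, rule X_e) (use Cons.prems r in auto)
    also have "poly (lagrange (addable (shape p)) c) (val d) = 0"
      using Cons.prems True r \<open>c \<noteq> d\<close> len
      by (subst poly_lagrange) (auto intro: val_inj finite_addable)
    finally show ?thesis by simp
  next
    case False
    define R where "R = pev (X (length p)) (lagrange (addable (shape r')) d)"
    have er: "e r = R * e r'" by (simp add: r e.simps(2) len(1) R_def)
    have "e p * R = R * e p" unfolding R_def by (rule pev_commute) (rule comm[symmetric])
    then have "e (c # p) * e r = P * (R * e p) * e r'"
      unfolding er e.simps(2)[of c] P_def[symmetric] by (metis mult.assoc)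
    also have "\<dots> = P * R * (e p * e r')" by (simp only: mult.assoc)
    also have "e p * e r' = 0" using Cons.IH[of r'] Cons.prems r False by auto
    finally show ?thesis by simp
  qed
qed simp

lemma e_times_e:
  assumes "p \<in> tableaux k" "r \<in> tableaux k" "k \<le> n"
  shows "e p * e r = (if p = r then e r else 0)"
  using assms e_orthogonal[of p r] e_square[of p] by (auto simp: tableaux_def)

lemma sum_e: "k \<le> n \<Longrightarrow> (\<Sum>p\<in>tableaux k. e p) = 1"
proof (induction k)
  case (Suc k)
  have "(\<Sum>c\<in>addable (shape p). e (c # p)) = e p" if p: "p \<in> tableaux k" for p
  proof (cases "addable (shape p) = {}")
    case True
    \<comment> \<open>For an empty set of boxes \<open>full\<close> is the empty product 1, so the
      spectral condition itself says \<open>e p = 0\<close>.\<close>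
    then have "pev (X (length p)) 1 * e p = 0"
      using spectral_n p Suc.prems unfolding spectral_def tableaux_def by (auto simp: full_def dest!: spec[of _ p])
    with True show ?thesis by simp
  next
    case False
    have "(\<Sum>c\<in>addable (shape p). e (c # p))
        = pev (X (length p)) (\<Sum>c\<in>addable (shape p). lagrange (addable (shape p)) c) * e p"
      by (simp add: e.simps(2) pev_sum sum_distrib_right)
    also have "(\<Sum>c\<in>addable (shape p). lagrange (addable (shape p)) c) = 1"
      by (rule sum_lagrange) (use p Suc.prems False in \<open>auto simp: tableaux_def intro: val_inj finite_addable\<close>)
    finally show ?thesis by simp
  qed
  then show ?case using Suc by (simp add: sum_tableaux_Suc)
qed (simp add: tableaux_0)

lemma eq_by_e:
  assumes "k \<le> n" "\<And>p. p \<in> tableaux k \<Longrightarrow> x * e p = y * e p"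
  shows "x = y"
proof -
  have "x * (\<Sum>p\<in>tableaux k. e p) = y * (\<Sum>p\<in>tableaux k. e p)"
    unfolding sum_distrib_left by (rule sum.cong) (use assms in auto)
  then show ?thesis by (simp add: sum_e assms(1))
qed

text \<open>The seminormal form: \<open>s_eigen\<close> expresses the left side by \<open>f\<close>
  and \<open>U k * f\<close>. The second term belongs to the exchanged tableau, or vanishes if the
  exchange is not standard, when any \<open>r\<close> of this shape will do. The value
  \<open>val b\<close> at \<open>y\<close> is recorded to separate \<open>y\<close> from
  \<open>f\<close> in \<open>corner\<close>.\<close>

lemma s_e_top:
  assumes std: "standard (c # b # p)" and len: "Suc (length p) < n"
  shows "\<exists>a y r. s (Suc (length p)) * e (c # b # p) = a \<cdot> e (c # b # p) + y \<and>
    X (Suc (length p)) * y = val b \<cdot> y \<and> e r * y = y \<and>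
    standard r \<and> length r = length (c # b # p) \<and> shape r = shape (c # b # p)"
proof -
  define k where "k = length p"
  define f where "f = e (c # b # p)"
  interpret R: rank_two emb \<delta> "s (Suc k)" "X k" "X (Suc k)" by (rule rank_two_X) (use len k_def in simp)
  have K: "Suc (length p) < n" "n \<le> n" using len by auto
  note pair = pair_eigen[OF spectral_n std K, folded k_def f_def]
  have ne: "val b - val c \<noteq> 0" using val_successive[OF std] len by auto
  define \<kappa> where "\<kappa> = inverse (val b - val c)"
  have "\<kappa> \<cdot> (U k * f) = (\<kappa> * (val b - val c)) \<cdot> (s (Suc k) * f) + (\<kappa> * (\<delta> * val c)) \<cdot> f"
    by (simp only: R.s_eigen[OF pair(1,2)] scl_distrib(1) scl_scl)
  moreover have "\<kappa> * (val b - val c) = 1" using ne by (simp add: \<kappa>_def)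
  ultimately have "s (Suc k) * f = (- (\<kappa> * (\<delta> * val c))) \<cdot> f + \<kappa> \<cdot> (U k * f)"
    by simp
  moreover have "X (Suc k) * (\<kappa> \<cdot> (U k * f)) = val b \<cdot> (\<kappa> \<cdot> (U k * f))"
    using R.U_eigen(2)[OF pair(1,2)] by (simp add: mult.commute)
  moreover have "\<exists>r. e r * (\<kappa> \<cdot> (U k * f)) = \<kappa> \<cdot> (U k * f) \<and>
    standard r \<and> length r = length (c # b # p) \<and> shape r = shape (c # b # p)"
  proof (cases "c \<in> addable (shape p)")
    case True
    have "b \<noteq> c" using ne by auto
    then have "swap (c # b # p) (b # c # p)" using std True by (intro swap.head) auto
    then show ?thesis
      using pair_swap[OF spectral_n std K True \<open>b \<noteq> c\<close>] swap_properties[of "c # b # p" "b # c # p"]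
      by (intro exI[of _ "b # c # p"]) (simp add: k_def f_def del: shape.simps standard.simps)
  next
    case False
    obtain j d where b: "b = (j, d)" by (cases b)
    have jd: "(j, d) \<in> addable (shape p)" using std b by simp
    \<comment> \<open>Here \<open>c\<close> became addable only through \<open>b\<close>, so
      \<open>val c\<close> is not an allowed value of \<open>X k\<close> on the image of
      \<open>e p\<close>.\<close>
    obtain x where c: "c = (j, x)" "\<bar>x - d\<bar> = 1"
      using std False unfolding b by (auto simp: addable_add_box[OF jd] split: if_splits)
    have "pev (X k) (full (addable (shape p))) * e p = 0"
      using spectral_n std len unfolding spectral_def k_def by auto
    then have "pev (X k) (full (addable (shape p))) * (U k * f) = 0"
      using pair(4) by (rule fix_zero)
    then have "poly (full (addable (shape p))) (val c) \<cdot> (U k * f) = 0"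
      by (simp add: pev_eigen[OF R.U_eigen(1)[OF pair(1,2)]])
    moreover have "val c \<notin> val ` addable (shape p)"
      using val_adjacent[of p _ j d x] std jd len c by fastforce
    ultimately have "U k * f = 0" using scl_eq_0 poly_full_nonzero by blast
    then show ?thesis using std by (intro exI[of _ "c # b # p"]) auto
  qed
  ultimately show ?thesis unfolding k_def f_def by blast
qed

lemma s_e:
  assumes "standard p" "length p \<le> n" "1 \<le> i" "i < length p"
  shows "\<exists>a y r. s i * e p = a \<cdot> e p + y \<and> e r * y = y \<and>
    standard r \<and> length r = length p \<and> shape r = shape p"
  using assms
proof (induction p)
  case (Cons c p)
  show ?case
  proof (cases "i = length p")
    case True
    then obtain b p' where p: "p = b # p'" using Cons.prems by (cases p) auto
    show ?thesis using s_e_top[of c b p'] Cons.prems True p by auto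
  next
    case False
    then obtain a y r where IH: "s i * e p = a \<cdot> e p + y" "e r * y = y"
      "standard r" "length r = length p" "shape r = shape p"
      using Cons by auto
    define L where "L = pev (X (length p)) (lagrange (addable (shape p)) c)"
    have "s i * L = L * s i"
      unfolding L_def using s_X_lower[of i "length p"] Cons.prems False by (intro pev_commute) auto
    then have "s i * e (c # p) = L * (s i * e p)"
      by (simp add: e.simps(2) L_def flip: mult.assoc)
    also have "\<dots> = a \<cdot> e (c # p) + L * y" by (simp add: IH(1) distrib_left e.simps(2) L_def)
    finally have 1: "s i * e (c # p) = a \<cdot> e (c # p) + L * y" .
    have "standard (c # r)" "length (c # r) \<le> n" using IH Cons.prems by auto
    note sq = e_square[OF this]
    have eq: "e (c # r) = L * e r" by (simp add: e.simps(2) IH L_def)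
    then have "L * y = e (c # r) * y" using IH(2) by (simp add: mult.assoc)
    then have "e (c # r) * (L * y) = L * y" by (simp add: sq flip: mult.assoc)
    with 1 IH Cons.prems show ?thesis by (intro exI[of _ a] exI[of _ "L * y"] exI[of _ "c # r"]) auto
  qed
qed simp

section \<open>Central idempotents attached to shapes\<close>

definition shape_sum :: "nat \<Rightarrow> 'm box set \<Rightarrow> 'a" where
  "shape_sum k S = (\<Sum>p\<in>{p \<in> tableaux k. shape p = S}. e p)"

lemma shape_sum_e:
  assumes "p \<in> tableaux k" "k \<le> n"
  shows "shape_sum k S * e p = (if shape p = S then e p else 0)"
    "e p * shape_sum k S = (if shape p = S then e p else 0)"
proof -
  have fin: "finite {p \<in> tableaux k. shape p = S}"
    by (rule finite_subset[OF _ finite_tableaux[of k]]) auto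
  have "shape_sum k S * e p = (\<Sum>r\<in>{p \<in> tableaux k. shape p = S}. if r = p then e p else 0)"
    unfolding shape_sum_def sum_distrib_right by (rule sum.cong) (use assms in \<open>auto simp: e_times_e\<close>)
  then show "shape_sum k S * e p = (if shape p = S then e p else 0)"
    using assms fin by simp
  have "e p * shape_sum k S = (\<Sum>r\<in>{p \<in> tableaux k. shape p = S}. if p = r then e p else 0)"
    unfolding shape_sum_def sum_distrib_left by (rule sum.cong) (use assms in \<open>auto simp: e_times_e\<close>)
  then show "e p * shape_sum k S = (if shape p = S then e p else 0)"
    using assms fin by simp
qed

lemma shape_sum_in_H: "shape_sum k S \<in> H k"
  unfolding shape_sum_def by (rule alg_sum) (auto simp: tableaux_def intro: e_in_H)

text \<open>By \<open>s_e\<close>, a generator \<open>s i\<close> sends \<open>e p\<close> into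
  images of idempotents of the same shape, on which \<open>shape_sum\<close> acts by 1 or by 0. The
  generator \<open>t\<close> commutes with every single \<open>e p\<close>.\<close>

lemma shape_sum_central:
  assumes "x \<in> H k" "k \<le> n"
  shows "shape_sum k S * x = x * shape_sum k S"
  using assms(1)
proof (rule alg_commute)
  fix g assume g: "g \<in> gens k"
  show "shape_sum k S * g = g * shape_sum k S"
  proof (cases "g = t")
    case True
    then have "0 < k" using g by (auto simp: gens_def split: if_splits)
    then have "e p * t = t * e p" if "p \<in> tableaux k" for p
      using X_e_commute[of 0 p] that assms by (auto simp: tableaux_def)
    then show ?thesis
      unfolding shape_sum_def True by (auto simp: sum_distrib_left sum_distrib_right intro!: sum.cong)
  next
    case False
    then obtain i where i: "g = s i" "1 \<le> i" "i < k" using g by (auto simp: gens_def split: if_splits)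
    show ?thesis
    proof (rule eq_by_e[OF assms(2)])
      fix p :: "'m box list" assume p: "p \<in> tableaux k"
      obtain a y r where ayr: "s i * e p = a \<cdot> e p + y" "e r * y = y" "r \<in> tableaux k" "shape r = shape p"
      proof -
        have len: "standard p" "length p = k" using p by (auto simp: tableaux_def)
        then have "length p \<le> n" "i < length p" using i assms(2) by auto
        from s_e[OF len(1) this(1) i(2) this(2)] obtain a y r where
          "s i * e p = a \<cdot> e p + y" "e r * y = y" "standard r" "length r = length p" "shape r = shape p"
          by metis
        then show ?thesis using len by (intro that[of a y r]) (simp_all add: tableaux_def)
      qed
      have "shape_sum k S * y = (shape_sum k S * e r) * y" by (simp only: mult.assoc ayr(2))
      also have "\<dots> = (if shape p = S then y else 0)"
        unfolding shape_sum_e(1)[OF ayr(3) assms(2)] ayr(4) by (simp add: ayr(2))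
      finally have "shape_sum k S * (s i * e p) = (if shape p = S then s i * e p else 0)"
        by (simp add: ayr(1) distrib_left shape_sum_e(1)[OF p assms(2)])
      then show "shape_sum k S * g * e p = g * shape_sum k S * e p"
        by (simp add: i(1) mult.assoc shape_sum_e(1)[OF p assms(2)])
    qed
  qed
qed

lemma block_zero:
  assumes "p \<in> tableaux k" "r \<in> tableaux k" "k \<le> n" "x \<in> H k" "shape p \<noteq> shape r"
  shows "e p * x * e r = 0"
proof -
  have "e p * x * e r = e p * (shape_sum k (shape p) * x) * e r"
    using shape_sum_e(2)[OF assms(1,3), of "shape p"] by (simp flip: mult.assoc)
  also have "\<dots> = e p * x * (shape_sum k (shape p) * e r)"
    unfolding shape_sum_central[OF assms(4,3)] by (simp add: mult.assoc)
  finally show ?thesis using shape_sum_e(1)[OF assms(2,3)] assms(5) by simp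
qed

text \<open>\<open>H (k + 1)\<close> is spanned by \<open>H k\<close> and the double coset \<open>H k \<sigma>\<^sub>k H k\<close> over the polynomials
  in the Jucys--Murphy element \<open>X k\<close>.\<close>

inductive_set mackey :: "nat \<Rightarrow> 'a set" for k where
  pol: "h \<in> H k \<Longrightarrow> h * pev (X k) Q \<in> mackey k"
| coset: "1 \<le> k \<Longrightarrow> h \<in> H k \<Longrightarrow> h' \<in> H k \<Longrightarrow> h * s k * h' * pev (X k) Q \<in> mackey k"
| add: "x \<in> mackey k \<Longrightarrow> y \<in> mackey k \<Longrightarrow> x + y \<in> mackey k"

lemma mackey_H_times: "x \<in> mackey k \<Longrightarrow> g \<in> H k \<Longrightarrow> g * x \<in> mackey k"
proof (induction rule: mackey.induct)
  case (pol h Q)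
  then have "(g * h) * pev (X k) Q \<in> mackey k" by (intro mackey.pol alg.mult)
  then show ?case by (simp add: mult.assoc)
next
  case (coset h h' Q)
  then have "(g * h) * s k * h' * pev (X k) Q \<in> mackey k" by (intro mackey.coset alg.mult)
  then show ?case by (simp add: mult.assoc)
qed (simp add: distrib_left mackey.add)

lemma mackey_times_pev: "x \<in> mackey k \<Longrightarrow> x * pev (X k) R \<in> mackey k"
proof (induction rule: mackey.induct)
  case (pol h Q)
  then have "h * pev (X k) (Q * R) \<in> mackey k" by (intro mackey.pol)
  then show ?case by (simp add: mult.assoc pev_mult)
next
  case (coset h h' Q)
  then have "h * s k * h' * pev (X k) (Q * R) \<in> mackey k" by (intro mackey.coset)
  then show ?case by (simp add: mult.assoc pev_mult)
qed (simp add: distrib_right mackey.add)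

lemma mackey_times_H:
  assumes "x \<in> mackey k" "g \<in> H k" "k < n"
  shows "x * g \<in> mackey k"
  using assms(1)
proof (induction rule: mackey.induct)
  have comm: "pev (X k) Q * g = g * pev (X k) Q" for Q
    using X_H_commute[OF assms(2,3)] by (intro pev_commute[symmetric]) auto
  {
    case (pol h Q)
    then have "(h * g) * pev (X k) Q \<in> mackey k" using assms by (intro mackey.pol alg.mult)
    then show ?case by (simp add: mult.assoc comm)
  next
    case (coset h h' Q)
    then have "h * s k * (h' * g) * pev (X k) Q \<in> mackey k" using assms by (intro mackey.coset alg.mult)
    then show ?case by (simp add: mult.assoc comm)
  }
qed (simp add: distrib_right mackey.add)

lemma mackey_scl: "x \<in> mackey k \<Longrightarrow> a \<cdot> x \<in> mackey k"
  using mackey_H_times[of x k "emb a"] by (simp add: alg.scalar)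

lemma mackey_diff: "x \<in> mackey k \<Longrightarrow> y \<in> mackey k \<Longrightarrow> x - y \<in> mackey k"
  using mackey.add[of x k "(-1) \<cdot> y"] mackey_scl[of y k "-1"] by simp

lemma mackey_H: "h \<in> H k \<Longrightarrow> h \<in> mackey k"
  using mackey.pol[of h k 1] by simp

lemma mackey_coset: "1 \<le> k \<Longrightarrow> h \<in> H k \<Longrightarrow> h' \<in> H k \<Longrightarrow> h * s k * h' \<in> mackey k"
  using mackey.coset[of k h h' 1] by simp

text \<open>The relation \<open>X s = s Y - \<delta> Y\<close> pulls one factor \<open>X j\<close>
  through the right-hand \<open>s (Suc j)\<close>, leaving \<open>X (Suc j)\<close> at the right end
  and a coset term. Generalizing over \<open>m\<close> absorbs the powers of \<open>X j\<close> one
  at a time.\<close>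

lemma mackey_conj_pev:
  assumes "Suc j < n" "m \<in> H (Suc j)" "s (Suc j) * m * s (Suc j) \<in> mackey (Suc j)"
  shows "s (Suc j) * (m * pev (X j) Q) * s (Suc j) \<in> mackey (Suc j)"
  using assms(2,3)
proof (induction Q arbitrary: m)
  case 0
  then show ?case using mackey_H[OF alg_0] by simp
next
  case (pCons a Q)
  interpret R: rank_two emb \<delta> "s (Suc j)" "X j" "X (Suc j)" by (rule rank_two_X[OF assms(1)])
  have mX: "m * X j \<in> H (Suc j)" using pCons by (intro alg.mult X_in_H) auto
  have "s (Suc j) * (m * X j) * s (Suc j) = s (Suc j) * m * (X j * s (Suc j))"
    by (simp only: mult.assoc)
  also have "\<dots> = s (Suc j) * m * s (Suc j) * pev (X (Suc j)) [:0, 1:]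
      - \<delta> \<cdot> (1 * s (Suc j) * m * pev (X (Suc j)) [:0, 1:])"
    by (simp add: R.Xs right_diff_distrib mult.assoc emb_0 emb_1)
  also have "\<dots> \<in> mackey (Suc j)"
    using pCons.prems by (intro mackey_diff mackey_scl mackey_times_pev mackey.coset alg_1) auto
  finally have "s (Suc j) * (m * X j * pev (X j) Q) * s (Suc j) \<in> mackey (Suc j)"
    by (rule pCons.IH[OF mX])
  moreover have "s (Suc j) * (m * pev (X j) (pCons a Q)) * s (Suc j)
    = a \<cdot> (s (Suc j) * m * s (Suc j)) + s (Suc j) * (m * X j * pev (X j) Q) * s (Suc j)"
    by (simp add: distrib_left distrib_right mult.assoc)
  ultimately show ?case using pCons.prems by (simp add: mackey.add mackey_scl)
qed

text \<open>An \<open>h \<in> H j\<close> commutes with \<open>s (Suc j)\<close> and leaves its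
  square. In a coset the outer factors from \<open>H j\<close> move out, and the braid relation
  leaves a single \<open>s (Suc j)\<close> between elements of \<open>H (Suc j)\<close>.\<close>

lemma mackey_conj:
  assumes "Suc j < n" "m \<in> mackey j"
  shows "m \<in> H (Suc j) \<and> s (Suc j) * m * s (Suc j) \<in> mackey (Suc j)"
  using assms(2)
proof (induction rule: mackey.induct)
  case (pol h Q)
  have h: "h \<in> H (Suc j)" using pol H_mono[of j "Suc j"] by auto
  have "s (Suc j) * h * s (Suc j) = h * (s (Suc j) * s (Suc j))"
    unfolding s_H_commute[OF pol assms(1)] by (simp only: mult.assoc)
  also have "\<dots> = \<delta> \<cdot> (h * s (Suc j) * 1) + h"
    using s_square[of "Suc j"] assms(1) by (simp add: distrib_left)
  also have "\<dots> \<in> mackey (Suc j)"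
    by (intro mackey.add mackey_scl mackey_coset mackey_H h alg_1) simp
  finally show ?case using mackey_conj_pev[OF assms(1) h] h by (auto intro!: alg.mult pev_in_alg X_in_H)
next
  case (coset h h' Q)
  have h: "h \<in> H (Suc j)" "h' \<in> H (Suc j)" "s j \<in> H (Suc j)"
    using coset H_mono[of j "Suc j"] s_in_H[of j "Suc j"] by auto
  have br: "s (Suc j) * s j * s (Suc j) = s j * s (Suc j) * s j"
    using braid[of j] coset(1) assms(1) by simp
  have "s (Suc j) * (h * s j * h') * s (Suc j) = (s (Suc j) * h) * s j * (h' * s (Suc j))"
    by (simp only: mult.assoc)
  also have "\<dots> = h * (s (Suc j) * s j * s (Suc j)) * h'"
    unfolding s_H_commute[OF coset(2) assms(1)] s_H_commute[OF coset(3) assms(1), symmetric]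
    by (simp only: mult.assoc)
  also have "\<dots> = (h * s j) * s (Suc j) * (s j * h')"
    unfolding br by (simp only: mult.assoc)
  also have "\<dots> \<in> mackey (Suc j)"
    by (intro mackey_coset alg.mult h) simp
  finally show ?case using mackey_conj_pev[OF assms(1), of "h * s j * h'"] h
    by (auto intro!: alg.mult pev_in_alg X_in_H)
qed (auto simp: distrib_left distrib_right intro: mackey.add alg.add)

text \<open>Left multiplication of a coset by \<open>s (Suc j)\<close> creates
  \<open>s (Suc j) * h * s (Suc j)\<close> with \<open>h \<in> H (Suc j)\<close>; the induction
  hypothesis puts \<open>h\<close> into \<open>mackey j\<close>, where \<open>mackey_conj\<close>
  applies.\<close>

lemma H_Suc_subset_mackey: "k < n \<Longrightarrow> H (Suc k) \<subseteq> mackey k"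
proof (induction k)
  case 0
  show ?case
  proof
    fix x assume "x \<in> H (Suc 0)"
    then show "x \<in> mackey 0"
    proof (rule alg_left_induct)
      fix g x assume g: "g \<in> gens (Suc 0)" and x: "x \<in> mackey 0"
      from x show "g * x \<in> mackey 0"
      proof (induction rule: mackey.induct)
        case (pol h Q)
        have "g = X 0" using g by (simp add: gens_def)
        then have "g * (h * pev (X 0) Q) = h * pev (X 0) (pCons 0 Q)"
          using X_H_commute[OF pol] 0 by (simp add: emb_0) (metis mult.assoc)
        then show ?case using mackey.pol[OF pol] by metis
      qed (auto simp: distrib_left intro: mackey.add)
    qed (auto intro: mackey.add mackey_scl mackey_H alg_1)
  qed
next
  case (Suc j)
  have conj: "s (Suc j) * h * s (Suc j) \<in> mackey (Suc j)" if "h \<in> H (Suc j)" for h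
    using mackey_conj[OF Suc.prems] Suc that by auto
  show ?case
  proof
    fix x assume "x \<in> H (Suc (Suc j))"
    then show "x \<in> mackey (Suc j)"
    proof (rule alg_left_induct)
      fix g x assume g: "g \<in> gens (Suc (Suc j))" and x: "x \<in> mackey (Suc j)"
      have "g \<in> H (Suc j) \<or> g = s (Suc j)"
        using g alg.gen[of g "gens (Suc j)"] by (auto simp: gens_def less_Suc_eq)
      moreover from x have "s (Suc j) * x \<in> mackey (Suc j)"
      proof (induction rule: mackey.induct)
        case (pol h Q)
        then show ?case using mackey.coset[of "Suc j" 1 h Q] by (simp add: alg_1 mult.assoc)
      next
        case (coset h h' Q)
        have "s (Suc j) * h * s (Suc j) * h' * pev (X (Suc j)) Q \<in> mackey (Suc j)"
          by (intro mackey_times_pev mackey_times_H conj coset Suc.prems)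
        then show ?case by (simp add: mult.assoc)
      qed (auto simp: distrib_left intro: mackey.add)
      ultimately show "g * x \<in> mackey (Suc j)" using x mackey_H_times by blast
    qed (auto intro: mackey.add mackey_scl mackey_H alg_1)
  qed
qed

section \<open>Corners of tableau idempotents\<close>

lemma corner_lower:
  assumes "standard (c # p)" "length p < n" "h \<in> H (length p)" "e p * h * e p = \<kappa> \<cdot> e p"
  shows "e (c # p) * h * e (c # p) = \<kappa> \<cdot> e (c # p)"
proof -
  define L where "L = pev (X (length p)) (lagrange (addable (shape p)) c)"
  have comm: "L * y = y * L" if "y \<in> H (length p)" for y
    unfolding L_def using X_H_commute[OF that assms(2)] by (intro pev_commute[symmetric]) auto
  have L: "e (c # p) = L * e p" "e (c # p) = e p * L"
    using comm[of "e p"] by (simp_all add: e.simps(2) L_def e_in_H)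
  have "e (c # p) * h * e (c # p) = L * (e p * h * e p) * L"
    by (subst L(1), subst L(2)) (simp only: mult.assoc)
  also have "\<dots> = \<kappa> \<cdot> (L * (e p * L))" unfolding assms(4) by (simp add: mult.assoc)
  also have "L * (e p * L) = L * e (c # p)" by (simp only: L(2))
  also have "\<dots> = e (c # p)"
    unfolding L_def using pev_eigen[OF X_e[OF assms(1,2)]] poly_lagrange_1[OF assms(1,2)] by simp
  finally show ?thesis .
qed

text \<open>In a coset \<open>h * s k * h'\<close>, the sum of all \<open>e r\<close> is inserted
  before \<open>h'\<close>. Other shapes than that of \<open>p'\<close> are killed by
  \<open>block_zero\<close>. For the remaining \<open>r\<close>, the off-diagonal part of
  \<open>s k * e (c # r)\<close> has another value of \<open>X k\<close> than \<open>e p\<close> and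
  dies against it; the diagonal part gives a corner of an element of \<open>H k\<close>, known by
  induction.\<close>

lemma corner:
  assumes "x \<in> H k" "p \<in> tableaux k" "k \<le> n"
  shows "\<exists>\<kappa>. e p * x * e p = \<kappa> \<cdot> e p"
  using assms
proof (induction k arbitrary: x p)
  case 0
  have "x \<in> alg {}" using 0 by (simp add: gens_def)
  then have "x \<in> range emb"
  proof (rule alg_left_induct)
    show "1 \<in> range emb" using emb_1 by (metis rangeI)
    show "x + y \<in> range emb" if "x \<in> range emb" "y \<in> range emb" for x y
      using that by (auto simp flip: emb_add)
  qed auto
  then show ?case using 0 by (auto simp: tableaux_0 simp flip: scl_emb) (metis emb_1 mult_1_right scl_emb)
next
  case (Suc k)
  obtain c p' where p: "p = c # p'" "p' \<in> tableaux k" "c \<in> addable (shape p')"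
    using Suc.prems(2) unfolding tableaux_Suc by auto
  have std: "standard (c # p')" "length p' = k" "k < n"
    using p Suc.prems by (auto simp: tableaux_def)
  have lower: "\<exists>\<kappa>. e p * h * e p = \<kappa> \<cdot> e p" if "h \<in> H k" for h
    using Suc.IH[OF that p(2)] corner_lower[of c p' h] std that p(1) by auto
  have Xp: "X k * e p = val c \<cdot> e p" using X_e[of c p'] std p(1) by simp
  have pX: "e p * X k = val c \<cdot> e p" using X_e_commute[of k p] Xp std p(1) by simp
  define L where "L = pev (X k) (lagrange (addable (shape p')) c)"
  have comm: "L * y = y * L" if "y \<in> H k" for y
    unfolding L_def using X_H_commute[OF that] std by (intro pev_commute[symmetric]) auto
  have L: "e p = L * e p'" "e p = e p' * L"
    using comm[of "e p'"] by (simp_all add: e.simps(2) L_def e_in_H p(1) std)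
  have corner_coset: "\<exists>\<kappa>. e p * (h * s k * h') * e p = \<kappa> \<cdot> e p"
    if h: "1 \<le> k" "h \<in> H k" "h' \<in> H k" for h h'
  proof -
    have "\<exists>\<kappa>. e p * h * s k * (e r * h' * e p) = \<kappa> \<cdot> e p" if r: "r \<in> tableaux k" for r
    proof (cases "shape r = shape p'")
      case False
      then have "e r * h' * e p' = 0" using block_zero[OF r p(2) _ h(3)] std by simp
      then have "e r * h' * e p = 0" by (simp add: L(2) flip: mult.assoc)
      then show ?thesis by (intro exI[of _ 0]) simp
    next
      case True
      obtain b r' where r': "r = b # r'" using r h by (cases r) (auto simp: tableaux_def)
      have cr: "standard (c # b # r')" "Suc (length r') = k" "Suc (length r') < n"
        using r r' p(3) True std by (auto simp: tableaux_def)
      obtain a y where ay: "s k * e (c # r) = a \<cdot> e (c # r) + y" "X k * y = val b \<cdot> y"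
        using s_e_top[OF cr(1,3)] cr(2) r' by auto
      \<comment> \<open>\<open>X k\<close> commutes with \<open>h\<close>, and has the value
        \<open>val c\<close> at \<open>e p\<close> but \<open>val b\<close> at
        \<open>y\<close>.\<close>
      have "e p * h * (X k * y) = (e p * X k) * h * y"
        using X_H_commute[OF h(2)] std by (simp add: mult.assoc)
      then have "val b \<cdot> (e p * h * y) = val c \<cdot> (e p * h * y)"
        by (simp add: ay(2) pX)
      then have hy: "e p * h * y = 0"
        using val_successive[OF cr(1)] cr by (metis add_2_eq_Suc' scl_cancel Suc_leI)
      have er: "e (c # r) = L * e r"
        using cr(2) True by (simp add: e.simps(2)[of c] L_def r')
      have "e r * h' * e p = L * (e r * h') * e p'"
        unfolding L(1) using comm[OF alg.mult[OF e_in_H[of r k] h(3)]] r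
        by (simp add: tableaux_def flip: mult.assoc)
      \<comment> \<open>The factor of the last box commutes with \<open>H k\<close>, so it moves
        from \<open>e p\<close> to \<open>e r\<close>, where \<open>s_e_top\<close> needs
        it.\<close>
      then have w: "e r * h' * e p = e (c # r) * h' * e p'" by (simp add: er mult.assoc)
      have "e p * h * s k * (e r * h' * e p) = e p * h * (s k * e (c # r)) * h' * e p'"
        unfolding w by (simp only: mult.assoc)
      also have "\<dots> = a \<cdot> (e p * h * (e (c # r) * h' * e p')) + (e p * h * y) * h' * e p'"
        by (simp add: ay(1) distrib_left distrib_right mult.assoc)
      also have "\<dots> = a \<cdot> (e p * (h * e r * h') * e p)"
        unfolding hy w[symmetric] by (simp add: mult.assoc)
      finally have eq: "e p * h * s k * (e r * h' * e p) = a \<cdot> (e p * (h * e r * h') * e p)" .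
      have "h * e r * h' \<in> H k"
        using h r by (intro alg.mult e_in_H) (auto simp: tableaux_def)
      from lower[OF this] obtain \<kappa> where "e p * (h * e r * h') * e p = \<kappa> \<cdot> e p" by blast
      then show ?thesis unfolding eq by auto
    qed
    then obtain \<kappa> where \<kappa>: "\<And>r. r \<in> tableaux k \<Longrightarrow> e p * h * s k * (e r * h' * e p) = \<kappa> r \<cdot> e p"
      by metis
    have "e p * (h * s k * h') * e p = e p * h * s k * (\<Sum>r\<in>tableaux k. e r) * h' * e p"
      using std by (simp add: sum_e mult.assoc)
    also have "\<dots> = (\<Sum>r\<in>tableaux k. e p * h * s k * (e r * h' * e p))"
      by (simp add: sum_distrib_left sum_distrib_right mult.assoc)
    also have "\<dots> = (\<Sum>r\<in>tableaux k. \<kappa> r \<cdot> e p)" by (rule sum.cong) (simp_all add: \<kappa>)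
    also have "\<dots> = (\<Sum>r\<in>tableaux k. \<kappa> r) \<cdot> e p"
      by (rule scl_sum_left[symmetric])
    finally show ?thesis by blast
  qed
  have pev: "pev (X k) Q * e p = poly Q (val c) \<cdot> e p" for Q by (rule pev_eigen[OF Xp])
  have "x \<in> mackey k" using H_Suc_subset_mackey[of k] Suc.prems std by auto
  then show ?case
  proof (induction rule: mackey.induct)
    case (pol h Q)
    then obtain \<kappa> where "e p * h * e p = \<kappa> \<cdot> e p" using lower by blast
    then have "e p * (h * pev (X k) Q) * e p = (poly Q (val c) * \<kappa>) \<cdot> e p"
      by (simp add: mult.assoc pev)
    then show ?case by blast
  next
    case (coset h h' Q)
    then obtain \<kappa> where "e p * (h * s k * h') * e p = \<kappa> \<cdot> e p" using corner_coset by blast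
    then have "e p * (h * s k * h' * pev (X k) Q) * e p = (poly Q (val c) * \<kappa>) \<cdot> e p"
      by (simp add: mult.assoc pev)
    then show ?case by blast
  next
    case (add x y)
    then obtain \<kappa> \<kappa>' where "e p * x * e p = \<kappa> \<cdot> e p" "e p * y * e p = \<kappa>' \<cdot> e p" by blast
    then have "e p * (x + y) * e p = (\<kappa> + \<kappa>') \<cdot> e p"
      by (simp add: distrib_left distrib_right scl_distrib)
    then show ?case by blast
  qed
qed

section \<open>Centralizers\<close>

lemma sum_e_times: "k \<le> n \<Longrightarrow> x = (\<Sum>p\<in>tableaux k. e p * x)"
  using sum_e[of k] by (simp flip: sum_distrib_right)

lemma commuting_with_X:
  assumes "x \<in> H n" "\<And>i. i < n \<Longrightarrow> x * X i = X i * x"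
  shows "x \<in> alg (X ` {..<n})"
proof -
  have "e p * x \<in> alg (X ` {..<n})" if p: "p \<in> tableaux n" for p
  proof -
    have len: "standard p" "length p = n" using p by (auto simp: tableaux_def)
    have "x * e p = e p * x"
      by (rule alg_commute[OF e_in_alg_X[of p n]]) (use len assms in auto)
    then have "e p * x = e p * x * e p"
      using e_square[of p] len by (simp add: mult.assoc) (simp flip: mult.assoc)
    moreover obtain \<kappa> where "e p * x * e p = \<kappa> \<cdot> e p" using corner[OF assms(1) p] by blast
    ultimately show ?thesis using e_in_alg_X[of p n] len by (simp add: alg_scl)
  qed
  then have "(\<Sum>p\<in>tableaux n. e p * x) \<in> alg (X ` {..<n})" by (rule alg_sum)
  then show ?thesis using sum_e_times[of n x] by simp
qed

text \<open>Off-diagonal terms vanish for two reasons: tableaux that agree up to the last box have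
  different shapes, and otherwise \<open>e p'\<close> separates them and commutes with
  \<open>x\<close>. The coefficients are then interpolated, for each shape separately, by a
  polynomial in \<open>X k\<close> multiplying the central \<open>shape_sum\<close>.\<close>

lemma commuting_with_H:
  assumes n: "n = Suc k" and x: "x \<in> H n" and comm: "\<And>y. y \<in> H k \<Longrightarrow> x * y = y * x"
  shows "x \<in> alg (insert (X k) {z \<in> H k. \<forall>y\<in>H k. z * y = y * z})"
proof -
  have diag: "\<exists>\<kappa>. e p * x = \<kappa> \<cdot> e p" if p: "p \<in> tableaux n" for p
  proof -
    have "e p * x * e r = 0" if r: "r \<in> tableaux n" "r \<noteq> p" for r
    proof -
      obtain c p' where p': "p = c # p'" "p' \<in> tableaux k" "c \<in> addable (shape p')"
        using p unfolding n tableaux_Suc by auto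
      obtain d r' where r': "r = d # r'" "r' \<in> tableaux k" "d \<in> addable (shape r')"
        using r unfolding n tableaux_Suc by auto
      show ?thesis
      proof (cases "p' = r'")
        case True
        obtain j i where c: "c = (j, i)" by (cases c)
        have "c \<noteq> d" using r p' r' True by auto
        then have "c \<in> shape p" "c \<notin> shape r"
          using p' r' True by (auto simp: c add_box_def addable_def)
        then show ?thesis using block_zero[OF p r(1) _ x] by auto
      next
        case False
        have "length r' = k" "length p' = k" using p' r' by (auto simp: tableaux_def)
        then have eH: "e p' \<in> H k" by (simp add: e_in_H)
        define L where "L = pev (X k) (lagrange (addable (shape r')) d)"
        have "e p' * L = L * e p'"
          unfolding L_def using X_H_commute[OF eH] n by (intro pev_commute) auto
        then have "e p' * e r = L * (e p' * e r')"
          using \<open>length r' = k\<close> by (simp add: r'(1) e.simps(2) L_def flip: mult.assoc)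
        also have "e p' * e r' = 0" using e_times_e[OF p'(2) r'(2)] False n by simp
        finally have "x * (e p' * e r) = 0" by simp
        then have "e p' * x * e r = 0" unfolding comm[OF eH, symmetric] by (simp only: mult.assoc)
        then show ?thesis by (simp add: p'(1) e.simps(2) mult.assoc)
      qed
    qed
    then have "(\<Sum>r\<in>tableaux n. e p * x * e r) = (\<Sum>r\<in>{p}. e p * x * e r)"
      by (intro sum.mono_neutral_right) (use p finite_tableaux in auto)
    then have "e p * x = e p * x * e p"
      by (simp add: sum_e flip: sum_distrib_left)
    then show ?thesis using corner[OF x p] by auto
  qed
  \<comment> \<open>The scalar is chosen before \<open>p\<close>. The factorization
    \<open>e p = a * e r * b\<close> transports it from \<open>r\<close>, because \<open>x\<close>
    commutes with \<open>b \<in> H k\<close>.\<close>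
  have "\<exists>\<kappa>. \<forall>p. p \<in> tableaux k \<and> shape p = S \<and> c \<in> addable S \<longrightarrow> e (c # p) * x = \<kappa> \<cdot> e (c # p)" for S c
  proof (cases "\<exists>r. r \<in> tableaux k \<and> shape r = S \<and> c \<in> addable S")
    case True
    then obtain r where r: "r \<in> tableaux k" "shape r = S" "c \<in> addable S" by blast
    then have "c # r \<in> tableaux n" by (simp add: n tableaux_def)
    from diag[OF this] obtain \<kappa> where \<kappa>: "e (c # r) * x = \<kappa> \<cdot> e (c # r)" by blast
    have "e (c # p) * x = \<kappa> \<cdot> e (c # p)" if p: "p \<in> tableaux k" "shape p = S" for p
    proof -
      have "swap\<^sup>*\<^sup>* p r" using shape_eq_swaps[of r p] p r by (auto simp: tableaux_def)
      then obtain a b where ab: "a \<in> H k" "b \<in> H k" "e p = a * e r * b"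
        using swaps_factor[OF _ _ spectral_n, of p r] p n by (auto simp: tableaux_def)
      define L where "L = pev (X k) (lagrange (addable S) c)"
      have La: "L * a = a * L"
        unfolding L_def using X_H_commute[OF ab(1)] n by (intro pev_commute[symmetric]) auto
      have "e (c # p) = (L * a) * e r * b"
        using p ab by (simp add: e.simps(2) L_def tableaux_def mult.assoc)
      then have cp: "e (c # p) = a * e (c # r) * b"
        unfolding La using r by (simp add: e.simps(2) L_def tableaux_def mult.assoc)
      then have "e (c # p) * x = a * (e (c # r) * x) * b"
        using comm[OF ab(2)] by (simp add: mult.assoc)
      then show ?thesis by (simp add: \<kappa> cp mult.assoc)
    qed
    then show ?thesis by blast
  qed blast
  then obtain \<kappa> where \<kappa>: "\<And>S c p. p \<in> tableaux k \<Longrightarrow> shape p = S \<Longrightarrow> c \<in> addable S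
    \<Longrightarrow> e (c # p) * x = \<kappa> S c \<cdot> e (c # p)" by metis
  define F where "F S = (\<Sum>c\<in>addable S. \<kappa> S c \<cdot> pev (X k) (lagrange (addable S) c))" for S
  have "x = (\<Sum>p\<in>tableaux (Suc k). e p * x)" using sum_e_times[of n x] n by simp
  also have "\<dots> = (\<Sum>p\<in>tableaux k. \<Sum>c\<in>addable (shape p). e (c # p) * x)"
    by (rule sum_tableaux_Suc)
  also have "\<dots> = (\<Sum>p\<in>tableaux k. F (shape p) * e p)"
    unfolding F_def sum_distrib_right
    by (intro sum.cong refl) (simp add: \<kappa>, simp add: e.simps(2) tableaux_def)
  also have "\<dots> = (\<Sum>S\<in>shape ` tableaux k. \<Sum>p\<in>{p \<in> tableaux k. shape p = S}. F (shape p) * e p)"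
    by (rule sum.image_gen[OF finite_tableaux])
  also have "\<dots> = (\<Sum>S\<in>shape ` tableaux k. F S * shape_sum k S)"
    unfolding shape_sum_def sum_distrib_left by (intro sum.cong refl) auto
  also have "\<dots> \<in> alg (insert (X k) {z \<in> H k. \<forall>y\<in>H k. z * y = y * z})"
  proof -
    have "shape_sum k S \<in> {z \<in> H k. \<forall>y\<in>H k. z * y = y * z}" for S
      using shape_sum_in_H shape_sum_central n by simp
    then show ?thesis
      unfolding F_def by (intro alg_sum alg.mult alg_scl pev_in_alg alg.gen) auto
  qed
  finally show ?thesis .
qed

end

section \<open>A faithful representation of a quotient of the free algebra\<close>

abbreviation (input) fscale :: "'k \<Rightarrow> ('w \<Rightarrow> 'k) \<Rightarrow> 'w \<Rightarrow> 'k::field" where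
  "fscale c f \<equiv> (\<lambda>w. c * f w)"

interpretation fun_space: vector_space fscale
  by unfold_locales (auto simp: fun_eq_iff algebra_simps)

text \<open>The Hecke algebra depends on \<open>q\<close>, \<open>v\<close> and \<open>n\<close>,
  which a type cannot. Endomorphisms of the space of all functions on words form one ring into which
  all these quotients embed.\<close>

typedef (overloaded) ('w, 'k::field) lin =
  "{f :: ('w \<Rightarrow> 'k) \<Rightarrow> ('w \<Rightarrow> 'k). (\<forall>x y. f (x + y) = f x + f y) \<and> (\<forall>c x. f (fscale c x) = fscale c (f x))}"
  by (rule exI[of _ id]) simp

setup_lifting type_definition_lin

instantiation lin :: (type, field) ring_1
begin

lift_definition zero_lin :: "('a, 'b) lin" is "\<lambda>x. 0" by auto
lift_definition one_lin :: "('a, 'b) lin" is "\<lambda>x. x" by auto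
lift_definition plus_lin :: "('a, 'b) lin \<Rightarrow> ('a, 'b) lin \<Rightarrow> ('a, 'b) lin" is "\<lambda>f g x. f x + g x"
  by (auto simp: algebra_simps)
lift_definition uminus_lin :: "('a, 'b) lin \<Rightarrow> ('a, 'b) lin" is "\<lambda>f x. - f x"
  by (auto simp: algebra_simps)
lift_definition minus_lin :: "('a, 'b) lin \<Rightarrow> ('a, 'b) lin \<Rightarrow> ('a, 'b) lin" is "\<lambda>f g x. f x - g x"
  by (auto simp: algebra_simps)
lift_definition times_lin :: "('a, 'b) lin \<Rightarrow> ('a, 'b) lin \<Rightarrow> ('a, 'b) lin" is "\<lambda>f g x. f (g x)"
  by auto

instance
proof
  fix a b c :: "('a, 'b) lin"
  have add: "Rep_lin a (x + y) = Rep_lin a x + Rep_lin a y" for x y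
    using Rep_lin[of a] by blast
  have zero: "Rep_lin a 0 = 0" using add[of 0 0] by simp
  note rep = zero_lin.rep_eq one_lin.rep_eq plus_lin.rep_eq uminus_lin.rep_eq minus_lin.rep_eq times_lin.rep_eq
  show "a * b * c = a * (b * c)" "a + b + c = a + (b + c)" "a + b = b + a" "0 + a = a" "- a + a = 0"
    "a - b = a + - b" "1 * a = a" "a * 1 = a" "(a + b) * c = a * c + b * c" "a * (b + c) = a * b + a * c"
    unfolding Rep_lin_inject[symmetric] rep add by (simp_all only: add_ac add_0_left add_uminus_conv_diff left_minus diff_self)
  show "(0 :: ('a, 'b) lin) \<noteq> 1"
  proof
    assume "(0 :: ('a, 'b) lin) = 1"
    from arg_cong[OF this, of "\<lambda>a. Rep_lin a (\<lambda>_. 1) undefined"] show False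
      by (simp add: zero_lin.rep_eq one_lin.rep_eq)
  qed
qed

end

lift_definition lin_scalar :: "'k::field \<Rightarrow> ('w, 'k) lin" is "\<lambda>c. fscale c"
  by (simp add: fun_eq_iff distrib_left mult.left_commute)

lemma Rep_lin_scale: "Rep_lin f (fscale c x) = fscale c (Rep_lin f x)"
proof -
  have "\<forall>c x. Rep_lin f (fscale c x) = fscale c (Rep_lin f x)"
    using Rep_lin[of f] by (elim CollectE conjE)
  then show ?thesis by (elim allE)
qed

lemma lin_central_scalars: "central_scalars (lin_scalar :: 'k::field \<Rightarrow> ('w, 'k) lin)"
proof (rule central_scalars.intro)
  note rep = one_lin.rep_eq plus_lin.rep_eq times_lin.rep_eq lin_scalar.rep_eq
  show "lin_scalar (a + b) = (lin_scalar a + lin_scalar b :: ('w, 'k) lin)" for a b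
    unfolding Rep_lin_inject[symmetric] rep by (intro ext) (simp only: plus_fun_apply distrib_right)
  show "lin_scalar (a * b) = (lin_scalar a * lin_scalar b :: ('w, 'k) lin)" for a b
    unfolding Rep_lin_inject[symmetric] rep by (simp only: mult.assoc)
  show "lin_scalar 1 = (1 :: ('w, 'k) lin)"
    unfolding Rep_lin_inject[symmetric] rep by (simp only: mult_1_left)
  show "x * lin_scalar a = lin_scalar a * x" for a and x :: "('w, 'k) lin"
    unfolding Rep_lin_inject[symmetric] rep Rep_lin_scale ..
qed

definition typed_ring :: "'a::ring_1 ring" where
  "typed_ring = \<lparr>carrier = UNIV, monoid.mult = (*), one = 1, zero = 0, add = (+)\<rparr>"

lemma typed_ring_simps [simp]:
  "carrier typed_ring = UNIV" "x \<otimes>\<^bsub>typed_ring\<^esub> y = x * y" "\<one>\<^bsub>typed_ring\<^esub> = 1"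
  "\<zero>\<^bsub>typed_ring\<^esub> = 0" "x \<oplus>\<^bsub>typed_ring\<^esub> y = x + y"
  by (simp_all add: typed_ring_def)

lemma ring_typed_ring: "ring (typed_ring :: 'a::ring_1 ring)"
proof (rule ringI)
  show "abelian_group (typed_ring :: 'a ring)"
  proof (rule abelian_groupI)
    show "\<exists>y\<in>carrier typed_ring. y \<oplus>\<^bsub>typed_ring\<^esub> x = \<zero>\<^bsub>typed_ring\<^esub>" for x :: 'a
      by (rule bexI[of _ "- x"]) auto
  qed (simp_all add: add_ac)
  show "Group.monoid (typed_ring :: 'a ring)" by (rule monoidI) (simp_all add: mult.assoc)
qed (simp_all add: algebra_simps)

text \<open>A basis of \<open>I\<close> is extended to one of \<open>F\<close>; \<open>\<pi>\<close>
  kills the first part and fixes the added vectors. Their span is a complement of \<open>I\<close>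
  in \<open>F\<close>, hence a model of the quotient inside the space.\<close>

lemma (in vector_space) projection_along:
  assumes "subspace I" "subspace F" "I \<subseteq> F"
  obtains \<pi> where "Vector_Spaces.linear scale scale \<pi>" "\<And>x. \<pi> x \<in> F" "\<And>x. \<pi> (\<pi> x) = \<pi> x"
    "\<And>x. x \<in> F \<Longrightarrow> \<pi> x - x \<in> I" "\<And>x. x \<in> I \<Longrightarrow> \<pi> x = 0"
proof -
  interpret pair: vector_space_pair scale scale ..
  obtain B where B: "B \<subseteq> I" "independent B" "I \<subseteq> span B"
    using maximal_independent_subset[of I] by blast
  obtain C where C: "B \<subseteq> C" "C \<subseteq> F" "independent C" "F \<subseteq> span C"
    using maximal_independent_subset_extend[of B F] B assms(3) by blast
  define f where "f b = (if b \<in> B then 0 else b)" for b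
  define \<pi> where "\<pi> = pair.construct C f"
  have lin: "Vector_Spaces.linear scale scale \<pi>"
    unfolding \<pi>_def by (rule pair.linear_construct[OF C(3)])
  interpret L: Vector_Spaces.linear scale scale \<pi> by (rule lin)
  have basis: "\<pi> b = f b" if "b \<in> C" for b
    unfolding \<pi>_def by (rule pair.construct_basis[OF C(3) that])
  have f_F: "f b \<in> F" if "b \<in> C" for b
    using that C(2) subspace_0[OF assms(2)] by (auto simp: f_def)
  have range: "\<pi> x \<in> span (f ` C)" for x
    unfolding \<pi>_def by (rule pair.construct_in_span[OF C(3)])
  show ?thesis
  proof
    show "\<pi> x \<in> F" for x
      using range[of x] span_minimal[of "f ` C" F] f_F assms(2) by auto
    have ff: "\<pi> (f b) = f b" if "b \<in> C" for b
      using basis[OF that] by (simp add: f_def L.zero)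
    have "f ` C \<subseteq> {y. \<pi> y = y}" using ff by auto
    moreover have "subspace {y. \<pi> y = y}"
      by (auto simp: subspace_def L.zero L.add L.scale)
    ultimately have "span (f ` C) \<subseteq> {y. \<pi> y = y}" by (rule span_minimal)
    then show "\<pi> (\<pi> x) = \<pi> x" for x using range by auto
    have "C \<subseteq> {x. \<pi> x - x \<in> I}"
    proof
      fix b assume "b \<in> C"
      then show "b \<in> {x. \<pi> x - x \<in> I}"
        using basis B(1) subspace_0[OF assms(1)] subspace_neg[OF assms(1)] by (auto simp: f_def)
    qed
    moreover have "subspace {x. \<pi> x - x \<in> I}"
    proof (rule subspaceI)
      show "0 \<in> {x. \<pi> x - x \<in> I}" using subspace_0[OF assms(1)] by (simp add: L.zero)
      show "x + y \<in> {x. \<pi> x - x \<in> I}" if "x \<in> {x. \<pi> x - x \<in> I}" "y \<in> {x. \<pi> x - x \<in> I}" for x y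
        using that subspace_add[OF assms(1), of "\<pi> x - x" "\<pi> y - y"] by (simp add: L.add algebra_simps)
      show "scale c x \<in> {x. \<pi> x - x \<in> I}" if "x \<in> {x. \<pi> x - x \<in> I}" for c x
        using that subspace_scale[OF assms(1), of "\<pi> x - x" c] by (simp add: L.scale scale_right_diff_distrib)
    qed
    ultimately have "span C \<subseteq> {x. \<pi> x - x \<in> I}" by (rule span_minimal)
    then show "\<pi> x - x \<in> I" if "x \<in> F" for x using that C(4) by auto
    have "B \<subseteq> {x. \<pi> x = 0}" using basis C(1) by (auto simp: f_def)
    moreover have "subspace {x. \<pi> x = 0}" by (auto simp: subspace_def L.zero L.add L.scale)
    ultimately have "span B \<subseteq> {x. \<pi> x = 0}" by (rule span_minimal)
    then show "\<pi> x = 0" if "x \<in> I" for x using that B(3) by auto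
  qed (rule lin)
qed

text \<open>The product formula makes sense without finite support, so the free algebra acts on all
  functions and the alphabet no longer enters.\<close>

definition conv :: "('g list \<Rightarrow> 'k::field) \<Rightarrow> ('g list \<Rightarrow> 'k) \<Rightarrow> 'g list \<Rightarrow> 'k" where
  "conv f x = (\<lambda>w. \<Sum>i\<le>length w. f (take i w) * x (drop i w))"

lemma free_algebra_simps:
  "f \<otimes>\<^bsub>free_algebra G\<^esub> g = conv f g" "f \<oplus>\<^bsub>free_algebra G\<^esub> g = f + g" "\<zero>\<^bsub>free_algebra G\<^esub> = 0"
  "\<one>\<^bsub>free_algebra G\<^esub> = free_scalar 1"
  by (auto simp: free_algebra_def conv_def free_scalar_def)

lemma conv_linear:
  "conv f (x + y) = conv f x + conv f y" "conv (f + g) x = conv f x + conv g x"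
  "conv f (x - y) = conv f x - conv f y" "conv f (fscale c x) = fscale c (conv f x)"
  by (auto simp: conv_def fun_eq_iff algebra_simps sum.distrib sum_subtractf sum_distrib_left)

lemma conv_assoc: "conv (conv f g) h = conv f (conv g h)"
  using free_algebra_mult_assoc[where f = f and g = g and h = h and G = UNIV] by (simp add: free_algebra_simps)

lemma conv_scalar: "conv (free_scalar c) x = fscale c x"
proof
  fix w
  have "conv (free_scalar c) x w = (\<Sum>i\<le>length w. if i = 0 then c * x w else 0)"
    unfolding conv_def by (rule sum.cong) (auto simp: free_scalar_def)
  then show "conv (free_scalar c) x w = c * x w" by simp
qed

lemma free_scalar_carrier: "free_scalar c \<in> carrier (free_algebra G)"
  by (auto simp: free_algebra_def free_scalar_def)

lemma free_gen_carrier: "x \<in> G \<Longrightarrow> free_gen x \<in> carrier (free_algebra G)"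
  by (auto simp: free_algebra_def free_gen_def)

text \<open>The free algebra acts on its quotient by the ideal \<open>I\<close>, realized as the image of a linear
  projection \<open>\<pi>\<close> on the space of all functions; on the complementary space it acts by the
  character \<open>\<epsilon>\<close>, so that the representation is unital.\<close>

lemma faithful_representation:
  fixes G :: "'g set" and I :: "('g list \<Rightarrow> 'k::field) set" and \<epsilon> :: "('g list \<Rightarrow> 'k) \<Rightarrow> 'k"
  defines "F \<equiv> free_algebra G"
  assumes I: "ideal I F"
    and \<epsilon>_add: "\<And>f g. f \<in> carrier F \<Longrightarrow> g \<in> carrier F \<Longrightarrow> \<epsilon> (f + g) = \<epsilon> f + \<epsilon> g"
    and \<epsilon>_mult: "\<And>f g. f \<in> carrier F \<Longrightarrow> g \<in> carrier F \<Longrightarrow> \<epsilon> (conv f g) = \<epsilon> f * \<epsilon> g"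
    and \<epsilon>_scalar: "\<And>c. \<epsilon> (free_scalar c) = c"
    and \<epsilon>_I: "\<And>f. f \<in> I \<Longrightarrow> \<epsilon> f = 0"
  obtains \<Psi> :: "('g list \<Rightarrow> 'k) \<Rightarrow> ('g list, 'k) lin"
  where "ring_hom_ring F typed_ring \<Psi>" "a_kernel F typed_ring \<Psi> = I"
    "\<And>c. \<Psi> (free_scalar c) = lin_scalar c"
proof -
  interpret ideal I F by (rule I)
  have F_add: "x + y \<in> carrier F" if "x \<in> carrier F" "y \<in> carrier F" for x y
    using a_closed that by (simp add: F_def free_algebra_simps)
  have F_conv: "conv x y \<in> carrier F" if "x \<in> carrier F" "y \<in> carrier F" for x y
    using m_closed that by (simp add: F_def free_algebra_simps)
  have I_conv: "conv x y \<in> I" "conv y x \<in> I" if "x \<in> carrier F" "y \<in> I" for x y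
    using I_l_closed[OF that(2,1)] I_r_closed[OF that(2,1)] by (simp_all add: F_def free_algebra_simps)
  have scalar: "free_scalar c \<in> carrier F" for c by (simp add: F_def free_scalar_carrier)
  have I_sub: "I \<subseteq> carrier F" by (rule a_subset)
  have sub_I: "fun_space.subspace I"
    unfolding fun_space.subspace_def
    using additive_subgroup.zero_closed[OF is_additive_subgroup] a_closed
      additive_subgroup.a_closed[OF is_additive_subgroup] I_conv(1)[OF scalar]
    by (auto simp: F_def free_algebra_simps conv_scalar)
  have sub_F: "fun_space.subspace (carrier F)"
    unfolding fun_space.subspace_def
    using zero_closed F_add F_conv[OF scalar] by (auto simp: F_def free_algebra_simps conv_scalar)
  obtain \<pi> where lin: "Vector_Spaces.linear fscale fscale \<pi>"
    and \<pi>_F: "\<And>x. \<pi> x \<in> carrier F" and \<pi>_\<pi>: "\<And>x. \<pi> (\<pi> x) = \<pi> x"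
    and \<pi>_mod: "\<And>x. x \<in> carrier F \<Longrightarrow> \<pi> x - x \<in> I" and \<pi>_I: "\<And>x. x \<in> I \<Longrightarrow> \<pi> x = 0"
    using fun_space.projection_along[OF sub_I sub_F I_sub] by blast
  interpret L: Vector_Spaces.linear fscale fscale \<pi> by (rule lin)
  have \<pi>_compl: "\<pi> (\<lambda>w. x w - \<pi> x w) = 0" for x
    using L.diff[of x "\<pi> x"] by (simp add: \<pi>_\<pi> fun_diff_def)
  define \<Psi> where "\<Psi> f = Abs_lin (\<lambda>x. \<pi> (conv f (\<pi> x)) + fscale (\<epsilon> f) (x - \<pi> x))" for f
  have rep: "Rep_lin (\<Psi> f) = (\<lambda>x. \<pi> (conv f (\<pi> x)) + fscale (\<epsilon> f) (x - \<pi> x))" for f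
    unfolding \<Psi>_def
  proof (rule Abs_lin_inverse, safe)
    fix x y :: "'g list \<Rightarrow> 'k" and c
    show "\<pi> (conv f (\<pi> (x + y))) + fscale (\<epsilon> f) (x + y - \<pi> (x + y)) =
      \<pi> (conv f (\<pi> x)) + fscale (\<epsilon> f) (x - \<pi> x) + (\<pi> (conv f (\<pi> y)) + fscale (\<epsilon> f) (y - \<pi> y))"
      by (simp add: L.add conv_linear fun_eq_iff algebra_simps)
    show "\<pi> (conv f (\<pi> (fscale c x))) + fscale (\<epsilon> f) (fscale c x - \<pi> (fscale c x)) =
      fscale c (\<pi> (conv f (\<pi> x)) + fscale (\<epsilon> f) (x - \<pi> x))"
      by (simp add: L.scale conv_linear fun_eq_iff algebra_simps)
  qed
  \<comment> \<open>Replacing \<open>z\<close> by \<open>\<pi> z\<close> changes the product by an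
    element of \<open>I\<close>; this makes the compressed action multiplicative.\<close>
  have \<pi>_conv: "\<pi> (conv f (\<pi> z)) = \<pi> (conv f z)" if "f \<in> carrier F" "z \<in> carrier F" for f z
  proof -
    have "\<pi> (conv f (\<pi> z - z)) = 0" using I_conv(1)[OF that(1) \<pi>_mod[OF that(2)]] \<pi>_I by blast
    then show ?thesis by (simp add: conv_linear L.diff)
  qed
  have hom: "ring_hom_ring F typed_ring \<Psi>"
  proof (rule ring_hom_ringI)
    show "ring F" "ring (typed_ring :: ('g list, 'k) lin ring)"
      by (simp_all add: F_def free_algebra_ring ring_typed_ring)
    show "\<Psi> (f \<otimes>\<^bsub>F\<^esub> g) = \<Psi> f \<otimes>\<^bsub>typed_ring\<^esub> \<Psi> g" if fg: "f \<in> carrier F" "g \<in> carrier F" for f g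
    proof (simp add: Rep_lin_inject[symmetric] times_lin.rep_eq, rule ext)
      fix x
      define y where "y = Rep_lin (\<Psi> g) x"
      have "\<pi> (fscale (\<epsilon> g) (x - \<pi> x)) = 0"
        unfolding L.scale L.diff \<pi>_\<pi> by (simp add: fun_eq_iff)
      then have y1: "\<pi> y = \<pi> (conv g (\<pi> x))"
        unfolding y_def rep L.add \<pi>_\<pi> by simp
      have y2: "y - \<pi> (conv g (\<pi> x)) = fscale (\<epsilon> g) (x - \<pi> x)"
        unfolding y_def rep by (rule add_diff_cancel_left')
      have "Rep_lin (\<Psi> f) y = \<pi> (conv f (\<pi> (conv g (\<pi> x)))) + fscale (\<epsilon> f) (fscale (\<epsilon> g) (x - \<pi> x))"
        unfolding rep[of f] y1 y2 ..
      also have "\<dots> = \<pi> (conv (conv f g) (\<pi> x)) + fscale (\<epsilon> (conv f g)) (x - \<pi> x)"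
        by (simp only: \<pi>_conv[OF fg(1) F_conv[OF fg(2) \<pi>_F]] conv_assoc \<epsilon>_mult[OF fg] mult.assoc)
      also have "\<dots> = Rep_lin (\<Psi> (f \<otimes>\<^bsub>F\<^esub> g)) x"
        unfolding rep F_def free_algebra_simps ..
      finally show "Rep_lin (\<Psi> (f \<otimes>\<^bsub>F\<^esub> g)) x = Rep_lin (\<Psi> f) (Rep_lin (\<Psi> g) x)"
        unfolding y_def by (rule sym)
    qed
    show "\<Psi> (f \<oplus>\<^bsub>F\<^esub> g) = \<Psi> f \<oplus>\<^bsub>typed_ring\<^esub> \<Psi> g" if fg: "f \<in> carrier F" "g \<in> carrier F" for f g
      by (simp add: Rep_lin_inject[symmetric] plus_lin.rep_eq rep F_def free_algebra_simps conv_linear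
          \<epsilon>_add[OF fg, unfolded F_def] L.add fun_eq_iff algebra_simps)
    show "\<Psi> \<one>\<^bsub>F\<^esub> = \<one>\<^bsub>typed_ring\<^esub>"
      by (simp add: Rep_lin_inject[symmetric] one_lin.rep_eq rep F_def free_algebra_simps conv_scalar
          \<epsilon>_scalar \<pi>_\<pi> fun_eq_iff)
  qed simp
  moreover have "\<Psi> f = 0 \<longleftrightarrow> f \<in> I" if f: "f \<in> carrier F" for f
  proof
    assume "\<Psi> f = 0"
    \<comment> \<open>Acting on the unit recovers \<open>f\<close> modulo \<open>I\<close>, which
      gives faithfulness.\<close>
    then have "Rep_lin (\<Psi> f) (free_scalar 1) = 0" by (simp add: zero_lin.rep_eq)
    then have "\<pi> (\<pi> (conv f (\<pi> (free_scalar 1))) + fscale (\<epsilon> f) (free_scalar 1 - \<pi> (free_scalar 1))) = 0"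
      by (simp add: rep L.zero)
    then have "\<pi> (conv f (free_scalar 1)) = 0"
      unfolding L.add L.scale L.diff \<pi>_\<pi> \<pi>_conv[OF f scalar] by (simp add: fun_eq_iff)
    moreover have "conv f (free_scalar 1) = f"
      using free_algebra_one(2)[where f = f and G = G] by (simp add: free_algebra_simps)
    ultimately have "- f \<in> I" using \<pi>_mod[OF f] by simp
    then show "f \<in> I" using fun_space.subspace_neg[OF sub_I] by fastforce
  next
    assume "f \<in> I"
    then show "\<Psi> f = 0"
      by (simp add: Rep_lin_inject[symmetric] zero_lin.rep_eq rep I_conv(2)[OF \<pi>_F] \<pi>_I \<epsilon>_I fun_eq_iff)
  qed
  then have "a_kernel F typed_ring \<Psi> = I"
    using I_sub by (auto simp: a_kernel_def')
  moreover have "\<Psi> (free_scalar c) = lin_scalar c" for c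
    by (simp add: Rep_lin_inject[symmetric] lin_scalar.rep_eq rep conv_scalar \<epsilon>_scalar L.scale \<pi>_\<pi>
        fun_eq_iff algebra_simps)
  ultimately show ?thesis by (rule that)
qed

section \<open>Characters of the free algebra\<close>

definition character :: "('g \<Rightarrow> 'k::field) \<Rightarrow> ('g list \<Rightarrow> 'k) \<Rightarrow> 'k" where
  "character g f = (\<Sum>w | f w \<noteq> 0. f w * prod_list (map g w))"

lemma character_superset:
  assumes "finite W" "\<And>w. f w \<noteq> 0 \<Longrightarrow> w \<in> W"
  shows "character g f = (\<Sum>w\<in>W. f w * prod_list (map g w))"
  unfolding character_def by (rule sum.mono_neutral_left) (use assms in auto)

lemma character_gen: "character g (free_gen x) = g x" and character_scalar: "character g (free_scalar c) = c"
  by (subst character_superset[of "{[x]}"]; simp add: free_gen_def split: if_splits)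
     (subst character_superset[of "{[]}"]; simp add: free_scalar_def split: if_splits)

lemma character_add:
  assumes "f \<in> carrier (free_algebra G)" "h \<in> carrier (free_algebra G)"
  shows "character g (f + h) = character g f + character g h"
proof -
  define W where "W = {w. f w \<noteq> 0} \<union> {w. h w \<noteq> 0}"
  have W: "finite W" using assms by (simp add: W_def free_algebra_def)
  have "character g k = (\<Sum>w\<in>W. k w * prod_list (map g w))" if "k = f \<or> k = h \<or> k = f + h" for k
    by (rule character_superset[OF W]) (use that in \<open>auto simp: W_def\<close>)
  then show ?thesis by (simp add: distrib_right sum.distrib)
qed

text \<open>Words with a cut correspond to pairs of words, which turns the convolution into a
  product of two sums; pairs outside the supports contribute 0.\<close>

lemma character_mult:
  assumes "f \<in> carrier (free_algebra G)" "h \<in> carrier (free_algebra G)"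
  shows "character g (conv f h) = character g f * character g h"
proof -
  define A where "A = {w. f w \<noteq> 0}"
  define B where "B = {w. h w \<noteq> 0}"
  have fin: "finite A" "finite B" using assms by (simp_all add: A_def B_def free_algebra_def)
  define W where "W = (\<lambda>(u, v). u @ v) ` (A \<times> B)"
  define t where "t = (\<lambda>(u, v). f u * h v * (prod_list (map g u) * prod_list (map g v)))"
  define S where "S = (SIGMA w:W. {..length w})"
  define \<phi> where "\<phi> = (\<lambda>(w :: 'a list, i). (take i w, drop i w))"
  have finW: "finite W" "finite S" using fin by (simp_all add: W_def S_def)
  have "conv f h w \<noteq> 0 \<Longrightarrow> w \<in> W" for w
  proof -
    assume "conv f h w \<noteq> 0"
    then obtain i where "f (take i w) * h (drop i w) \<noteq> 0"
      unfolding conv_def using sum.not_neutral_contains_not_neutral by blast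
    then show "w \<in> W" unfolding W_def A_def B_def
      by (intro image_eqI[of _ _ "(take i w, drop i w)"]) auto
  qed
  then have "character g (conv f h) = (\<Sum>w\<in>W. conv f h w * prod_list (map g w))"
    by (rule character_superset[OF finW(1)])
  also have "\<dots> = (\<Sum>w\<in>W. \<Sum>i\<le>length w. t (\<phi> (w, i)))"
  proof (rule sum.cong[OF refl])
    fix w
    have "prod_list (map g w) = prod_list (map g (take i w)) * prod_list (map g (drop i w))" for i
      by (metis append_take_drop_id map_append prod_list.append)
    then show "conv f h w * prod_list (map g w) = (\<Sum>i\<le>length w. t (\<phi> (w, i)))"
      unfolding conv_def t_def \<phi>_def sum_distrib_right by simp
  qed
  also have "\<dots> = (\<Sum>z\<in>S. t (\<phi> z))"
    unfolding S_def by (subst sum.Sigma) (use finW in auto)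
  also have "\<dots> = (\<Sum>z\<in>\<phi> ` S. t z)"
    by (subst sum.reindex) (auto simp: inj_on_def \<phi>_def S_def, metis append_take_drop_id,
      metis append_take_drop_id length_take min.absorb2)
  also have "\<dots> = (\<Sum>z\<in>A \<times> B. t z)"
  proof (rule sum.mono_neutral_right)
    show "A \<times> B \<subseteq> \<phi> ` S"
    proof safe
      fix u v assume "u \<in> A" "v \<in> B"
      then have "(u @ v, length u) \<in> S" by (force simp: S_def W_def)
      moreover have "\<phi> (u @ v, length u) = (u, v)" by (simp add: \<phi>_def)
      ultimately show "(u, v) \<in> \<phi> ` S" by (metis imageI)
    qed
    show "\<forall>z\<in>\<phi> ` S - A \<times> B. t z = 0" by (auto simp: t_def A_def B_def)
  qed (use finW in simp)
  also have "\<dots> = (\<Sum>u\<in>A. f u * prod_list (map g u)) * (\<Sum>v\<in>B. h v * prod_list (map g v))"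
    by (simp add: sum_product sum.cartesian_product t_def mult_ac case_prod_unfold)
  finally show ?thesis by (simp add: character_def A_def B_def)
qed

section \<open>Transfer to the cyclotomic Hecke algebra\<close>

lemma typed_ring_a_inv: "\<ominus>\<^bsub>typed_ring\<^esub> x = - x"
  by (rule abelian_group.minus_equality[OF ring.is_abelian_group[OF ring_typed_ring]]) simp_all

definition word :: "'g list \<Rightarrow> 'k::field \<Rightarrow> 'g list \<Rightarrow> 'k" where
  "word w c = (\<lambda>u. if u = w then c else 0)"

lemma word_Nil: "word [] c = free_scalar c"
  by (simp add: word_def free_scalar_def)

lemma word_Cons: "word (x # w) c = conv (free_gen x) (word w c)"
proof
  fix u
  show "word (x # w) c u = conv (free_gen x) (word w c) u"
  proof (cases u)
    case Nil
    then show ?thesis by (simp add: word_def conv_def free_gen_def)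
  next
    case (Cons y u')
    have "conv (free_gen x) (word w c) u = (\<Sum>i\<in>{1}. free_gen x (take i u) * word w c (drop i u))"
      unfolding conv_def
    proof (rule sum.mono_neutral_right)
      show "\<forall>i\<in>{..length u} - {1}. free_gen x (take i u) * word w c (drop i u) = 0"
      proof
        fix i assume i: "i \<in> {..length u} - {1}"
        then have "length (take i u) \<noteq> length [x]" by simp
        then have "take i u \<noteq> [x]" by metis
        then show "free_gen x (take i u) * word w c (drop i u) = 0" by (simp add: free_gen_def)
      qed
    qed (auto simp: Cons)
    then show ?thesis by (simp add: Cons word_def free_gen_def)
  qed
qed

lemma word_carrier: "set w \<subseteq> G \<Longrightarrow> word w c \<in> carrier (free_algebra G)"
  by (auto simp: free_algebra_def word_def)

locale hecke_faithful = hecke_params q v n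
  for q :: "'k::field" and v :: "'m::{finite,linorder} \<Rightarrow> 'k" and n +
  fixes \<Psi> :: "(hecke_gen list \<Rightarrow> 'k) \<Rightarrow> (hecke_gen list, 'k) lin"
  assumes hom: "ring_hom_ring (free_algebra (hecke_gens n)) typed_ring \<Psi>"
    and kernel: "a_kernel (free_algebra (hecke_gens n)) typed_ring \<Psi> = hecke_ideal q v n"
    and \<Psi>_scalar: "\<Psi> (free_scalar c) = lin_scalar c"
    and n_pos: "1 \<le> n"
begin

abbreviation F :: "(hecke_gen list \<Rightarrow> 'k) ring" where "F \<equiv> free_algebra (hecke_gens n)"
abbreviation R :: "(hecke_gen list \<Rightarrow> 'k) set ring" where "R \<equiv> hecke q v n"

sublocale \<Psi>: ring_hom_ring F "typed_ring :: (hecke_gen list, 'k) lin ring" \<Psi>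
  by (rule hom)

sublocale R: ring R
  by (rule hecke_ring)

sublocale central_scalars "lin_scalar :: 'k \<Rightarrow> (hecke_gen list, 'k) lin"
  by (rule lin_central_scalars)

text \<open>The map induced by \<open>\<Psi>\<close>, which is constant on each coset of the ideal.
  It is injective because the ideal is the whole kernel.\<close>

definition \<Phi> :: "(hecke_gen list \<Rightarrow> 'k) set \<Rightarrow> (hecke_gen list, 'k) lin" where
  "\<Phi> Y = the_elem (\<Psi> ` Y)"

lemma \<Phi>_class: "f \<in> carrier F \<Longrightarrow> \<Phi> (hecke_class q v n f) = \<Psi> f"
  using \<Psi>.the_elem_simp[of f] by (simp add: \<Phi>_def hecke_class_def kernel)

lemma \<Phi>_hom: "\<Phi> \<in> ring_hom R typed_ring"
  using \<Psi>.the_elem_hom unfolding kernel hecke_def \<Phi>_def .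

lemma \<Phi>_mult: "x \<in> carrier R \<Longrightarrow> y \<in> carrier R \<Longrightarrow> \<Phi> (x \<otimes>\<^bsub>R\<^esub> y) = \<Phi> x * \<Phi> y"
  and \<Phi>_add: "x \<in> carrier R \<Longrightarrow> y \<in> carrier R \<Longrightarrow> \<Phi> (x \<oplus>\<^bsub>R\<^esub> y) = \<Phi> x + \<Phi> y"
  and \<Phi>_one: "\<Phi> \<one>\<^bsub>R\<^esub> = 1"
  using \<Phi>_hom by (auto simp: ring_hom_def)

lemma \<Phi>_minus: "x \<in> carrier R \<Longrightarrow> \<Phi> (\<ominus>\<^bsub>R\<^esub> x) = - \<Phi> x"
  using \<Phi>_add[of "\<ominus>\<^bsub>R\<^esub> x" x] \<Phi>_add[of "\<zero>\<^bsub>R\<^esub>" "\<zero>\<^bsub>R\<^esub>"]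
  by (simp add: R.l_neg eq_neg_iff_add_eq_0)

lemma \<Phi>_inj: "x \<in> carrier R \<Longrightarrow> y \<in> carrier R \<Longrightarrow> \<Phi> x = \<Phi> y \<Longrightarrow> x = y"
  using \<Psi>.the_elem_inj unfolding kernel hecke_def \<Phi>_def by blast

lemma class_carrier: "f \<in> carrier F \<Longrightarrow> hecke_class q v n f \<in> carrier R"
  using \<Psi>.R.a_rcosetsI[of "hecke_ideal q v n" f] ideal.axioms(1)[OF hecke_ideal_ideal, of q v n]
  unfolding hecke_def FactRing_def hecke_class_def
  by (simp add: A_RCOSETS_def' ) blast

lemma carrier_class: "x \<in> carrier R \<Longrightarrow> \<exists>f\<in>carrier F. x = hecke_class q v n f"
  unfolding hecke_def FactRing_def hecke_class_def A_RCOSETS_def' by auto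

lemma relation:
  assumes "(l, r) \<in> hecke_relations q v n"
  shows "\<Psi> l = \<Psi> r"
proof -
  have c: "l \<in> carrier F" "r \<in> carrier F" using hecke_relations_carrier[OF assms] by auto
  have "{l \<ominus>\<^bsub>F\<^esub> r | l r. (l, r) \<in> hecke_relations q v n} \<subseteq> hecke_ideal q v n"
    unfolding hecke_ideal_def
    by (rule \<Psi>.R.genideal_self) (auto dest: hecke_relations_carrier)
  then have "l \<ominus>\<^bsub>F\<^esub> r \<in> hecke_ideal q v n"
    by (rule subsetD) (rule CollectI, rule exI[of _ l], rule exI[of _ r], rule conjI, rule refl, rule assms)
  then have "\<Psi> (l \<ominus>\<^bsub>F\<^esub> r) = 0"
    unfolding kernel[symmetric] a_kernel_def' mem_Collect_eq by (simp only: typed_ring_simps)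
  moreover have "\<Psi> (l \<ominus>\<^bsub>F\<^esub> r) = \<Psi> l + - \<Psi> r"
    unfolding a_minus_def \<Psi>.hom_add[OF c(1) \<Psi>.R.a_inv_closed[OF c(2)]] \<Psi>.hom_a_inv[OF c(2)] typed_ring_a_inv
    by (simp only: typed_ring_simps)
  ultimately show ?thesis by (simp only: add_eq_0_iff2 minus_minus)
qed

definition t :: "(hecke_gen list, 'k) lin" where "t = \<Psi> (free_gen Tau)"
definition s :: "nat \<Rightarrow> (hecke_gen list, 'k) lin" where "s i = \<Psi> (free_gen (Sigma i))"

lemma gen_in_F: "x \<in> hecke_gens n \<Longrightarrow> free_gen x \<in> carrier F"
  by (rule free_gen_carrier)

lemma sigma_in_F: "1 \<le> i \<Longrightarrow> i < n \<Longrightarrow> free_gen (Sigma i) \<in> carrier F"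
  and tau_in_F: "1 \<le> n \<Longrightarrow> free_gen Tau \<in> carrier F"
  by (rule gen_in_F, simp add: hecke_gens_def)+

lemma \<Psi>_cyclotomic:
  assumes "1 \<le> n"
  shows "foldr (\<lambda>j p. (free_gen Tau \<ominus>\<^bsub>F\<^esub> free_scalar (v j)) \<otimes>\<^bsub>F\<^esub> p) js \<one>\<^bsub>F\<^esub> \<in> carrier F \<and>
    \<Psi> (foldr (\<lambda>j p. (free_gen Tau \<ominus>\<^bsub>F\<^esub> free_scalar (v j)) \<otimes>\<^bsub>F\<^esub> p) js \<one>\<^bsub>F\<^esub>)
    = pev t (prod_list (map (\<lambda>j. [:- v j, 1:]) js))"
proof (induction js)
  case Nil
  show ?case using \<Psi>.hom_one by simp
next
  case (Cons j js)
  have "\<Psi> (free_gen Tau \<ominus>\<^bsub>F\<^esub> free_scalar (v j)) = pev t [:- v j, 1:]"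
    using tau_in_F[OF assms] free_scalar_carrier[of "v j" "hecke_gens n"]
    by (simp add: a_minus_def typed_ring_a_inv t_def \<Psi>_scalar emb_1 emb_minus)
  then show ?case
    using Cons tau_in_F[OF assms] free_scalar_carrier[of "v j" "hecke_gens n"]
    by (simp only: foldr_Cons o_apply list.map prod_list.Cons pev_mult)
      (simp add: pev_mult \<Psi>.hom_mult del: pev_pCons mult_pCons_left)
qed

sublocale hecke_algebra "lin_scalar :: 'k \<Rightarrow> (hecke_gen list, 'k) lin" q v n t s
proof unfold_locales
  note mult = \<Psi>.hom_mult[unfolded typed_ring_simps]
  show "s i * s i = scl (q - inverse q) (s i) + 1" if i: "1 \<le> i" "i < n" for i
  proof -
    have "(free_gen (Sigma i) \<otimes>\<^bsub>F\<^esub> free_gen (Sigma i),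
        free_scalar (q - inverse q) \<otimes>\<^bsub>F\<^esub> free_gen (Sigma i) \<oplus>\<^bsub>F\<^esub> \<one>\<^bsub>F\<^esub>) \<in> hecke_relations q v n"
      unfolding hecke_relations_def Let_def
      by (rule UnI1, rule UnI2, rule CollectI, rule exI[of _ i]) (use i in simp)
    from relation[OF this] show ?thesis
      using sigma_in_F[OF i] free_scalar_carrier[of "q - inverse q" "hecke_gens n"]
      by (simp add: mult s_def \<Psi>_scalar)
  qed
  show "s i * s (Suc i) * s i = s (Suc i) * s i * s (Suc i)" if i: "1 \<le> i" "Suc i < n" for i
  proof -
    have "(free_gen (Sigma i) \<otimes>\<^bsub>F\<^esub> free_gen (Sigma (i + 1)) \<otimes>\<^bsub>F\<^esub> free_gen (Sigma i),
        free_gen (Sigma (i + 1)) \<otimes>\<^bsub>F\<^esub> free_gen (Sigma i) \<otimes>\<^bsub>F\<^esub> free_gen (Sigma (i + 1))) \<in> hecke_relations q v n"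
      unfolding hecke_relations_def Let_def
      by (rule UnI1, rule UnI1, rule UnI1, rule UnI1, rule UnI1, rule CollectI, rule exI[of _ i]) (use i in simp)
    from relation[OF this] show ?thesis
      using sigma_in_F[of i] sigma_in_F[of "Suc i"] i by (simp add: mult s_def)
  qed
  show "s i * s j = s j * s i" if ij: "1 \<le> i" "Suc i < j" "j < n" for i j
  proof -
    have "(free_gen (Sigma i) \<otimes>\<^bsub>F\<^esub> free_gen (Sigma j), free_gen (Sigma j) \<otimes>\<^bsub>F\<^esub> free_gen (Sigma i)) \<in> hecke_relations q v n"
      unfolding hecke_relations_def Let_def
      by (rule UnI1, rule UnI1, rule UnI1, rule UnI1, rule UnI2, rule CollectI, rule exI[of _ i], rule exI[of _ j])
        (use ij in simp)
    from relation[OF this] show ?thesis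
      using sigma_in_F[of i] sigma_in_F[of j] ij by (simp add: mult s_def)
  qed
  show "t * s 1 * t * s 1 = s 1 * t * s 1 * t" if n: "1 < n"
  proof -
    have "(free_gen Tau \<otimes>\<^bsub>F\<^esub> free_gen (Sigma 1) \<otimes>\<^bsub>F\<^esub> free_gen Tau \<otimes>\<^bsub>F\<^esub> free_gen (Sigma 1),
        free_gen (Sigma 1) \<otimes>\<^bsub>F\<^esub> free_gen Tau \<otimes>\<^bsub>F\<^esub> free_gen (Sigma 1) \<otimes>\<^bsub>F\<^esub> free_gen Tau) \<in> hecke_relations q v n"
      unfolding hecke_relations_def Let_def
      by (rule UnI1, rule UnI1, rule UnI1, rule UnI2) (use n in simp)
    from relation[OF this] show ?thesis
      using sigma_in_F[of 1] tau_in_F n by (simp add: mult s_def t_def)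
  qed
  show "t * s i = s i * t" if i: "1 < i" "i < n" for i
  proof -
    have "(free_gen Tau \<otimes>\<^bsub>F\<^esub> free_gen (Sigma i), free_gen (Sigma i) \<otimes>\<^bsub>F\<^esub> free_gen Tau) \<in> hecke_relations q v n"
      unfolding hecke_relations_def Let_def
      by (rule UnI1, rule UnI1, rule UnI2, rule CollectI, rule exI[of _ i]) (use i in simp)
    from relation[OF this] show ?thesis
      using sigma_in_F[of i] tau_in_F i by (simp add: mult s_def t_def)
  qed
  show "pev t (\<Prod>j\<in>UNIV. [:- v j, 1:]) = 0"
  proof -
    note n = n_pos
    have "(foldr (\<lambda>j p. (free_gen Tau \<ominus>\<^bsub>F\<^esub> free_scalar (v j)) \<otimes>\<^bsub>F\<^esub> p) (sorted_list_of_set UNIV) \<one>\<^bsub>F\<^esub>, \<zero>\<^bsub>F\<^esub>)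
        \<in> hecke_relations q v n"
      unfolding hecke_relations_def Let_def by (rule UnI2) (use n in simp)
    from relation[OF this] have "pev t (prod_list (map (\<lambda>j. [:- v j, 1:]) (sorted_list_of_set UNIV))) = 0"
      using \<Psi>_cyclotomic[OF n] \<Psi>.hom_zero by simp
    then show ?thesis
      using prod.distinct_set_conv_list[of "sorted_list_of_set (UNIV :: 'm set)" "\<lambda>j. [:- v j, 1:]"] by simp
  qed
qed

text \<open>Induction over a finite set containing the support, splitting off one monomial at a
  time.\<close>

lemma \<Psi>_in_H:
  assumes "f \<in> carrier F"
  shows "\<Psi> f \<in> H n"
proof -
  have gen: "\<Psi> (free_gen x) \<in> H n" if "x \<in> hecke_gens n" for x
    using that by (intro alg.gen) (auto simp: hecke_gens_def gens_def t_def[symmetric] s_def[symmetric] split: if_splits)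
  have word: "\<Psi> (word w c) \<in> H n" if "set w \<subseteq> hecke_gens n" for w c
    using that
  proof (induction w)
    case (Cons x w)
    have "\<Psi> (word (x # w) c) = \<Psi> (free_gen x \<otimes>\<^bsub>F\<^esub> word w c)"
      by (simp add: word_Cons free_algebra_simps)
    also have "\<dots> = \<Psi> (free_gen x) * \<Psi> (word w c)"
      using Cons.prems \<Psi>.hom_mult[of "free_gen x" "word w c"]
      by (simp add: word_carrier gen_in_F)
    finally show ?case using Cons gen[of x] by (simp add: alg.mult)
  qed (simp add: word_Nil \<Psi>_scalar alg.scalar)
  have "\<Psi> f \<in> H n" if "finite W" "{w. f w \<noteq> 0} \<subseteq> W" "f \<in> carrier F" for W f
    using that
  proof (induction W arbitrary: f)
    case empty
    then have "f = \<zero>\<^bsub>F\<^esub>" by (auto simp: free_algebra_def)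
    then show ?case using \<Psi>.hom_zero by (simp add: alg_0)
  next
    case (insert w W)
    define g where "g = f(w := 0)"
    have "{u. g u \<noteq> 0} \<subseteq> {u. f u \<noteq> 0}" by (auto simp: g_def)
    then have g: "g \<in> carrier F"
      using insert.prems(2) unfolding free_algebra_def by (auto dest: finite_subset)
    have gW: "\<Psi> g \<in> H n"
      by (rule insert.IH[OF _ g]) (use insert.prems in \<open>auto simp: g_def\<close>)
    show ?case
    proof (cases "f w = 0")
      case True
      then have "g = f" by (auto simp: g_def)
      with gW show ?thesis by simp
    next
      case False
      then have w: "set w \<subseteq> hecke_gens n" using insert.prems(2) by (auto simp: free_algebra_def)
      have "f = g \<oplus>\<^bsub>F\<^esub> word w (f w)"
        by (auto simp: free_algebra_simps g_def word_def fun_eq_iff)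
      then have "\<Psi> f = \<Psi> g + \<Psi> (word w (f w))"
        using \<Psi>.hom_add[OF g word_carrier[OF w, of "f w"]] by simp
      then show ?thesis using gW word[OF w] by (simp add: alg.add)
    qed
  qed
  then show ?thesis using assms by (auto simp: free_algebra_def)
qed

lemma \<Phi>_in_H: "x \<in> carrier R \<Longrightarrow> \<Phi> x \<in> H n"
  using carrier_class \<Phi>_class \<Psi>_in_H by metis

lemma scalars_carrier: "hecke_scalars q v n \<subseteq> carrier R"
  by (auto simp: hecke_scalars_def intro: class_carrier free_scalar_carrier)

lemma \<Phi>_generated:
  assumes "S \<subseteq> carrier R"
  shows "\<Phi> ` generated_subalgebra (hecke_scalars q v n) R S = alg (\<Phi> ` S)"
    and "generated_subalgebra (hecke_scalars q v n) R S \<subseteq> carrier R"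
proof -
  have KS: "hecke_scalars q v n \<union> S \<subseteq> carrier R" using assms scalars_carrier by auto
  show sub: "generated_subalgebra (hecke_scalars q v n) R S \<subseteq> carrier R"
    unfolding generated_subalgebra_def by (rule R.generate_ring_incl[OF KS])
  have \<Phi>_scalar: "\<Phi> (hecke_class q v n (free_scalar c)) = lin_scalar c" for c
    by (simp add: \<Phi>_class free_scalar_carrier \<Psi>_scalar)
  have "\<Phi> x \<in> alg (\<Phi> ` S)" if "x \<in> generate_ring R (hecke_scalars q v n \<union> S)" for x
    using that
  proof (induction rule: generate_ring.induct)
    case one
    then show ?case by (simp add: \<Phi>_one alg_1)
  next
    case (incl h)
    then show ?case by (auto simp: hecke_scalars_def \<Phi>_scalar intro: alg.intros)
  next
    case (a_inv h)
    then show ?case using R.generate_ring_in_carrier[OF KS] by (simp add: \<Phi>_minus alg_uminus)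
  next
    case (eng_add h1 h2)
    then show ?case using R.generate_ring_in_carrier[OF KS] by (simp add: \<Phi>_add alg.add)
  next
    case (eng_mult h1 h2)
    then show ?case using R.generate_ring_in_carrier[OF KS] by (simp add: \<Phi>_mult alg.mult)
  qed
  moreover have "y \<in> \<Phi> ` generate_ring R (hecke_scalars q v n \<union> S)" if "y \<in> alg (\<Phi> ` S)" for y
    using that
  proof induction
    case (scalar a)
    show ?case
      by (rule image_eqI[of _ _ "hecke_class q v n (free_scalar a)"])
        (auto intro: generate_ring.incl simp: hecke_scalars_def \<Phi>_scalar)
  next
    case (gen x)
    then show ?case by (auto intro: generate_ring.incl)
  next
    case (add x y)
    then obtain x' y' where "x = \<Phi> x'" "y = \<Phi> y'"
      "x' \<in> generate_ring R (hecke_scalars q v n \<union> S)" "y' \<in> generate_ring R (hecke_scalars q v n \<union> S)"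
      by blast
    then show ?case using R.generate_ring_in_carrier[OF KS]
      by (intro image_eqI[of _ _ "x' \<oplus>\<^bsub>R\<^esub> y'"]) (auto simp: \<Phi>_add intro: generate_ring.eng_add)
  next
    case (mult x y)
    then obtain x' y' where "x = \<Phi> x'" "y = \<Phi> y'"
      "x' \<in> generate_ring R (hecke_scalars q v n \<union> S)" "y' \<in> generate_ring R (hecke_scalars q v n \<union> S)"
      by blast
    then show ?case using R.generate_ring_in_carrier[OF KS]
      by (intro image_eqI[of _ _ "x' \<otimes>\<^bsub>R\<^esub> y'"]) (auto simp: \<Phi>_mult intro: generate_ring.eng_mult)
  qed
  ultimately show "\<Phi> ` generated_subalgebra (hecke_scalars q v n) R S = alg (\<Phi> ` S)"
    unfolding generated_subalgebra_def by blast
qed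

text \<open>Injectivity of \<open>\<Phi>\<close> reflects membership; together with
  \<open>\<Phi>_commute_iff\<close> it turns the claims on the quotient into claims on
  \<open>H\<close> and \<open>X\<close>.\<close>

lemma generated_iff:
  assumes "S \<subseteq> carrier R" "x \<in> carrier R"
  shows "x \<in> generated_subalgebra (hecke_scalars q v n) R S \<longleftrightarrow> \<Phi> x \<in> alg (\<Phi> ` S)"
proof -
  have in_gen: "x \<in> generated_subalgebra (hecke_scalars q v n) R S"
    if "\<Phi> x \<in> \<Phi> ` generated_subalgebra (hecke_scalars q v n) R S"
  proof -
    from that obtain y where y: "\<Phi> x = \<Phi> y" "y \<in> generated_subalgebra (hecke_scalars q v n) R S"
      by (rule imageE)
    then have "y \<in> carrier R" using \<Phi>_generated(2)[OF assms(1)] by (auto simp only: subset_iff)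
    then have "x = y" using \<Phi>_inj[OF assms(2)] y(1) by simp
    then show ?thesis using y(2) by simp
  qed
  show ?thesis
    unfolding \<Phi>_generated(1)[OF assms(1), symmetric]
  proof
    assume "x \<in> generated_subalgebra (hecke_scalars q v n) R S"
    then show "\<Phi> x \<in> \<Phi> ` generated_subalgebra (hecke_scalars q v n) R S" by (rule imageI)
  qed (rule in_gen)
qed

lemma \<Phi>_commute_iff:
  assumes "x \<in> carrier R" "y \<in> carrier R"
  shows "x \<otimes>\<^bsub>R\<^esub> y = y \<otimes>\<^bsub>R\<^esub> x \<longleftrightarrow> \<Phi> x * \<Phi> y = \<Phi> y * \<Phi> x"
  using \<Phi>_inj[of "x \<otimes>\<^bsub>R\<^esub> y" "y \<otimes>\<^bsub>R\<^esub> x"] assms by (auto simp flip: \<Phi>_mult)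

lemma generated_subcring:
  assumes "S \<subseteq> carrier R" "\<And>x y. x \<in> S \<Longrightarrow> y \<in> S \<Longrightarrow> x \<otimes>\<^bsub>R\<^esub> y = y \<otimes>\<^bsub>R\<^esub> x"
  shows "subcring (generated_subalgebra (hecke_scalars q v n) R S) R"
proof (rule R.subcringI)
  show "subring (generated_subalgebra (hecke_scalars q v n) R S) R"
    unfolding generated_subalgebra_def
    by (rule R.generate_ring_is_subring) (use assms scalars_carrier in auto)
  fix x y assume xy: "x \<in> generated_subalgebra (hecke_scalars q v n) R S" "y \<in> generated_subalgebra (hecke_scalars q v n) R S"
  then have c: "x \<in> carrier R" "y \<in> carrier R"
    using \<Phi>_generated(2)[OF assms(1)] by (simp_all only: subsetD)
  have "\<Phi> x * \<Phi> y = \<Phi> y * \<Phi> x"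
  proof (rule alg_commutative)
    show "\<Phi> x \<in> alg (\<Phi> ` S)" by (rule iffD1[OF generated_iff[OF assms(1) c(1)] xy(1)])
    show "\<Phi> y \<in> alg (\<Phi> ` S)" by (rule iffD1[OF generated_iff[OF assms(1) c(2)] xy(2)])
    fix a b assume "a \<in> \<Phi> ` S" "b \<in> \<Phi> ` S"
    then obtain a' b' where ab: "a = \<Phi> a'" "a' \<in> S" "b = \<Phi> b'" "b' \<in> S"
      by (elim imageE)
    have "a' \<in> carrier R" "b' \<in> carrier R" using ab assms(1) by (simp_all only: subsetD)
    then show "a * b = b * a"
      unfolding ab(1,3) using assms(2)[OF ab(2,4)] by (rule iffD1[OF \<Phi>_commute_iff])
  qed
  then show "x \<otimes>\<^bsub>R\<^esub> y = y \<otimes>\<^bsub>R\<^esub> x" by (rule iffD2[OF \<Phi>_commute_iff[OF c]])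
qed

lemma gens_image:
  assumes "k \<le> n"
  shows "(\<lambda>x. hecke_class q v n (free_gen x)) ` hecke_gens k \<subseteq> carrier R"
    "\<Phi> ` (\<lambda>x. hecke_class q v n (free_gen x)) ` hecke_gens k = gens k"
proof -
  have sub: "hecke_gens k \<subseteq> hecke_gens n" using assms by (auto simp: hecke_gens_def split: if_splits)
  then show "(\<lambda>x. hecke_class q v n (free_gen x)) ` hecke_gens k \<subseteq> carrier R"
    by (auto intro: class_carrier gen_in_F)
  have "\<Phi> ` (\<lambda>x. hecke_class q v n (free_gen x)) ` hecke_gens k = (\<lambda>x. \<Psi> (free_gen x)) ` hecke_gens k"
    unfolding image_image by (rule image_cong[OF refl]) (use sub in \<open>auto intro: \<Phi>_class gen_in_F\<close>)
  also have "\<dots> = gens k"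
    by (auto simp: hecke_gens_def gens_def t_def[symmetric] s_def[symmetric] image_image)
  finally show "\<Phi> ` (\<lambda>x. hecke_class q v n (free_gen x)) ` hecke_gens k = gens k" .
qed

lemma \<Phi>_hecke_sub:
  assumes "k \<le> n"
  shows "\<Phi> ` hecke_sub q v n k = H k" "hecke_sub q v n k \<subseteq> carrier R"
  using \<Phi>_generated[OF gens_image(1)[OF assms]] gens_image(2)[OF assms]
  unfolding hecke_sub_def by simp_all

lemma \<Phi>_jucys_murphy:
  "i < n \<Longrightarrow> jucys_murphy q v n (Suc i) \<in> carrier R \<and> \<Phi> (jucys_murphy q v n (Suc i)) = X i"
proof (induction i)
  case 0
  then show ?case by (simp add: class_carrier \<Phi>_class tau_in_F t_def[symmetric])
next
  case (Suc i)
  have "sigma q v n (Suc i) \<in> carrier R" "\<Phi> (sigma q v n (Suc i)) = s (Suc i)"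
    using Suc.prems by (simp_all add: class_carrier \<Phi>_class sigma_in_F s_def[symmetric])
  then show ?case using Suc by (simp add: \<Phi>_mult X.simps(2))
qed

theorem hecke_centralizers:
  defines "K \<equiv> hecke_scalars q v n" and "A \<equiv> hecke_sub q v n (n - 1)" and "J \<equiv> jucys_murphy q v n"
  shows "subcring (centralizer R A) R"
    and "centralizer R A = generated_subalgebra K R (center_of R A \<union> {J n})"
    and "maximal_commutative K R (generated_subalgebra K R (J ` {1..n}))"
proof -
  obtain k where n: "n = Suc k" using n_pos by (cases n) auto
  have A: "A \<subseteq> carrier R" "\<Phi> ` A = H k" using \<Phi>_hecke_sub[of k] by (simp_all add: A_def n)
  have Jn: "J n \<in> carrier R" "\<Phi> (J n) = X k" using \<Phi>_jucys_murphy[of k] by (simp_all add: n J_def)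
  define Z where "Z = center_of R A"
  have Z: "Z \<subseteq> A" "Z \<subseteq> carrier R" using A by (auto simp: Z_def center_of_def)
  have commute_A: "(\<forall>a\<in>A. x \<otimes>\<^bsub>R\<^esub> a = a \<otimes>\<^bsub>R\<^esub> x) \<longleftrightarrow> (\<forall>y\<in>H k. \<Phi> x * y = y * \<Phi> x)" if "x \<in> carrier R" for x
  proof -
    have "(\<forall>a\<in>A. x \<otimes>\<^bsub>R\<^esub> a = a \<otimes>\<^bsub>R\<^esub> x) \<longleftrightarrow> (\<forall>a\<in>A. \<Phi> x * \<Phi> a = \<Phi> a * \<Phi> x)"
      by (rule ball_cong[OF refl], rule \<Phi>_commute_iff[OF that], rule subsetD[OF A(1)])
    then show ?thesis unfolding A(2)[symmetric] by (simp only: ball_simps)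
  qed
  have \<Phi>_Z: "\<Phi> ` Z = {z \<in> H k. \<forall>y\<in>H k. z * y = y * z}"
  proof -
    have "Z = {x \<in> A. \<forall>y\<in>H k. \<Phi> x * y = y * \<Phi> x}"
      unfolding Z_def center_of_def
      by (intro Collect_cong conj_cong refl commute_A) (rule subsetD[OF A(1)])
    then show ?thesis by (auto simp only: A(2)[symmetric])
  qed
  have ZJ: "Z \<union> {J n} \<subseteq> carrier R" using Z Jn by auto
  have \<Phi>_ZJ: "\<Phi> ` (Z \<union> {J n}) = insert (X k) {z \<in> H k. \<forall>y\<in>H k. z * y = y * z}"
    by (simp add: image_Un \<Phi>_Z Jn)
  have Xk: "X k * y = y * X k" if "y \<in> H k" for y using X_H_commute[OF that] n by simp
  show eq: "centralizer R A = generated_subalgebra K R (center_of R A \<union> {J n})"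
  proof (rule equalityI; rule subsetI)
    fix x assume "x \<in> centralizer R A"
    then have x: "x \<in> carrier R" "\<forall>a\<in>A. x \<otimes>\<^bsub>R\<^esub> a = a \<otimes>\<^bsub>R\<^esub> x"
      unfolding centralizer_def by simp_all
    have "\<forall>y\<in>H k. \<Phi> x * y = y * \<Phi> x" by (rule iffD1[OF commute_A[OF x(1)] x(2)])
    then have "\<Phi> x \<in> alg (\<Phi> ` (Z \<union> {J n}))"
      unfolding \<Phi>_ZJ by (intro commuting_with_H[OF n \<Phi>_in_H[OF x(1)]]) (rule bspec)
    then show "x \<in> generated_subalgebra K R (center_of R A \<union> {J n})"
      unfolding K_def Z_def[symmetric] by (rule iffD2[OF generated_iff[OF ZJ x(1)]])
  next
    fix x assume x: "x \<in> generated_subalgebra K R (center_of R A \<union> {J n})"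
    then have xc: "x \<in> carrier R"
      unfolding K_def Z_def[symmetric] by (rule subsetD[OF \<Phi>_generated(2)[OF ZJ]])
    have \<Phi>_x: "\<Phi> x \<in> alg (insert (X k) {z \<in> H k. \<forall>y\<in>H k. z * y = y * z})"
      using x unfolding K_def Z_def[symmetric] \<Phi>_ZJ[symmetric] by (rule iffD1[OF generated_iff[OF ZJ xc]])
    have "\<Phi> x * y = y * \<Phi> x" if y: "y \<in> H k" for y
      by (rule sym, rule alg_commute[OF \<Phi>_x]) (use Xk[OF y] y in force)
    then have "\<forall>a\<in>A. x \<otimes>\<^bsub>R\<^esub> a = a \<otimes>\<^bsub>R\<^esub> x" by (intro iffD2[OF commute_A[OF xc]] ballI)
    then show "x \<in> centralizer R A" unfolding centralizer_def using xc by (intro CollectI conjI)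
  qed
  have comm: "x \<otimes>\<^bsub>R\<^esub> y = y \<otimes>\<^bsub>R\<^esub> x" if xy: "x \<in> Z \<union> {J n}" "y \<in> Z \<union> {J n}" for x y
  proof -
    have "\<Phi> x \<in> \<Phi> ` (Z \<union> {J n})" "\<Phi> y \<in> \<Phi> ` (Z \<union> {J n})" by (rule imageI, rule xy)+
    then have "\<Phi> x = X k \<or> \<Phi> x \<in> H k \<and> (\<forall>z\<in>H k. \<Phi> x * z = z * \<Phi> x)"
      "\<Phi> y = X k \<or> \<Phi> y \<in> H k \<and> (\<forall>z\<in>H k. \<Phi> y * z = z * \<Phi> y)"
      unfolding \<Phi>_ZJ by (simp_all only: insert_iff mem_Collect_eq)
    then have "\<Phi> x * \<Phi> y = \<Phi> y * \<Phi> x" by (metis Xk)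
    then show ?thesis by (rule iffD2[OF \<Phi>_commute_iff[OF subsetD[OF ZJ xy(1)] subsetD[OF ZJ xy(2)]]])
  qed
  show "subcring (centralizer R A) R"
    unfolding eq K_def Z_def[symmetric] by (rule generated_subcring[OF ZJ comm])
  \<comment> \<open>Index shift: \<open>J\<close> counts from 1, \<open>X\<close> from 0.\<close>
  have J_X: "J i \<in> carrier R \<and> \<Phi> (J i) = X (i - 1)" if "i \<in> {1..n}" for i
    using \<Phi>_jucys_murphy[of "i - 1"] that by (auto simp: J_def)
  then have J: "J ` {1..n} \<subseteq> carrier R" by auto
  have "\<Phi> ` J ` {1..n} = (\<lambda>i. X (i - 1)) ` {1..n}"
    unfolding image_image by (rule image_cong) (use J_X in auto)
  also have "\<dots> = X ` {..<n}"
  proof (rule equalityI; rule subsetI)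
    fix y assume "y \<in> X ` {..<n}"
    then obtain i where "y = X i" "i < n" by (elim imageE) simp
    then show "y \<in> (\<lambda>i. X (i - 1)) ` {1..n}" by (intro image_eqI[of _ _ "Suc i"]) auto
  qed auto
  finally have \<Phi>_J: "\<Phi> ` J ` {1..n} = X ` {..<n}" .
  have J_comm: "x \<otimes>\<^bsub>R\<^esub> y = y \<otimes>\<^bsub>R\<^esub> x" if "x \<in> J ` {1..n}" "y \<in> J ` {1..n}" for x y
  proof -
    have "\<Phi> x \<in> X ` {..<n}" "\<Phi> y \<in> X ` {..<n}"
      unfolding \<Phi>_J[symmetric] by (rule imageI, rule that)+
    then obtain i j where "\<Phi> x = X i" "i < n" "\<Phi> y = X j" "j < n" by (elim imageE) simp
    then have "\<Phi> x * \<Phi> y = \<Phi> y * \<Phi> x" using X_commute[of i j] by simp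
    then show ?thesis by (rule iffD2[OF \<Phi>_commute_iff[OF subsetD[OF J that(1)] subsetD[OF J that(2)]]])
  qed
  show "maximal_commutative K R (generated_subalgebra K R (J ` {1..n}))"
    unfolding maximal_commutative_def
  proof (intro conjI allI impI)
    show "subcring (generated_subalgebra K R (J ` {1..n})) R"
      unfolding K_def by (rule generated_subcring[OF J J_comm])
    show "K \<subseteq> generated_subalgebra K R (J ` {1..n})"
      by (auto simp: generated_subalgebra_def intro: generate_ring.incl)
    fix B assume B: "subcring B R \<and> K \<subseteq> B \<and> generated_subalgebra K R (J ` {1..n}) \<subseteq> B"
    have J_gen: "J i \<in> B" if "i \<in> {1..n}" for i
    proof -
      have "J i \<in> generated_subalgebra K R (J ` {1..n})"
        unfolding generated_subalgebra_def by (rule generate_ring.incl, rule UnI2, rule imageI, rule that)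
      then show ?thesis using B by (intro subsetD[of _ B]) simp_all
    qed
    have "b \<in> generated_subalgebra K R (J ` {1..n})" if b: "b \<in> B" for b
    proof -
      have "B \<subseteq> carrier R" using B by (intro subcringE(1)) simp
      then have bc: "b \<in> carrier R" using b by (rule subsetD)
      have "\<Phi> b * X i = X i * \<Phi> b" if "i < n" for i
      proof -
        have i: "Suc i \<in> {1..n}" using that by simp
        have "b \<otimes>\<^bsub>R\<^esub> J (Suc i) = J (Suc i) \<otimes>\<^bsub>R\<^esub> b"
          by (rule subcring.sub_m_comm[OF conjunct1[OF B] b J_gen[OF i]])
        from iffD1[OF \<Phi>_commute_iff[OF bc conjunct1[OF J_X[OF i]]] this] show ?thesis
          using conjunct2[OF J_X[OF i]] by simp
      qed
      then have "\<Phi> b \<in> alg (\<Phi> ` J ` {1..n})"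
        unfolding \<Phi>_J by (rule commuting_with_X[OF \<Phi>_in_H[OF bc]])
      then show ?thesis unfolding K_def by (rule iffD2[OF generated_iff[OF J bc]])
    qed
    then have "B \<subseteq> generated_subalgebra K R (J ` {1..n})" by (rule subsetI)
    then show "B = generated_subalgebra K R (J ` {1..n})"
      using B by (intro equalityI) simp_all
  qed
qed

end

text \<open>\<open>q\<close> is a root of \<open>x^2 = (q - 1/q) x + 1\<close>, and any
  \<open>v j\<close> makes the cyclotomic product vanish. The resulting character is the
  \<open>\<epsilon>\<close> required by \<open>faithful_representation\<close>.\<close>

lemma hecke_ideal_character:
  fixes q :: "'k::field" and v :: "'m::{finite,linorder} \<Rightarrow> 'k"
  assumes "q \<noteq> 0" "f \<in> hecke_ideal q v n"
  defines "g \<equiv> (\<lambda>x. case x of Tau \<Rightarrow> v undefined | Sigma i \<Rightarrow> q)"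
  shows "character g f = 0"
proof -
  define F where "F = (free_algebra (hecke_gens n) :: (hecke_gen list \<Rightarrow> 'k) ring)"
  have hom: "ring_hom_ring F (typed_ring :: 'k ring) (character g)"
  proof (rule ring_hom_ringI)
    show "ring F" "ring (typed_ring :: 'k ring)" by (simp_all add: F_def free_algebra_ring ring_typed_ring)
    show "character g (x \<otimes>\<^bsub>F\<^esub> y) = character g x \<otimes>\<^bsub>typed_ring\<^esub> character g y"
      if "x \<in> carrier F" "y \<in> carrier F" for x y
      using character_mult[of x _ y g] that by (simp add: F_def free_algebra_simps)
    show "character g (x \<oplus>\<^bsub>F\<^esub> y) = character g x \<oplus>\<^bsub>typed_ring\<^esub> character g y"
      if "x \<in> carrier F" "y \<in> carrier F" for x y
      using character_add[of x _ y g] that by (simp add: F_def free_algebra_simps)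
    show "character g \<one>\<^bsub>F\<^esub> = \<one>\<^bsub>typed_ring\<^esub>"
      by (simp add: F_def free_algebra_simps character_scalar)
  qed simp
  interpret h: ring_hom_ring F "typed_ring :: 'k ring" "character g" by (rule hom)
  note mult = h.hom_mult[unfolded typed_ring_simps] and add = h.hom_add[unfolded typed_ring_simps]
  have gen: "free_gen x \<in> carrier F" if "x \<in> hecke_gens n" for x
    unfolding F_def by (rule free_gen_carrier[OF that])
  have scalar: "free_scalar c \<in> carrier F" for c
    unfolding F_def by (rule free_scalar_carrier)
  have s: "free_gen (Sigma i) \<in> carrier F" if "1 \<le> i" "i < n" for i
    using that by (intro gen) (auto simp: hecke_gens_def)
  have t: "free_gen Tau \<in> carrier F" if "1 \<le> n"
    using that by (intro gen) (auto simp: hecke_gens_def)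
  have cg: "character g (free_gen (Sigma i)) = q" "character g (free_gen Tau) = v undefined" for i
    by (simp_all add: character_gen g_def)
  have minus: "character g (x \<ominus>\<^bsub>F\<^esub> y) = character g x - character g y"
    if "x \<in> carrier F" "y \<in> carrier F" for x y
    unfolding a_minus_def add[OF that(1) h.R.a_inv_closed[OF that(2)]] h.hom_a_inv[OF that(2)] typed_ring_a_inv
    by simp
  have cyc: "foldr (\<lambda>j p. (free_gen Tau \<ominus>\<^bsub>F\<^esub> free_scalar (v j)) \<otimes>\<^bsub>F\<^esub> p) js \<one>\<^bsub>F\<^esub> \<in> carrier F \<and>
    character g (foldr (\<lambda>j p. (free_gen Tau \<ominus>\<^bsub>F\<^esub> free_scalar (v j)) \<otimes>\<^bsub>F\<^esub> p) js \<one>\<^bsub>F\<^esub>)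
      = prod_list (map (\<lambda>j. v undefined - v j) js)" if n: "1 \<le> n" for js
  proof (induction js)
    case Nil
    show ?case using h.hom_one by simp
  next
    case (Cons j js)
    have c: "free_gen Tau \<ominus>\<^bsub>F\<^esub> free_scalar (v j) \<in> carrier F"
      by (rule h.R.minus_closed[OF t[OF n] scalar])
    show ?case
      using h.R.m_closed[OF c conjunct1[OF Cons]]
      by (simp add: mult[OF c conjunct1[OF Cons]] conjunct2[OF Cons] minus[OF t[OF n] scalar] cg character_scalar)
  qed
  have rel: "character g l = character g r" if in_rel: "(l, r) \<in> hecke_relations q v n" for l r
  proof -
    have square: "(q - inverse q) * q + 1 = q * q" using assms(1) by (simp add: left_diff_distrib)
    have "prod_list (map (\<lambda>j. v undefined - v j) (sorted_list_of_set UNIV)) = 0"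
      by (simp add: prod_list_zero_iff image_iff exI[of _ undefined])
    then have cyc0: "character g (foldr (\<lambda>j p. (free_gen Tau \<ominus>\<^bsub>F\<^esub> free_scalar (v j)) \<otimes>\<^bsub>F\<^esub> p)
      (sorted_list_of_set UNIV) \<one>\<^bsub>F\<^esub>) = 0" if "1 \<le> n"
      using cyc[OF that] by simp
    show ?thesis
      using in_rel h.hom_one h.hom_zero unfolding hecke_relations_def Let_def F_def[symmetric]
      by (auto split: if_splits simp: mult add cg s t scalar character_scalar cyc0 square)
  qed
  have "{l \<ominus>\<^bsub>F\<^esub> r | l r. (l, r) \<in> hecke_relations q v n} \<subseteq> a_kernel F typed_ring (character g)"
  proof
    fix x assume "x \<in> {l \<ominus>\<^bsub>F\<^esub> r | l r. (l, r) \<in> hecke_relations q v n}"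
    then obtain l r where x: "x = l \<ominus>\<^bsub>F\<^esub> r" "(l, r) \<in> hecke_relations q v n" by blast
    have lr: "l \<in> carrier F" "r \<in> carrier F"
      using hecke_relations_carrier[OF x(2)] by (simp_all add: F_def)
    have "character g (l \<ominus>\<^bsub>F\<^esub> r) = \<zero>\<^bsub>typed_ring\<^esub>"
      unfolding minus[OF lr] rel[OF x(2)] by simp
    then show "x \<in> a_kernel F typed_ring (character g)"
      unfolding a_kernel_def' x(1) by (intro CollectI conjI h.R.minus_closed lr)
  qed
  then have "hecke_ideal q v n \<subseteq> a_kernel F typed_ring (character g)"
    unfolding hecke_ideal_def F_def[symmetric]
    by (rule h.R.genideal_minimal[OF h.kernel_is_ideal])
  then have "f \<in> a_kernel F typed_ring (character g)" using assms(2) by (rule subsetD)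
  then show ?thesis unfolding a_kernel_def' by (elim CollectE conjE) (simp only: typed_ring_simps)
qed

lemma hecke_centralizers_params:
  fixes q :: "'k::field" and v :: "'m::{finite,linorder} \<Rightarrow> 'k"
  assumes "hecke_params q v n" "1 \<le> n"
  shows "subcring (centralizer (hecke q v n) (hecke_sub q v n (n - 1))) (hecke q v n)"
    and "centralizer (hecke q v n) (hecke_sub q v n (n - 1)) =
      generated_subalgebra (hecke_scalars q v n) (hecke q v n)
        (center_of (hecke q v n) (hecke_sub q v n (n - 1)) \<union> {jucys_murphy q v n n})"
    and "maximal_commutative (hecke_scalars q v n) (hecke q v n)
      (generated_subalgebra (hecke_scalars q v n) (hecke q v n) (jucys_murphy q v n ` {1..n}))"
proof -
  interpret hecke_params q v n by (rule assms(1))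
  obtain \<Psi> :: "(hecke_gen list \<Rightarrow> 'k) \<Rightarrow> (hecke_gen list, 'k) lin" where \<Psi>: "ring_hom_ring (free_algebra (hecke_gens n)) typed_ring \<Psi>"
    "a_kernel (free_algebra (hecke_gens n)) typed_ring \<Psi> = hecke_ideal q v n"
    "\<And>c. \<Psi> (free_scalar c) = lin_scalar c"
  proof (rule faithful_representation[where G = "hecke_gens n" and I = "hecke_ideal q v n"
        and \<epsilon> = "character (\<lambda>x. case x of Tau \<Rightarrow> v undefined | Sigma i \<Rightarrow> q)"])
    show "ideal (hecke_ideal q v n) (free_algebra (hecke_gens n))" by (rule hecke_ideal_ideal)
    fix \<Psi> :: "(hecke_gen list \<Rightarrow> 'k) \<Rightarrow> (hecke_gen list, 'k) lin"
    assume "ring_hom_ring (free_algebra (hecke_gens n)) typed_ring \<Psi>"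
      "a_kernel (free_algebra (hecke_gens n)) typed_ring \<Psi> = hecke_ideal q v n"
      "\<And>c. \<Psi> (free_scalar c) = lin_scalar c"
    then show thesis by (rule that)
  qed (auto simp: character_scalar hecke_ideal_character[OF q_nonzero] intro: character_add character_mult)
  interpret hecke_faithful q v n \<Psi>
    by (intro hecke_faithful.intro hecke_faithful_axioms.intro assms \<Psi>)
  show "subcring (centralizer (hecke q v n) (hecke_sub q v n (n - 1))) (hecke q v n)"
    by (rule hecke_centralizers(1))
  show "centralizer (hecke q v n) (hecke_sub q v n (n - 1)) =
      generated_subalgebra (hecke_scalars q v n) (hecke q v n)
        (center_of (hecke q v n) (hecke_sub q v n (n - 1)) \<union> {jucys_murphy q v n n})"
    by (rule hecke_centralizers(2))
  show "maximal_commutative (hecke_scalars q v n) (hecke q v n)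
      (generated_subalgebra (hecke_scalars q v n) (hecke q v n) (jucys_murphy q v n ` {1..n}))"
    by (rule hecke_centralizers(3))
qed

section \<open>The two kinds of parameters\<close>

text \<open>For \<open>n \<ge> 2\<close> and \<open>1 \<le> d \<le> n\<close>, both factors of
  \<open>q^(2d) - 1 = (q^2 - 1)(1 + q^2 + ... + q^(2(d-1)))\<close> are nonzero.\<close>

lemma admissible_hecke_params:
  assumes "admissible n q v" "1 \<le> n"
  shows "hecke_params q v n"
proof
  show "q \<noteq> 0" "v j \<noteq> 0" for j using assms by (auto simp: admissible_def)
  show "q powi (2 * i) * v j \<noteq> v k" if "j \<noteq> k" "\<bar>i\<bar> < int n" for i j k
    using assms that unfolding admissible_def by (metis abs_less_iff minus_less_iff right_minus_eq)
  show "q ^ (2 * d) \<noteq> 1" if d: "2 \<le> n" "1 \<le> d" "d \<le> n" for d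
  proof -
    have "(\<Sum>k\<le>d - 1. q ^ (2 * k)) \<noteq> 0" "q ^ 2 \<noteq> 1"
      using assms d unfolding admissible_def by auto
    moreover have "(\<Sum>k\<le>d - 1. q ^ (2 * k)) = (\<Sum>k<d. (q ^ 2) ^ k)"
      using d by (intro sum.cong) (auto simp: power_mult)
    moreover have "(q ^ 2) ^ d - 1 = (q ^ 2 - 1) * (\<Sum>k<d. (q ^ 2) ^ k)"
      by (rule power_diff_1_eq)
    ultimately have "(q ^ 2) ^ d - 1 \<noteq> 0" by (metis mult_eq_0_iff right_minus_eq)
    then show ?thesis by (simp add: power_mult)
  qed
qed

section \<open>Monomials in the field of rational functions\<close>

definition monomial :: "('m::{finite,linorder} option \<Rightarrow>\<^sub>0 nat) \<Rightarrow> 'm rat_fun" where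
  "monomial \<alpha> = Fract (Poly_Mapping.single \<alpha> 1) 1"

lemma monomial_mult: "monomial \<alpha> * monomial \<beta> = monomial (\<alpha> + \<beta>)"
  by (simp add: monomial_def mult_single)

lemma monomial_0: "monomial 0 = 1"
  by (simp add: monomial_def One_fract_def)

lemma monomial_inject:
  assumes "monomial \<alpha> = monomial \<beta>"
  shows "\<alpha> = \<beta>"
proof -
  have "Poly_Mapping.single \<alpha> (1 :: complex) = Poly_Mapping.single \<beta> 1"
    using assms by (simp add: monomial_def eq_fract)
  then have "Poly_Mapping.lookup (Poly_Mapping.single \<alpha> (1 :: complex)) \<alpha> = Poly_Mapping.lookup (Poly_Mapping.single \<beta> 1) \<alpha>"
    by simp
  then show ?thesis by (simp add: lookup_single when_def split: if_splits)
qed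

lemma monomial_power: "monomial (Poly_Mapping.single x 1) ^ d = monomial (Poly_Mapping.single x d)"
  by (induction d) (simp_all add: monomial_0 monomial_mult flip: single_add)

lemma indet_monomial: "indet x = monomial (Poly_Mapping.single x 1)"
  by (simp add: indet_def monomial_def)

text \<open>A zero monomial would be unchanged by multiplication with \<open>q\<close>, although the
  exponents differ.\<close>

lemma monomial_nonzero: "monomial \<alpha> \<noteq> 0"
proof
  assume "monomial \<alpha> = 0"
  then have "monomial (\<alpha> + Poly_Mapping.single None 1) = monomial \<alpha>"
    by (simp flip: monomial_mult)
  then have "\<alpha> + Poly_Mapping.single None 1 = \<alpha>" by (rule monomial_inject)
  then have "Poly_Mapping.lookup (\<alpha> + Poly_Mapping.single None 1) None = Poly_Mapping.lookup \<alpha> None" by simp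
  then show False by (simp add: lookup_add)
qed

lemma indet_hecke_params:
  "hecke_params (indet None) (\<lambda>j :: 'm::{finite,linorder}. indet (Some j)) n"
proof
  let ?q = "indet None :: 'm rat_fun"
  have nz: "indet x \<noteq> 0" for x :: "'m option" by (simp add: indet_monomial monomial_nonzero)
  then show "?q \<noteq> 0" "indet (Some j) \<noteq> 0" for j :: 'm by auto
  show "?q ^ (2 * d) \<noteq> 1" if "1 \<le> d" for d
  proof
    assume "?q ^ (2 * d) = 1"
    then have "Poly_Mapping.single None (2 * d) = (0 :: 'm option \<Rightarrow>\<^sub>0 nat)"
      unfolding indet_monomial monomial_power monomial_0[symmetric] by (rule monomial_inject)
    then have "Poly_Mapping.lookup (Poly_Mapping.single (None :: 'm option) (2 * d)) None = 0" by simp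
    with that show False by simp
  qed
  have distinct: "?q ^ d * indet (Some j) \<noteq> indet (Some k)" if "j \<noteq> k" for d and j k :: 'm
  proof
    assume "?q ^ d * indet (Some j) = indet (Some k)"
    then have "Poly_Mapping.single None d + Poly_Mapping.single (Some j) 1 = Poly_Mapping.single (Some k) (1 :: nat)"
      unfolding indet_monomial monomial_power monomial_mult by (rule monomial_inject)
    then have "Poly_Mapping.lookup (Poly_Mapping.single None d + Poly_Mapping.single (Some j) 1) (Some j)
        = Poly_Mapping.lookup (Poly_Mapping.single (Some k) (1 :: nat)) (Some j)" by simp
    with that show False by (simp add: lookup_add lookup_single when_def)
  qed
  show "?q powi (2 * i) * indet (Some j) \<noteq> indet (Some k)" if "j \<noteq> k" for i and j k :: 'm
  proof (cases "i \<ge> 0")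
    case True
    then have "?q powi (2 * i) = ?q ^ nat (2 * i)" by (simp add: power_int_def)
    then show ?thesis using distinct[OF that] by simp
  next
    case False
    \<comment> \<open>A negative power of \<open>q\<close> is moved to the other side, which
      exchanges the roles of \<open>j\<close> and \<open>k\<close>.\<close>
    then have "?q powi (2 * i) = inverse (?q ^ nat (- (2 * i)))" by (simp add: power_int_def power_inverse)
    moreover have "indet (Some j) \<noteq> ?q ^ nat (- (2 * i)) * indet (Some k)"
      using distinct[of k j] that by metis
    moreover have "w = p * (inverse p * w)" if "p \<noteq> 0" for w p :: "'m rat_fun"
      using that by simp
    ultimately show ?thesis using nz by (metis power_not_zero)
  qed
qed

theorem mainTheorem13:
  fixes n :: nat
  assumes "n \<ge> 1"
  shows
   "(let q = indet None;
         v = (\<lambda>j :: 'm::{finite,linorder}. indet (Some j));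
         H = hecke q v n;
         K = hecke_scalars q v n;
         A = hecke_sub q v n (n - 1);
         J = jucys_murphy q v n
     in subcring (centralizer H A) H
      \<and> centralizer H A = generated_subalgebra K H (center_of H A \<union> {J n})
      \<and> maximal_commutative K H (generated_subalgebra K H (J ` {1..n})))
  \<and> (\<forall>(q :: complex) (v :: 'm \<Rightarrow> complex). admissible n q v \<longrightarrow>
     (let H = hecke q v n;
          K = hecke_scalars q v n;
          A = hecke_sub q v n (n - 1);
          J = jucys_murphy q v n
      in subcring (centralizer H A) H
       \<and> centralizer H A = generated_subalgebra K H (center_of H A \<union> {J n})
       \<and> maximal_commutative K H (generated_subalgebra K H (J ` {1..n}))))"
  unfolding Let_def
  by (intro conjI allI impI hecke_centralizers_params[OF indet_hecke_params assms]
      hecke_centralizers_params[OF admissible_hecke_params[OF _ assms] assms])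

end
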